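(* Let $\{\mathbf X_t\}=\{(X_{1,t},X_{2,t})^T\}$ be a strictly stationary and ergodic BRCMNBINAR(1) process with known $l$ and true parameter $\boldsymbol\gamma=(m_1,m_2,\mu_1,\mu_2)^T$, and assume $E|X_{i,t}|^4<\infty$ for $i=1,2$. Let $\hat{\boldsymbol\gamma}^{CLS}=(\hat m_1^{CLS},\hat m_2^{CLS},\hat\mu_1^{CLS},\hat\mu_2^{CLS})^T$ be the conditional least squares estimator based on $\mathbf X_1,\dots,\mathbf X_n$, i.e. the minimizer of $$S_1(\boldsymbol\gamma)=\sum_{t=2}^n\sum_{i=1}^2\big(X_{i,t}-m_i(X_{i,t-1}+1)/l-\mu_i\big)^2 .$$ Then, as $n\to\infty$, $\hat{\boldsymbol\gamma}^{CLS}$ is strongly consistent ($\hat{\boldsymbol\gamma}^{CLS}\to\boldsymbol\gamma$ almost surely) and asymptotically normal: $$\sqrt{n-1}\,(\hat{\boldsymbol\gamma}^{CLS}-\boldsymbol\gamma)\xrightarrow{L}N(\mathbf 0,\mathbf V_1^{-1}\mathbf W_1\mathbf V_1^{-1}),$$ where $$\mathbf V_1=E\Big(\frac{\partial g(\boldsymbol\gamma,\mathbf X_{t-1})^T}{\partial\boldsymbol\gamma}\frac{\partial g(\boldsymbol\gamma,\mathbf X_{t-1})}{\partial\boldsymbol\gamma^T}\Big),\qquad \mathbf W_1=E\Big(\frac{\partial g(\boldsymbol\gamma,\mathbf X_{t-1})^T}{\partial\boldsymbol\gamma}\mathbf u_t\mathbf u_t^T\frac{\partial g(\boldsymbol\gamma,\mathbf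 X_{t-1})}{\partial\boldsymbol\gamma^T}\Big),$$ with $g(\boldsymbol\gamma,\mathbf X_{t-1})=E(\mathbf X_t\mid\mathbf X_{t-1})=\big(m_1(X_{1,t-1}+1)/l+\mu_1,\ m_2(X_{2,t-1}+1)/l+\mu_2\big)^T$ and $\mathbf u_t=\mathbf X_t-g(\boldsymbol\gamma,\mathbf X_{t-1})$, and $\xrightarrow{L}$ denotes convergence in distribution.
   Context: $\mathbb N_0=\{0,1,2,\dots\}$. Modified negative binomial operator: for $\alpha>0$ and an $\mathbb N_0$-valued random variable $X$, $\alpha\diamond X=\sum_{j=1}^{X+1}G_j$, where $\{G_j\}$ are i.i.d. geometric with parameter $\frac{\alpha}{1+\alpha}$, i.e. $P(G_j=k)=\frac{\alpha^k}{(1+\alpha)^{k+1}}$, $k\in\mathbb N_0$ (mean $\alpha$), independent of $X$. When $\alpha$ is random, this is understood conditionally on $\alpha$. BRCMNBINAR(1) process: an $\mathbb N_0^2$-valued process $\mathbf X_t=(X_{1,t},X_{2,t})^T$ with $X_{i,t}=\alpha_{i,t}\diamond X_{i,t-1}+Z_{i,t}$, $i=1,2$, $t\in\mathbb N$, where: (i) for $i=1,2$, $\{\alpha_{i,t}\}_t$ is i.i.d. Beta prime with density $f(x)=x^{m_i-1}(1+x)^{-m_i-l-1}/B(m_i,l+1)$, $x>0$ ($B$ is the Beta function), where $l>1$ is a known constant and $0<m_i<l$; so $E(\alpha_{i,t})=\alpha_i=m_i/l$ and $\mathrm{Var}(\alpha_{i,t})=\sigma_{\alpha_i}^2=\frac{m_i(m_i+l)}{(l-1)l^2}$;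 $\{\alpha_{1,t}\}$ and $\{\alpha_{2,t}\}$ are mutually independent; (ii) $\mathbf Z_t=(Z_{1,t},Z_{2,t})^T$ are i.i.d. $\mathbb N_0^2$-valued random vectors with joint pmf $f_{\mathbf Z}(x,y)$, $E(Z_{i,t})=\mu_i$, $\mathrm{Var}(Z_{i,t})=\sigma_{Z_i}^2<\infty$, $\mathrm{Cov}(Z_{1,t},Z_{2,t})=\phi$; $\mathbf Z_t$ is independent of $(\alpha_{1,t}\diamond X_{1,t-1},\alpha_{2,t}\diamond X_{2,t-1})$ and of $\mathbf X_s$ for $s<t$; (iii) given the coefficients $\alpha_{i,t}$, the counting variables $G_j$ used in different components $i$ and at different times $t$ are independent; the triples (coefficients $(\alpha_{1,t},\alpha_{2,t})$, counting variables at time $t$, $\mathbf Z_t$) are independent over $t$ and independent of $\mathbf X_s$, $s<t$; (iv) $(m_1,\mu_1)\neq(m_2,\mu_2)$. $\frac{\partial g^T}{\partial\boldsymbol\gamma}$ is the $4\times2$ transpose of the $2\times 4$ Jacobian $\frac{\partial g}{\partial\boldsymbol\gamma^T}$. The minimization of $S_1$ is over $\boldsymbol\gamma\in\mathbb R^4$; when the normal equations $\partial S_1/\partial\boldsymbol\gamma=\mathbf 0$ have a unique solution (a $4\times4$ linear system), the estimator is that solution. *)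

theory Defs
  imports "HOL-Probability.Probability"
begin

section \<open>Stationarity, ergodicity and weak convergence\<close>

definition strictly_stationary :: "'a measure \<Rightarrow> 'b measure \<Rightarrow> (nat \<Rightarrow> 'a \<Rightarrow> 'b) \<Rightarrow> bool" where
  "strictly_stationary M S X \<longleftrightarrow>
     (\<forall>t. X t \<in> measurable M S) \<and>
     (\<forall>h. distr M (PiM UNIV (\<lambda>_. S)) (\<lambda>\<omega> t. X (t + h) \<omega>) =
          distr M (PiM UNIV (\<lambda>_. S)) (\<lambda>\<omega> t. X t \<omega>))"

text \<open>Ergodicity of the one-sided path shift under the law of the process: every
  shift-invariant event of the path space has probability 0 or 1.\<close>

definition ergodic_process :: "'a measure \<Rightarrow> 'b measure \<Rightarrow> (nat \<Rightarrow> 'a \<Rightarrow> 'b) \<Rightarrow> bool" where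
  "ergodic_process M S X \<longleftrightarrow>
     (\<forall>A \<in> sets (PiM UNIV (\<lambda>_::nat. S)).
        {x \<in> space (PiM UNIV (\<lambda>_. S)). (\<lambda>t. x (Suc t)) \<in> A} = A \<longrightarrow>
        measure M {\<omega> \<in> space M. (\<lambda>t. X t \<omega>) \<in> A} \<in> {0, 1})"

text \<open>The library's weak convergence is restricted to laws on the real line, hence the
  general definition through bounded continuous test functions. Measurability is part of the
  definition because the Bochner integral of a non-measurable function is 0.\<close>

definition converges_in_law ::
    "'a measure \<Rightarrow> (nat \<Rightarrow> 'a \<Rightarrow> 'b::topological_space) \<Rightarrow> 'b measure \<Rightarrow> bool" where
  "converges_in_law M Y N \<longleftrightarrow>
     (\<forall>n. Y n \<in> borel_measurable M) \<and>
     (\<forall>f :: 'b \<Rightarrow> real. continuous_on UNIV f \<and> bounded (range f) \<longrightarrow>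
        (\<lambda>n. \<integral>\<omega>. f (Y n \<omega>) \<partial>M) \<longlonglongrightarrow> (\<integral>y. f y \<partial>N))"

text \<open>The normal law is specified by its characteristic function, so that a singular
  covariance matrix is allowed.\<close>

definition is_multivariate_normal ::
    "real ^ 'n \<Rightarrow> real ^ 'n ^ 'n \<Rightarrow> (real ^ 'n) measure \<Rightarrow> bool" where
  "is_multivariate_normal \<nu> \<Sigma> N \<longleftrightarrow>
     prob_space N \<and> sets N = sets borel \<and>
     (\<forall>s. (\<integral>y. iexp (s \<bullet> y) \<partial>N) =
          exp (\<i> * complex_of_real (s \<bullet> \<nu>) - complex_of_real (s \<bullet> (\<Sigma> *v s)) / 2))"

section \<open>The process\<close>

text \<open>\<open>mnb_op K x\<close> is the value of the modified negative binomial operator at \<open>x\<close>, where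
  \<open>K\<close> is the realised sequence of counting variables; the index starts at 1.\<close>

definition mnb_op :: "(nat \<Rightarrow> nat) \<Rightarrow> nat \<Rightarrow> nat" where
  "mnb_op K x = (\<Sum>j = 1..x + 1. K j)"

definition geom_mass :: "real \<Rightarrow> nat \<Rightarrow> real" where
  "geom_mass a k = a ^ k / (1 + a) ^ (k + 1)"

definition beta_prime_density :: "real \<Rightarrow> real \<Rightarrow> real \<Rightarrow> real" where
  "beta_prime_density p l x =
     (if x > 0 then x powr (p - 1) * (1 + x) powr (- p - l - 1) / Beta p (l + 1) else 0)"

text \<open>The library's \<open>indep_var\<close> requires both variables to have values in the same type.\<close>

definition (in prob_space) indep_rv ::
    "'b measure \<Rightarrow> ('a \<Rightarrow> 'b) \<Rightarrow> 'c measure \<Rightarrow> ('a \<Rightarrow> 'c) \<Rightarrow> bool" where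
  "indep_rv S U T V \<longleftrightarrow>
     U \<in> measurable M S \<and> V \<in> measurable M T \<and>
     indep_set {U -` A \<inter> space M | A. A \<in> sets S} {V -` B \<inter> space M | B. B \<in> sets T}"

text \<open>Components are indexed by the two-element type \<open>2\<close>. \<open>G t j \<omega> $ i\<close> is the \<open>j\<close>-th counting
  variable (\<open>j \<ge> 1\<close>) of component \<open>i\<close> at time \<open>t\<close>. The innovations \<open>\<alpha>\<close>, \<open>G\<close>, \<open>Z\<close> are only
  constrained at times \<open>t \<ge> 1\<close>; \<open>X 0\<close> is the initial state.\<close>

locale brcmnbinar1 = prob_space M
  for M :: "'a measure"
  and l :: real
  and m \<mu> \<sigma>2 :: "real ^ 2"
  and \<phi> :: real
  and f\<^sub>Z :: "(nat ^ 2) pmf"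
  and \<alpha> :: "nat \<Rightarrow> 'a \<Rightarrow> real ^ 2"
  and G :: "nat \<Rightarrow> nat \<Rightarrow> 'a \<Rightarrow> nat ^ 2"
  and Z X :: "nat \<Rightarrow> 'a \<Rightarrow> nat ^ 2" +
  assumes l_gt_1: "l > 1"
    and m_bounds: "\<And>i. 0 < m $ i \<and> m $ i < l"
    and X_measurable: "\<And>t. X t \<in> measurable M (count_space UNIV)"
    and \<alpha>_measurable: "\<And>t. t \<ge> 1 \<Longrightarrow> \<alpha> t \<in> borel_measurable M"
    and G_measurable: "\<And>t j. t \<ge> 1 \<Longrightarrow> j \<ge> 1 \<Longrightarrow> G t j \<in> measurable M (count_space UNIV)"
    and Z_measurable: "\<And>t. t \<ge> 1 \<Longrightarrow> Z t \<in> measurable M (count_space UNIV)"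
    and recursion: "\<And>t i. t \<ge> 1 \<Longrightarrow>
          AE \<omega> in M. X t \<omega> $ i = mnb_op (\<lambda>j. G t j \<omega> $ i) (X (t - 1) \<omega> $ i) + Z t \<omega> $ i"
    \<comment> \<open>random coefficients\<close>
    and \<alpha>_distributed: "\<And>t i. t \<ge> 1 \<Longrightarrow>
          distributed M lborel (\<lambda>\<omega>. \<alpha> t \<omega> $ i) (\<lambda>x. ennreal (beta_prime_density (m $ i) l x))"
    and \<alpha>_indep: "indep_vars (\<lambda>_. borel) (\<lambda>(i, t) \<omega>. \<alpha> t \<omega> $ i) (UNIV \<times> {1..})"
    \<comment> \<open>innovations\<close>
    and Z_indep: "indep_vars (\<lambda>_. count_space UNIV) Z {1..}"
    and Z_pmf: "\<And>t. t \<ge> 1 \<Longrightarrow> distr M (count_space UNIV) (Z t) = measure_pmf f\<^sub>Z"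
    and Z_square_integrable: "\<And>t i. t \<ge> 1 \<Longrightarrow> integrable M (\<lambda>\<omega>. (real (Z t \<omega> $ i))\<^sup>2)"
    and Z_mean: "\<And>t i. t \<ge> 1 \<Longrightarrow> expectation (\<lambda>\<omega>. real (Z t \<omega> $ i)) = \<mu> $ i"
    and Z_variance: "\<And>t i. t \<ge> 1 \<Longrightarrow> variance (\<lambda>\<omega>. real (Z t \<omega> $ i)) = \<sigma>2 $ i"
    and Z_covariance: "\<And>t. t \<ge> 1 \<Longrightarrow>
          expectation (\<lambda>\<omega>. (real (Z t \<omega> $ 1) - \<mu> $ 1) * (real (Z t \<omega> $ 2) - \<mu> $ 2)) = \<phi>"
    and Z_indep_thinning: "\<And>t. t \<ge> 1 \<Longrightarrow>
          indep_rv (count_space UNIV) (Z t)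
            (count_space UNIV)
            (\<lambda>\<omega>. (\<chi> i. mnb_op (\<lambda>j. G t j \<omega> $ i) (X (t - 1) \<omega> $ i)) :: nat ^ 2)"
    and Z_indep_past: "\<And>t. t \<ge> 1 \<Longrightarrow>
          indep_rv (count_space UNIV) (Z t)
            (PiM {..<t} (\<lambda>_. count_space UNIV)) (\<lambda>\<omega>. \<lambda>s\<in>{..<t}. X s \<omega>)"
    \<comment> \<open>conditionally on all coefficients, the counting variables are independent, and those of
        component \<open>i\<close> at time \<open>t\<close> are geometric with mean \<open>\<alpha> t $ i\<close>\<close>
    and G_conditional: "\<And>J k. finite J \<Longrightarrow> J \<subseteq> UNIV \<times> {1..} \<times> {1..} \<Longrightarrow>
          AE \<omega> in M.
            real_cond_exp M
              (vimage_algebra (space M) (\<lambda>\<omega>. \<lambda>t\<in>{1..}. \<alpha> t \<omega>) (PiM {1..} (\<lambda>_. borel)))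
              (indicat_real {\<omega> \<in> space M. \<forall>(i, t, j) \<in> J. G t j \<omega> $ i = k (i, t, j)}) \<omega>
            = (\<Prod>(i, t, j) \<in> J. geom_mass (\<alpha> t \<omega> $ i) (k (i, t, j)))"
    and triple_indep: "indep_vars
          (\<lambda>_. borel \<Otimes>\<^sub>M PiM {1..} (\<lambda>_. count_space UNIV) \<Otimes>\<^sub>M count_space UNIV)
          (\<lambda>t \<omega>. (\<alpha> t \<omega>, \<lambda>j\<in>{1..}. G t j \<omega>, Z t \<omega>)) {1..}"
    and triple_indep_past: "\<And>t. t \<ge> 1 \<Longrightarrow>
          indep_rv
            (borel \<Otimes>\<^sub>M PiM {1..} (\<lambda>_. count_space UNIV) \<Otimes>\<^sub>M count_space UNIV)
            (\<lambda>\<omega>. (\<alpha> t \<omega>, \<lambda>j\<in>{1..}. G t j \<omega>, Z t \<omega>))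
            (PiM {..<t} (\<lambda>_. count_space UNIV)) (\<lambda>\<omega>. \<lambda>s\<in>{..<t}. X s \<omega>)"
    and parameters_differ: "(m $ 1, \<mu> $ 1) \<noteq> (m $ 2, \<mu> $ 2)"

section \<open>Conditional least squares\<close>

text \<open>A parameter vector \<open>\<gamma>\<close> lists \<open>m\<^sub>1, m\<^sub>2, \<mu>\<^sub>1, \<mu>\<^sub>2\<close> in this order; \<open>reg l \<gamma> x\<close> is the one-step
  conditional mean (the function g) given the previous state \<open>x\<close>.\<close>

definition param :: "real ^ 2 \<Rightarrow> real ^ 2 \<Rightarrow> real ^ 4" where
  "param m \<mu> = vector [m $ 1, m $ 2, \<mu> $ 1, \<mu> $ 2]"

definition reg :: "real \<Rightarrow> real ^ 4 \<Rightarrow> nat ^ 2 \<Rightarrow> real ^ 2" where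
  "reg l \<gamma> x = vector [\<gamma> $ 1 * (real (x $ 1) + 1) / l + \<gamma> $ 3,
                       \<gamma> $ 2 * (real (x $ 2) + 1) / l + \<gamma> $ 4]"

definition S\<^sub>1 :: "real \<Rightarrow> nat \<Rightarrow> (nat \<Rightarrow> nat ^ 2) \<Rightarrow> real ^ 4 \<Rightarrow> real" where
  "S\<^sub>1 l n x \<gamma> = (\<Sum>t = 2..n. \<Sum>i\<in>UNIV. (real (x t $ i) - reg l \<gamma> (x (t - 1)) $ i)\<^sup>2)"

text \<open>A minimiser always exists but is not unique for degenerate samples; any measurable
  selection of minimisers is admitted.\<close>

definition is_CLS_estimator ::
    "'a measure \<Rightarrow> real \<Rightarrow> (nat \<Rightarrow> 'a \<Rightarrow> nat ^ 2) \<Rightarrow> (nat \<Rightarrow> 'a \<Rightarrow> real ^ 4) \<Rightarrow> bool" where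
  "is_CLS_estimator M l X \<gamma>hat \<longleftrightarrow>
     (\<forall>n. \<gamma>hat n \<in> borel_measurable M) \<and>
     (\<forall>n. \<forall>\<omega> \<in> space M. is_arg_min (S\<^sub>1 l n (\<lambda>t. X t \<omega>)) (\<lambda>_. True) (\<gamma>hat n \<omega>))"

definition reg_jacobian :: "real \<Rightarrow> real ^ 4 \<Rightarrow> nat ^ 2 \<Rightarrow> real ^ 4 ^ 2" where
  "reg_jacobian l \<gamma> x = jacobian (\<lambda>\<gamma>'. reg l \<gamma>' x) (at \<gamma>)"

definition outer :: "real ^ 'n \<Rightarrow> real ^ 'n \<Rightarrow> real ^ 'n ^ 'n" where
  "outer u v = (\<chi> i j. u $ i * v $ j)"

definition residual ::
    "real \<Rightarrow> (nat \<Rightarrow> 'a \<Rightarrow> nat ^ 2) \<Rightarrow> real ^ 4 \<Rightarrow> nat \<Rightarrow> 'a \<Rightarrow> real ^ 2" where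
  "residual l X \<gamma> t \<omega> = (\<chi> i. real (X t \<omega> $ i)) - reg l \<gamma> (X (t - 1) \<omega>)"

definition V\<^sub>1 ::
    "'a measure \<Rightarrow> real \<Rightarrow> (nat \<Rightarrow> 'a \<Rightarrow> nat ^ 2) \<Rightarrow> real ^ 4 \<Rightarrow> nat \<Rightarrow> real ^ 4 ^ 4" where
  "V\<^sub>1 M l X \<gamma> t =
     (\<integral>\<omega>. transpose (reg_jacobian l \<gamma> (X (t - 1) \<omega>)) ** reg_jacobian l \<gamma> (X (t - 1) \<omega>) \<partial>M)"

definition W\<^sub>1 ::
    "'a measure \<Rightarrow> real \<Rightarrow> (nat \<Rightarrow> 'a \<Rightarrow> nat ^ 2) \<Rightarrow> real ^ 4 \<Rightarrow> nat \<Rightarrow> real ^ 4 ^ 4" where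
  "W\<^sub>1 M l X \<gamma> t =
     (\<integral>\<omega>. transpose (reg_jacobian l \<gamma> (X (t - 1) \<omega>))
           ** outer (residual l X \<gamma> t \<omega>) (residual l X \<gamma> t \<omega>)
           ** reg_jacobian l \<gamma> (X (t - 1) \<omega>) \<partial>M)"

end

theory Submission
  imports Defs
begin

text \<open>The criterion is quadratic, so \<open>\<gamma>hat\<close> solves \<open>V\<^sub>n (\<gamma>hat - \<gamma>) = D\<^sub>n\<close>, where, with \<open>J\<close> the
  Jacobian of g and \<open>u\<close> the residual, \<open>V\<^sub>n\<close> averages \<open>J\<^sup>T J\<close> over the sample and \<open>D\<^sub>n\<close> averages the
  scores \<open>J\<^sup>T u\<close>. Birkhoff's theorem gives
  \<open>V\<^sub>n \<rightarrow> V\<^sub>1\<close> and \<open>D\<^sub>n \<rightarrow> 0\<close> almost surely, hence consistency; the scores are stationary ergodic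
  martingale differences for the natural filtration, so McLeish's argument gives the central limit
  theorem for \<open>\<surd>n D\<^sub>n\<close>. The matrix \<open>V\<^sub>1\<close> is invertible because \<open>X\<close> dominates a geometric
  variable of unbounded support, hence is not almost surely constant. Writing
  \<open>y - u = V\<^sub>1\<^bsup>-1\<^esup> (V\<^sub>1 - V\<^sub>n) y\<close> with \<open>u = V\<^sub>1\<^bsup>-1\<^esup> D\<^sub>n\<close> and \<open>y = \<gamma>hat - \<gamma>\<close> transfers both limits
  to \<open>y\<close> without inverting \<open>V\<^sub>n\<close>.\<close>

section \<open>Birkhoff's ergodic theorem\<close>

text \<open>What a Lindeberg condition would provide comes from the law of large numbers: along a
  path on which the averaged squares converge, consecutive averages nearly agree, so the largest
  normalised difference and the sum of normalised cubes vanish. What remains for the central limit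
  theorem is uniform integrability of McLeish's product, and for this the product is stopped: the
  stopping rule looks only at the past, so the mean stays 1 while second moments stay bounded.
  Several dimensions reduce to one through the forms \<open>s \<bullet> score\<close>. Returning
  from characteristic functions to bounded continuous test functions takes tightness; it is drawn
  from second moments of the linearised error, since the estimator is an arbitrary minimiser on
  degenerate samples and has no known moments. Fourth moments of \<open>X\<close> enter because a
  score multiplies a regressor with a residual and must be square integrable. The limit covariance
  is only shown to be positive semidefinite, so the normal law is built as a linear image of
  independent standard normal variables.\<close>

definition birkhoff_sum :: "('a \<Rightarrow> 'a) \<Rightarrow> ('a \<Rightarrow> real) \<Rightarrow> nat \<Rightarrow> 'a \<Rightarrow> real" where
  "birkhoff_sum T f n x = (\<Sum>k<n. f ((T ^^ k) x))"

lemma birkhoff_sum_Suc: "birkhoff_sum T f (Suc n) x = f x + birkhoff_sum T f n (T x)"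
  unfolding birkhoff_sum_def sum.lessThan_Suc_shift by (simp add: funpow_swap1)

locale ergodic_system = prob_space M for M :: "'a measure" +
  fixes T :: "'a \<Rightarrow> 'a"
  assumes T_measurable [measurable]: "T \<in> measurable M M"
    and T_preserving: "distr M M T = M"
    and T_ergodic: "\<And>A. A \<in> sets M \<Longrightarrow> T -` A \<inter> space M = A \<Longrightarrow> measure M A \<in> {0, 1}"
begin

lemma birkhoff_sum_measurable [measurable]:
  assumes [measurable]: "f \<in> borel_measurable M"
  shows "birkhoff_sum T f n \<in> borel_measurable M"
proof -
  have [measurable]: "T ^^ k \<in> measurable M M" for k
    by (induction k) (auto simp: id_def[symmetric] measurable_ident)
  show ?thesis
    unfolding birkhoff_sum_def[abs_def] by measurable
qed

lemma integrable_T: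
  fixes f :: "'a \<Rightarrow> real"
  assumes "integrable M f" shows "integrable M (\<lambda>x. f (T x))"
proof -
  have "integrable (distr M M T) f" using assms T_preserving by simp
  then show ?thesis by (rule integrable_distr[OF T_measurable])
qed

lemma integral_T:
  fixes f :: "'a \<Rightarrow> real"
  assumes "integrable M f" shows "(\<integral>x. f (T x) \<partial>M) = (\<integral>x. f x \<partial>M)"
proof -
  have "(\<integral>x. f (T x) \<partial>M) = (\<integral>x. f x \<partial>distr M M T)"
    using assms by (intro integral_distr[symmetric]) auto
  then show ?thesis using T_preserving by simp
qed

lemma integrable_birkhoff_sum:
  assumes "integrable M f" shows "integrable M (birkhoff_sum T f n)"
proof (induction n)
  case 0 then show ?case by (simp add: birkhoff_sum_def[abs_def])
next
  case (Suc n)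
  show ?case
    using assms integrable_T[OF Suc] by (simp add: birkhoff_sum_Suc[abs_def])
qed

text \<open>The empty sum for \<open>n = 0\<close> takes part in the maximum and makes it
  nonnegative, which Garsia's argument uses where the maximum is not positive.\<close>

definition max_sum :: "('a \<Rightarrow> real) \<Rightarrow> nat \<Rightarrow> 'a \<Rightarrow> real" where
  "max_sum f N x = (MAX n\<in>{..N}. birkhoff_sum T f n x)"

lemma max_sum_nonneg: "0 \<le> max_sum f N x"
  unfolding max_sum_def by (rule Max_ge) (auto simp: birkhoff_sum_def image_iff intro!: bexI[of _ 0])

lemma integrable_max_sum:
  assumes "integrable M f" shows "integrable M (max_sum f N)"
proof (induction N)
  case 0 then show ?case by (simp add: max_sum_def[abs_def] birkhoff_sum_def)
next
  case (Suc N)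
  have "max_sum f (Suc N) x = max (birkhoff_sum T f (Suc N) x) (max_sum f N x)" for x
    unfolding max_sum_def atMost_Suc by simp
  then show ?case
    using Suc integrable_birkhoff_sum[OF assms] by (simp add: fun_eq_iff[symmetric, of "max_sum f (Suc N)"])
qed

text \<open>Garsia's argument: where \<open>max_sum f N\<close> is positive it is at most
  \<open>f + max_sum f N \<circ> T\<close>, and the last two terms have equal integrals.\<close>

lemma maximal_ergodic:
  assumes f: "integrable M f"
  shows "0 \<le> (\<integral>x. indicat_real {x. 0 < max_sum f N x} x * f x \<partial>M)"
proof -
  note m = integrable_max_sum[OF f, of N]
  note [measurable] = borel_measurable_integrable[OF f] borel_measurable_integrable[OF m]
  have "max_sum f N x - max_sum f N (T x) \<le> indicat_real {x. 0 < max_sum f N x} x * f x" for x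
  proof (cases "0 < max_sum f N x")
    case True
    have "max_sum f N x \<in> (\<lambda>n. birkhoff_sum T f n x) ` {..N}"
      unfolding max_sum_def by (rule Max_in) auto
    then obtain n where n: "n \<le> N" "max_sum f N x = birkhoff_sum T f n x" by auto
    have "n \<noteq> 0"
    proof
      assume "n = 0"
      with True n show False by (simp add: birkhoff_sum_def)
    qed
    then obtain k where k: "n = Suc k" by (cases n) auto
    have "birkhoff_sum T f k (T x) \<le> max_sum f N (T x)"
      unfolding max_sum_def using n k by (intro Max_ge) auto
    with n k True show ?thesis by (simp add: birkhoff_sum_Suc)
  next
    case False
    then show ?thesis using max_sum_nonneg[of f N x] max_sum_nonneg[of f N "T x"] by simp
  qed
  then have "(\<integral>x. max_sum f N x - max_sum f N (T x) \<partial>M)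
      \<le> (\<integral>x. indicat_real {x. 0 < max_sum f N x} x * f x \<partial>M)"
  proof (intro integral_mono)
    have "{x\<in>space M. 0 < max_sum f N x} \<in> sets M" by measurable
    from integrable_mult_indicator[OF this f]
    have "integrable M (\<lambda>x. indicat_real {x\<in>space M. 0 < max_sum f N x} x * f x)" by simp
    then show "integrable M (\<lambda>x. indicat_real {x. 0 < max_sum f N x} x * f x)"
      by (rule Bochner_Integration.integrable_cong[THEN iffD1, rotated -1]) (auto simp: indicator_def)
  qed (intro Bochner_Integration.integrable_diff m integrable_T)
  then show ?thesis using integral_T[OF m] m integrable_T[OF m] by simp
qed

text \<open>Unboundedness of the sums is an invariant event, so it has probability 0 or 1. If it
  were 1, the sets where \<open>max_sum f N\<close> is positive would increase to almost the whole
  space, and the maximal inequality would become, in the limit, a nonnegative mean of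
  \<open>f\<close>.\<close>

lemma birkhoff_bounded_above:
  assumes f: "integrable M f" and neg: "(\<integral>x. f x \<partial>M) < 0"
  shows "AE x in M. \<exists>K. \<forall>n. birkhoff_sum T f n x \<le> K"
proof -
  note [measurable] = borel_measurable_integrable[OF f]
  define B where "B = {x\<in>space M. \<forall>K::nat. \<exists>n. real K < birkhoff_sum T f n x}"
  have [measurable]: "B \<in> sets M" unfolding B_def by measurable
  \<comment> \<open>The sums at \<open>x\<close> and at \<open>T x\<close> differ by an index shift
    and the single term \<open>f x\<close>, which a larger threshold absorbs.\<close>
  have inv: "(\<forall>K::nat. \<exists>n. real K < birkhoff_sum T f n (T x)) \<longleftrightarrow>
      (\<forall>K::nat. \<exists>n. real K < birkhoff_sum T f n x)" for x
  proof safe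
    fix K :: nat assume *: "\<forall>K::nat. \<exists>n. real K < birkhoff_sum T f n (T x)"
    obtain K' :: nat where "real K - f x < K'" using reals_Archimedean2 by blast
    moreover from * obtain n where "K' < birkhoff_sum T f n (T x)" by blast
    ultimately have "real K < birkhoff_sum T f (Suc n) x" by (simp add: birkhoff_sum_Suc)
    then show "\<exists>n. real K < birkhoff_sum T f n x" by blast
  next
    fix K :: nat assume *: "\<forall>K::nat. \<exists>n. real K < birkhoff_sum T f n x"
    obtain K' :: nat where K': "real K + \<bar>f x\<bar> < K'" using reals_Archimedean2 by blast
    from * obtain n where n: "K' < birkhoff_sum T f n x" by blast
    then have "n \<noteq> 0" by (intro notI) (simp add: birkhoff_sum_def)
    then obtain k where "n = Suc k" by (cases n) auto
    with n K' have "real K < birkhoff_sum T f k (T x)" by (simp add: birkhoff_sum_Suc)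
    then show "\<exists>n. real K < birkhoff_sum T f n (T x)" by blast
  qed
  have "T -` B \<inter> space M = B"
    unfolding B_def using measurable_space[OF T_measurable] by (auto simp: inv)
  then have "measure M B \<in> {0, 1}" by (intro T_ergodic) auto
  moreover have "measure M B \<noteq> 1"
  proof
    assume "measure M B = 1"
    then have AE: "AE x in M. x \<in> B" by (simp add: prob_eq_1)
    have "(\<lambda>N. \<integral>x. indicat_real {x. 0 < max_sum f N x} x * f x \<partial>M) \<longlonglongrightarrow> (\<integral>x. f x \<partial>M)"
    proof (rule integral_dominated_convergence[where w="\<lambda>x. \<bar>f x\<bar>"])
      fix N
      note [measurable] = borel_measurable_integrable[OF integrable_max_sum[OF f, of N]]
      show "(\<lambda>x. indicat_real {x. 0 < max_sum f N x} x * f x) \<in> borel_measurable M"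
        unfolding indicator_def by measurable
      show "AE x in M. norm (indicat_real {x. 0 < max_sum f N x} x * f x) \<le> \<bar>f x\<bar>"
        by (auto simp: indicator_def)
    next
      show "AE x in M. (\<lambda>N. indicat_real {x. 0 < max_sum f N x} x * f x) \<longlonglongrightarrow> f x"
        using AE
      proof eventually_elim
        case (elim x)
        then obtain n where n: "0 < birkhoff_sum T f n x"
          unfolding B_def by (auto dest: spec[of _ 0])
        have "eventually (\<lambda>N. indicat_real {x. 0 < max_sum f N x} x * f x = f x) sequentially"
          using eventually_ge_at_top[of n]
        proof eventually_elim
          case (elim N)
          have "birkhoff_sum T f n x \<le> max_sum f N x"
            unfolding max_sum_def using elim by (intro Max_ge) auto
          with n show ?case by simp
        qed
        then show ?case by (rule tendsto_eventually)
      qed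
    qed (use f in auto)
    then have "0 \<le> (\<integral>x. f x \<partial>M)"
      by (rule LIMSEQ_le_const) (auto intro: maximal_ergodic f)
    with neg show False by simp
  qed
  ultimately have "measure M B = 0" by simp
  then have "AE x in M. x \<notin> B" by (subst AE_iff_measurable[of B]) (auto simp: emeasure_eq_measure B_def)
  then show ?thesis
    using AE_space by eventually_elim (force simp: B_def not_less)
qed

text \<open>Subtracting a constant strictly between the mean and \<open>c\<close> makes the mean
  negative, so the centred sums have an upper bound \<open>K\<close>, and \<open>K / n\<close> is
  eventually smaller than the remaining gap.\<close>

lemma birkhoff_le:
  assumes f: "integrable M f" and e: "(\<integral>x. f x \<partial>M) < c"
  shows "AE x in M. eventually (\<lambda>n. birkhoff_sum T f n x / n < c) sequentially"
proof -
  define c' where "c' = ((\<integral>x. f x \<partial>M) + c) / 2"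
  have c': "(\<integral>x. f x \<partial>M) < c'" "c' < c" using e by (auto simp: c'_def)
  have "AE x in M. \<exists>K. \<forall>n. birkhoff_sum T (\<lambda>x. f x - c') n x \<le> K"
    using f c' by (intro birkhoff_bounded_above) (auto simp: prob_space)
  then show ?thesis
  proof eventually_elim
    case (elim x)
    then obtain K where K: "\<And>n. birkhoff_sum T f n x - n * c' \<le> K"
      by (auto simp: birkhoff_sum_def sum_subtractf)
    have "(\<lambda>n. K / real n) \<longlonglongrightarrow> 0" by (rule lim_const_over_n)
    then have "eventually (\<lambda>n. K / real n < c - c') sequentially"
      using c' by (intro order_tendstoD) auto
    then show ?case
      using eventually_gt_at_top[of 0]
    proof eventually_elim
      case (elim n)
      have "birkhoff_sum T f n x \<le> K + n * c'" using K[of n] by simp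
      then have "birkhoff_sum T f n x / n \<le> K / n + c'"
        using elim by (simp add: field_simps)
      with elim show ?case by simp
    qed
  qed
qed

text \<open>The one-sided bound is used for \<open>f\<close> and for \<open>- f\<close>, along the
  countably many margins \<open>1 / Suc k\<close>, so that one null set serves them all.\<close>

theorem birkhoff:
  assumes f: "integrable M f"
  shows "AE x in M. (\<lambda>n. birkhoff_sum T f n x / n) \<longlonglongrightarrow> (\<integral>x. f x \<partial>M)"
proof -
  let ?I = "\<integral>x. f x \<partial>M"
  have "AE x in M. \<forall>k::nat. eventually (\<lambda>n. birkhoff_sum T f n x / n < ?I + 1 / Suc k) sequentially"
    by (subst AE_all_countable) (auto intro!: birkhoff_le f)
  moreover have "AE x in M. \<forall>k::nat. eventually (\<lambda>n. birkhoff_sum T (\<lambda>x. - f x) n x / n < - ?I + 1 / Suc k) sequentially"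
    by (subst AE_all_countable) (use f in \<open>auto intro!: birkhoff_le\<close>)
  ultimately show ?thesis
  proof eventually_elim
    case (elim x)
    show ?case
    proof (rule order_tendstoI)
      fix a assume "?I < a"
      then obtain k where "1 / real (Suc k) < a - ?I" using nat_approx_posE[of "a - ?I"] by auto
      then show "eventually (\<lambda>n. birkhoff_sum T f n x / n < a) sequentially"
        using elim(1)[rule_format, of k] by (auto elim!: eventually_mono)
    next
      fix a assume "a < ?I"
      then obtain k where k: "1 / real (Suc k) < ?I - a" using nat_approx_posE[of "?I - a"] by auto
      have "birkhoff_sum T (\<lambda>x. - f x) n x = - birkhoff_sum T f n x" for n
        by (simp add: birkhoff_sum_def sum_negf)
      then show "eventually (\<lambda>n. a < birkhoff_sum T f n x / n) sequentially"
        using elim(2)[rule_format, of k] k by (auto elim!: eventually_mono)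
    qed
  qed
qed

end

text \<open>Ergodicity is a statement about the path space, where the shift makes the process a
  measure-preserving system.\<close>

theorem stationary_ergodic_average:
  fixes X :: "nat \<Rightarrow> 'a \<Rightarrow> 'b" and f :: "(nat \<Rightarrow> 'b) \<Rightarrow> real"
  assumes M: "prob_space M"
    and stat: "strictly_stationary M S X" and erg: "ergodic_process M S X"
    and f[measurable]: "f \<in> borel_measurable (PiM UNIV (\<lambda>_. S))"
    and int: "integrable M (\<lambda>\<omega>. f (\<lambda>t. X t \<omega>))"
  shows "AE \<omega> in M. (\<lambda>n. (\<Sum>k<n. f (\<lambda>t. X (t + k) \<omega>)) / n) \<longlonglongrightarrow> (\<integral>\<omega>. f (\<lambda>t. X t \<omega>) \<partial>M)"
proof -
  interpret prob_space M by fact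
  let ?P = "PiM UNIV (\<lambda>_::nat. S)"
  define X' where "X' = (\<lambda>\<omega> t. X t \<omega>)"
  have Xm: "X t \<in> measurable M S" for t using stat by (simp add: strictly_stationary_def)
  have X'm[measurable]: "X' \<in> measurable M ?P"
    unfolding X'_def by (rule measurable_PiM_single') (auto simp: Xm space_PiM measurable_space[OF Xm])
  define Q where "Q = distr M ?P X'"
  define T where "T = (\<lambda>(x::nat \<Rightarrow> 'b) t. x (Suc t))"
  have T: "T \<in> measurable ?P ?P"
    unfolding T_def by (rule measurable_PiM_single') (auto simp: space_PiM)
  have TX: "T (X' \<omega>) = (\<lambda>t. X (t + 1) \<omega>)" for \<omega> by (simp add: T_def X'_def)
  interpret Q: prob_space Q unfolding Q_def by (rule prob_space_distr) simp
  interpret Q: ergodic_system Q T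
  proof
    show "T \<in> measurable Q Q" using T by (simp add: Q_def)
    have "distr Q Q T = distr M ?P (T \<circ> X')"
      unfolding Q_def using T by (subst distr_distr[symmetric]) (auto intro!: distr_cong)
    also have "\<dots> = Q" using stat[unfolded strictly_stationary_def, THEN conjunct2, rule_format, of 1]
      unfolding Q_def comp_def TX by (simp add: X'_def)
    finally show "distr Q Q T = Q" .
    fix A assume A: "A \<in> sets Q" "T -` A \<inter> space Q = A"
    then have A': "A \<in> sets ?P" "{x \<in> space ?P. (\<lambda>t. x (Suc t)) \<in> A} = A"
      by (auto simp: Q_def T_def)
    then have "measure M {\<omega> \<in> space M. X' \<omega> \<in> A} \<in> {0, 1}"
      using erg unfolding ergodic_process_def X'_def by blast
    moreover have "measure Q A = measure M {\<omega> \<in> space M. X' \<omega> \<in> A}"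
      using A'(1) unfolding Q_def by (subst measure_distr) (auto intro!: arg_cong[where f="measure M"])
    ultimately show "measure Q A \<in> {0, 1}" by simp
  qed
  have "integrable M (\<lambda>\<omega>. f (X' \<omega>))" using int by (simp add: X'_def)
  then have "integrable Q f" unfolding Q_def by (subst integrable_distr_eq) auto
  from Q.birkhoff[OF this] have "AE x in Q. (\<lambda>n. birkhoff_sum T f n x / n) \<longlonglongrightarrow> (\<integral>\<omega>. f (X' \<omega>) \<partial>M)"
    unfolding Q_def by (subst (asm) integral_distr) auto
  then have "AE \<omega> in M. (\<lambda>n. birkhoff_sum T f n (X' \<omega>) / n) \<longlonglongrightarrow> (\<integral>\<omega>. f (X' \<omega>) \<partial>M)"
    unfolding Q_def by (rule AE_distrD[rotated]) simp
  moreover have "(T ^^ k) (X' \<omega>) = (\<lambda>t. X (t + k) \<omega>)" for k \<omega>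
    by (induction k) (auto simp: T_def X'_def)
  ultimately show ?thesis by (simp add: birkhoff_sum_def X'_def)
qed

section \<open>Central limit theorem for martingale differences\<close>

text \<open>Bounded second moments give uniform integrability: above level \<open>K\<close> the
  modulus is at most its square over \<open>K\<close>, and the part below it is handled by dominated
  convergence.\<close>

lemma (in prob_space) tendsto_integral_L2_bounded:
  fixes W :: "nat \<Rightarrow> 'a \<Rightarrow> complex"
  assumes [measurable]: "\<And>n. W n \<in> borel_measurable M"
    and sq: "\<And>n. integrable M (\<lambda>\<omega>. (cmod (W n \<omega>))\<^sup>2)"
    and B: "\<And>n. (\<integral>\<omega>. (cmod (W n \<omega>))\<^sup>2 \<partial>M) \<le> B"
    and lim: "AE \<omega> in M. (\<lambda>n. W n \<omega>) \<longlonglongrightarrow> 0"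
  shows "(\<lambda>n. \<integral>\<omega>. W n \<omega> \<partial>M) \<longlonglongrightarrow> 0"
proof (rule LIMSEQ_I)
  fix e :: real assume e: "0 < e"
  \<comment> \<open>Makes the contribution of the squares at most
    \<open>(\<bar>B\<bar> + 1) / K = e / 2\<close>; the modulus and the 1 keep \<open>K\<close>
    positive whatever \<open>B\<close> is.\<close>
  define K where "K = 2 * (\<bar>B\<bar> + 1) / e"
  have K: "K > 0" using e by (simp add: K_def)
  have "(\<lambda>n. \<integral>\<omega>. min (cmod (W n \<omega>)) K \<partial>M) \<longlonglongrightarrow> (\<integral>\<omega>. 0 \<partial>M)"
  proof (rule integral_dominated_convergence[where w="\<lambda>_. K"])
    show "AE \<omega> in M. (\<lambda>n. min (cmod (W n \<omega>)) K) \<longlonglongrightarrow> 0"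
      using lim
    proof eventually_elim
      case (elim \<omega>)
      have "(\<lambda>n. min (cmod (W n \<omega>)) K) \<longlonglongrightarrow> min (cmod 0) K"
        by (intro tendsto_min tendsto_norm elim tendsto_const)
      then show ?case using K by simp
    qed
  qed (use K in auto)
  then have "eventually (\<lambda>n. (\<integral>\<omega>. min (cmod (W n \<omega>)) K \<partial>M) < e / 2) sequentially"
    using e by (intro order_tendstoD) auto
  then obtain N where N: "\<And>n. n \<ge> N \<Longrightarrow> (\<integral>\<omega>. min (cmod (W n \<omega>)) K \<partial>M) < e / 2"
    by (auto simp: eventually_sequentially)
  show "\<exists>no. \<forall>n\<ge>no. norm ((\<integral>\<omega>. W n \<omega> \<partial>M) - 0) < e"
  proof (intro exI allI impI)
    fix n assume n: "n \<ge> N"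
    have i: "integrable M (\<lambda>\<omega>. min (cmod (W n \<omega>)) K)"
      using K by (intro integrable_const_bound[where B=K]) auto
    have pt: "cmod (W n \<omega>) \<le> min (cmod (W n \<omega>)) K + (cmod (W n \<omega>))\<^sup>2 / K" for \<omega>
    proof (cases "cmod (W n \<omega>) \<le> K")
      case False
      then have "cmod (W n \<omega>) * K \<le> cmod (W n \<omega>) * cmod (W n \<omega>)" by (intro mult_left_mono) auto
      then have "cmod (W n \<omega>) \<le> (cmod (W n \<omega>))\<^sup>2 / K"
        using K by (simp add: field_simps power2_eq_square)
      with K False show ?thesis by simp
    qed (use K in auto)
    have Wi: "integrable M (W n)"
    proof (rule Bochner_Integration.integrable_bound)
      show "integrable M (\<lambda>\<omega>. min (cmod (W n \<omega>)) K + (cmod (W n \<omega>))\<^sup>2 / K)"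
        using i sq by auto
    qed (use pt in \<open>auto intro!: AE_I2 order_trans[OF pt]\<close>)
    have "norm (\<integral>\<omega>. W n \<omega> \<partial>M) \<le> (\<integral>\<omega>. cmod (W n \<omega>) \<partial>M)" by (rule integral_norm_bound)
    also have "\<dots> \<le> (\<integral>\<omega>. min (cmod (W n \<omega>)) K + (cmod (W n \<omega>))\<^sup>2 / K \<partial>M)"
      using i sq Wi pt by (intro integral_mono) auto
    also have "\<dots> = (\<integral>\<omega>. min (cmod (W n \<omega>)) K \<partial>M) + (\<integral>\<omega>. (cmod (W n \<omega>))\<^sup>2 \<partial>M) / K"
      using i sq by simp
    also have "\<dots> < e / 2 + e / 2"
    proof (rule add_less_le_mono[OF N[OF n]])
      have "(\<integral>\<omega>. (cmod (W n \<omega>))\<^sup>2 \<partial>M) \<le> \<bar>B\<bar> + 1" using B[of n] by simp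
      then have "(\<integral>\<omega>. (cmod (W n \<omega>))\<^sup>2 \<partial>M) / K \<le> (\<bar>B\<bar> + 1) / K"
        using K by (intro divide_right_mono) auto
      also have "\<dots> = e / 2" using e by (simp add: K_def field_simps)
      finally show "(\<integral>\<omega>. (cmod (W n \<omega>))\<^sup>2 \<partial>M) / K \<le> e / 2" .
    qed
    finally show "norm ((\<integral>\<omega>. W n \<omega> \<partial>M) - 0) < e" by simp
  qed
qed

section \<open>Pointwise estimates for McLeish's product\<close>

lemma exp_ge_one_plus_square: "1 + x\<^sup>2 \<le> exp ((x::real)\<^sup>2)"
  by (rule exp_ge_add_one_self)

lemma cmod_one_plus_i: "(cmod (1 + \<i> * complex_of_real x))\<^sup>2 = 1 + x\<^sup>2"
  by (simp add: cmod_power2)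

text \<open>The squared modulus is \<open>(1 + x\<^sup>2) * exp (- x\<^sup>2)\<close>. Factors of
  modulus at most 1 are what lets \<open>norm_prod_diff\<close> bound a difference of products by
  the sum of the differences of the factors.\<close>

lemma cmod_mcleish_factor_le: "cmod ((1 + \<i> * complex_of_real x) * exp (- (complex_of_real x)\<^sup>2 / 2)) \<le> 1"
proof -
  have "exp (- (complex_of_real x)\<^sup>2 / 2) = complex_of_real (exp (- x\<^sup>2 / 2))"
    by (simp flip: exp_of_real)
  then have "(cmod ((1 + \<i> * complex_of_real x) * exp (- (complex_of_real x)\<^sup>2 / 2)))\<^sup>2
      = (1 + x\<^sup>2) * exp (- x\<^sup>2 / 2) ^ 2"
    by (simp add: norm_mult power_mult_distrib cmod_one_plus_i)
  also have "exp (- x\<^sup>2 / 2) ^ 2 = exp (- x\<^sup>2)"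
    by (simp flip: exp_double)
  also have "(1 + x\<^sup>2) * exp (- x\<^sup>2) \<le> exp (x\<^sup>2) * exp (- x\<^sup>2)"
    by (intro mult_right_mono exp_ge_one_plus_square) auto
  also have "\<dots> = 1" by (simp flip: exp_add)
  finally show ?thesis by (simp add: power_le_one_iff abs_square_le_1)
qed

lemma exp_minus_approx:
  fixes y :: real assumes "0 \<le> y" shows "\<bar>exp (- y) - (1 - y)\<bar> \<le> y\<^sup>2 / 2"
proof -
  have "exp (- y) \<ge> 1 - y" using exp_ge_add_one_self[of "- y"] by simp
  moreover have "exp (- y) \<le> 1 - y + y\<^sup>2 / 2"
  proof -
    have "\<exists>t. \<bar>t\<bar> \<le> \<bar>- y\<bar> \<and> exp (- y) = (\<Sum>m<3. (- y) ^ m / fact m) + exp t / fact 3 * (- y) ^ 3"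
      by (rule Maclaurin_exp_le)
    then obtain t where "exp (- y) = (\<Sum>m<3. (- y) ^ m / fact m) + exp t / fact 3 * (- y) ^ 3" by blast
    then have "exp (- y) = 1 - y + y\<^sup>2 / 2 - exp t / 6 * y ^ 3"
      by (simp add: eval_nat_numeral fact_numeral)
    moreover have "0 \<le> exp t / 6 * y ^ 3" using assms by simp
    ultimately show ?thesis by linarith
  qed
  ultimately show ?thesis by linarith
qed

text \<open>Both expressions expand as \<open>1 + i x - x\<^sup>2 / 2\<close> up to terms of third
  order. The three error pieces add up to 11/12 of the cube; the factor 2 is slack.\<close>

lemma mcleish_factor_approx:
  assumes "\<bar>x\<bar> \<le> 1"
  shows "cmod (iexp x - (1 + \<i> * complex_of_real x) * exp (- (complex_of_real x)\<^sup>2 / 2)) \<le> 2 * \<bar>x\<bar> ^ 3"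
proof -
  define r where "r = exp (- (x\<^sup>2 / 2)) - (1 - x\<^sup>2 / 2)"
  have r: "\<bar>r\<bar> \<le> \<bar>x\<bar> ^ 3 / 8"
  proof -
    have "\<bar>r\<bar> \<le> (x\<^sup>2 / 2)\<^sup>2 / 2" unfolding r_def by (rule exp_minus_approx) simp
    also have "\<dots> = \<bar>x\<bar> * \<bar>x\<bar> ^ 3 / 8" by (simp add: power2_eq_square power3_eq_cube abs_mult_self_eq mult.assoc)
    also have "\<dots> \<le> 1 * \<bar>x\<bar> ^ 3 / 8" using assms by (intro divide_right_mono mult_right_mono) auto
    finally show ?thesis by simp
  qed
  have e: "exp (- (complex_of_real x)\<^sup>2 / 2) = complex_of_real (1 - x\<^sup>2 / 2 + r)"
    unfolding r_def by (simp flip: exp_of_real)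
  have "cmod (iexp x - (\<Sum>k\<le>2. (\<i> * x) ^ k / fact k)) \<le> \<bar>x\<bar> ^ Suc 2 / fact (Suc 2)"
    by (rule iexp_approx1)
  then have s: "cmod (iexp x - (1 + \<i> * x - x\<^sup>2 / 2)) \<le> \<bar>x\<bar> ^ 3 / 6"
    by (simp add: eval_nat_numeral fact_numeral atMost_Suc algebra_simps)
  \<comment> \<open>The cubic term is the cross product of \<open>i x\<close> with
    \<open>x\<^sup>2 / 2\<close>; \<open>r\<close> collects the error of the Gaussian
    factor.\<close>
  have "iexp x - (1 + \<i> * complex_of_real x) * exp (- (complex_of_real x)\<^sup>2 / 2)
      = (iexp x - (1 + \<i> * x - x\<^sup>2 / 2)) + \<i> * complex_of_real (x ^ 3 / 2) - (1 + \<i> * x) * complex_of_real r"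
    unfolding e by (simp add: algebra_simps power2_eq_square power3_eq_cube)
  also have "cmod \<dots> \<le> cmod (iexp x - (1 + \<i> * x - x\<^sup>2 / 2)) + cmod (\<i> * complex_of_real (x ^ 3 / 2))
      + cmod ((1 + \<i> * x) * complex_of_real r)"
    by (intro norm_triangle_le_diff norm_triangle_le add_mono order_refl)
  also have "cmod (\<i> * complex_of_real (x ^ 3 / 2)) = \<bar>x\<bar> ^ 3 / 2"
    by (simp only: norm_mult norm_of_real norm_ii abs_divide power_abs)
  also have "cmod ((1 + \<i> * x) * complex_of_real r) \<le> 2 * (\<bar>x\<bar> ^ 3 / 8)"
  proof -
    have "cmod (1 + \<i> * x) \<le> cmod 1 + cmod (\<i> * x)" by (rule norm_triangle_ineq)
    also have "\<dots> \<le> 2" using assms by (simp add: norm_mult)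
    finally show ?thesis using r unfolding norm_mult norm_of_real by (intro mult_mono) auto
  qed
  finally have "cmod (iexp x - (1 + \<i> * complex_of_real x) * exp (- (complex_of_real x)\<^sup>2 / 2))
     \<le> \<bar>x\<bar> ^ 3 / 6 + \<bar>x\<bar> ^ 3 / 2 + 2 * (\<bar>x\<bar> ^ 3 / 8)"
    using s by linarith
  also have "\<dots> \<le> 2 * \<bar>x\<bar> ^ 3" using zero_le_power[of "\<bar>x\<bar>" 3] by simp
  finally show ?thesis .
qed

lemma iexp_sum_approx:
  fixes x :: "nat \<Rightarrow> real"
  assumes "\<And>j. j < n \<Longrightarrow> \<bar>x j\<bar> \<le> 1"
  shows "cmod (iexp (\<Sum>j<n. x j) - (\<Prod>j<n. 1 + \<i> * complex_of_real (x j)) * exp (- (\<Sum>j<n. (x j)\<^sup>2) / 2))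
    \<le> 2 * (\<Sum>j<n. \<bar>x j\<bar> ^ 3)"
proof -
  have "iexp (\<Sum>j<n. x j) = (\<Prod>j<n. iexp (x j))"
    unfolding of_real_sum sum_distrib_left by (rule exp_sum) simp
  moreover have "(\<Prod>j<n. 1 + \<i> * complex_of_real (x j)) * exp (- (\<Sum>j<n. (x j)\<^sup>2) / 2)
      = (\<Prod>j<n. (1 + \<i> * complex_of_real (x j)) * exp (- (complex_of_real (x j))\<^sup>2 / 2))"
    by (simp add: prod.distrib exp_sum[symmetric] sum_negf sum_divide_distrib flip: exp_of_real)
  ultimately have "cmod (iexp (\<Sum>j<n. x j) - (\<Prod>j<n. 1 + \<i> * complex_of_real (x j)) * exp (- (\<Sum>j<n. (x j)\<^sup>2) / 2))
    \<le> (\<Sum>j<n. cmod (iexp (x j) - (1 + \<i> * complex_of_real (x j)) * exp (- (complex_of_real (x j))\<^sup>2 / 2)))"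
    by (simp only:) (intro norm_prod_diff cmod_mcleish_factor_le; simp)
  also have "\<dots> \<le> (\<Sum>j<n. 2 * \<bar>x j\<bar> ^ 3)"
    by (intro sum_mono mcleish_factor_approx assms) auto
  finally show ?thesis by (simp add: sum_distrib_left)
qed

text \<open>\<open>(d n)\<^sup>2 / n\<close> is the difference of two consecutive averages, one of
  them rescaled by \<open>1 + 1 / n\<close>, and hence tends to 0. Then the largest of the first
  \<open>n\<close> terms is small against \<open>sqrt n\<close>, and the sum of cubes is at most
  this maximum times the convergent average of squares.\<close>

lemma sum_cubes_vanish:
  fixes d :: "nat \<Rightarrow> real"
  assumes lim: "(\<lambda>n. (\<Sum>j<n. (d j)\<^sup>2) / n) \<longlonglongrightarrow> s"
  shows "eventually (\<lambda>n. \<forall>j<n. \<bar>d j / sqrt n\<bar> \<le> 1) sequentially"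
    and "(\<lambda>n. \<Sum>j<n. \<bar>d j / sqrt n\<bar> ^ 3) \<longlonglongrightarrow> 0"
proof -
  have "(\<lambda>n. (\<Sum>j<Suc n. (d j)\<^sup>2) / Suc n * (1 + 1 / n) - (\<Sum>j<n. (d j)\<^sup>2) / n) \<longlonglongrightarrow> s * (1 + 0) - s"
    by (intro tendsto_intros lim LIMSEQ_Suc[OF lim] lim_const_over_n)
  moreover have "eventually (\<lambda>n. (\<Sum>j<Suc n. (d j)\<^sup>2) / Suc n * (1 + 1 / n) - (\<Sum>j<n. (d j)\<^sup>2) / n = (d n)\<^sup>2 / n) sequentially"
    using eventually_gt_at_top[of 0]
  proof eventually_elim
    case (elim n)
    have "x / Suc n * (1 + 1 / n) = x / n" for x :: real
    proof -
      have "1 + 1 / real n = Suc n / n" using elim by (simp add: add_divide_distrib)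
      then show ?thesis by simp
    qed
    then show ?case by (simp only: sum.lessThan_Suc) (simp add: add_divide_distrib)
  qed
  ultimately have dn: "(\<lambda>n. (d n)\<^sup>2 / n) \<longlonglongrightarrow> 0"
    by (simp add: tendsto_cong)
  \<comment> \<open>Indices up to \<open>N\<close> are bounded by a fixed \<open>C\<close>, divided
    by a growing \<open>n\<close>; a later index \<open>j < n\<close> has
    \<open>(d j)\<^sup>2 / n \<le> (d j)\<^sup>2 / j\<close>.\<close>
  have max: "eventually (\<lambda>n. \<forall>j<n. \<bar>d j / sqrt n\<bar> \<le> e) sequentially" if e: "0 < e" for e
  proof -
    have "eventually (\<lambda>n. (d n)\<^sup>2 / n < e\<^sup>2) sequentially"
      using dn e by (intro order_tendstoD) auto
    then obtain N where N: "\<And>n. n \<ge> N \<Longrightarrow> (d n)\<^sup>2 / n < e\<^sup>2"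
      by (auto simp: eventually_sequentially)
    define C where "C = (\<Sum>j\<le>N. (d j)\<^sup>2)"
    have "(\<lambda>n. C / real n) \<longlonglongrightarrow> 0" by (rule lim_const_over_n)
    then have "eventually (\<lambda>n. C / real n < e\<^sup>2) sequentially"
      using e by (intro order_tendstoD) auto
    then show ?thesis
      using eventually_gt_at_top[of 0]
    proof eventually_elim
      case (elim n)
      have "(d j)\<^sup>2 / n \<le> e\<^sup>2" if "j < n" for j
      proof (cases "j \<le> N")
        case True
        then have "(d j)\<^sup>2 \<le> C" unfolding C_def by (intro member_le_sum) auto
        then have "(d j)\<^sup>2 / n \<le> C / n" by (intro divide_right_mono) auto
        with elim show ?thesis by simp
      next
        case False
        then have j: "0 < j" "(d j)\<^sup>2 / j < e\<^sup>2" using N[of j] by auto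
        have "(d j)\<^sup>2 / n \<le> (d j)\<^sup>2 / j" using j that by (intro divide_left_mono) auto
        with j show ?thesis by simp
      qed
      then have "(d j / sqrt n)\<^sup>2 \<le> e\<^sup>2" if "j < n" for j using that by (simp add: power_divide)
      then show ?case using e abs_le_square_iff[of "d _ / sqrt n" e] by (auto simp del: abs_divide power_divide)
    qed
  qed
  from max[of 1] show "eventually (\<lambda>n. \<forall>j<n. \<bar>d j / sqrt n\<bar> \<le> 1) sequentially" by simp
  have le: "eventually (\<lambda>n. (\<Sum>j<n. \<bar>d j / sqrt n\<bar> ^ 3) \<le> e * (\<bar>s\<bar> + 1)) sequentially" if e: "0 < e" for e
  proof -
    have "eventually (\<lambda>n. (\<Sum>j<n. (d j)\<^sup>2) / n < \<bar>s\<bar> + 1) sequentially"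
      using lim by (intro order_tendstoD) auto
    then show ?thesis using max[OF e]
    proof eventually_elim
      case (elim n)
      have "(\<Sum>j<n. \<bar>d j / sqrt n\<bar> ^ 3) \<le> (\<Sum>j<n. e * (d j / sqrt n)\<^sup>2)"
      proof (intro sum_mono)
        fix j assume "j \<in> {..<n}"
        then have "\<bar>d j / sqrt n\<bar> * \<bar>d j / sqrt n\<bar>\<^sup>2 \<le> e * \<bar>d j / sqrt n\<bar>\<^sup>2"
          using elim by (intro mult_right_mono) auto
        then show "\<bar>d j / sqrt n\<bar> ^ 3 \<le> e * (d j / sqrt n)\<^sup>2"
          by (simp only: power3_eq_cube power2_eq_square mult.assoc abs_mult_self_eq)
      qed
      also have "\<dots> = e * ((\<Sum>j<n. (d j)\<^sup>2) / n)"
        by (simp add: sum_distrib_left power_divide sum_divide_distrib)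
      also have "\<dots> \<le> e * (\<bar>s\<bar> + 1)" using elim e by (intro mult_left_mono) auto
      finally show ?case .
    qed
  qed
  show "(\<lambda>n. \<Sum>j<n. \<bar>d j / sqrt n\<bar> ^ 3) \<longlonglongrightarrow> 0"
  proof (rule order_tendstoI)
    fix a :: real assume "a < 0"
    then show "eventually (\<lambda>n. a < (\<Sum>j<n. \<bar>d j / sqrt n\<bar> ^ 3)) sequentially"
      by (auto intro!: always_eventually less_le_trans[OF _ sum_nonneg])
  next
    fix a :: real assume a: "0 < a"
    \<comment> \<open>This choice of \<open>e\<close> turns the bound
      \<open>e * (\<bar>s\<bar> + 1)\<close> into \<open>a / 2\<close>.\<close>
    have "eventually (\<lambda>n. (\<Sum>j<n. \<bar>d j / sqrt n\<bar> ^ 3) \<le> (a / (2 * (\<bar>s\<bar> + 1))) * (\<bar>s\<bar> + 1)) sequentially"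
      using a by (intro le) (simp add: divide_pos_pos add_nonneg_pos)
    moreover have "(a / (2 * (\<bar>s\<bar> + 1))) * (\<bar>s\<bar> + 1) = a / 2" by (simp add: field_simps)
    ultimately show "eventually (\<lambda>n. (\<Sum>j<n. \<bar>d j / sqrt n\<bar> ^ 3) < a) sequentially"
      using a by (auto elim!: eventually_mono)
  qed
qed

text \<open>The product of McLeish's proof: the factor with index \<open>j\<close> is switched off as soon as the
  squares before \<open>j\<close> add up to more than \<open>C\<close>, which bounds the product in \<open>L\<^sup>2\<close>.\<close>

definition mcleish_prod :: "real \<Rightarrow> (nat \<Rightarrow> real) \<Rightarrow> nat \<Rightarrow> complex" where
  "mcleish_prod C x n = (\<Prod>j<n. 1 + \<i> * complex_of_real (if (\<Sum>i<j. (x i)\<^sup>2) \<le> C then x j else 0))"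

lemma cmod_mcleish_prod_le_exp:
  "(cmod (mcleish_prod C x n))\<^sup>2 \<le> exp (\<Sum>i<n. (x i)\<^sup>2)"
proof -
  have "(cmod (mcleish_prod C x n))\<^sup>2 = (\<Prod>j<n. 1 + (if (\<Sum>i<j. (x i)\<^sup>2) \<le> C then x j else 0)\<^sup>2)"
    unfolding mcleish_prod_def by (simp only: prod_norm[symmetric] prod_power_distrib cmod_one_plus_i)
  also have "\<dots> \<le> (\<Prod>j<n. exp ((x j)\<^sup>2))"
    by (intro prod_mono) (auto simp: exp_ge_one_plus_square)
  finally show ?thesis by (simp add: exp_sum)
qed

text \<open>While factor \<open>n\<close> is active, the earlier squares add up to at most
  \<open>C\<close>, so the earlier factors contribute at most \<open>exp C\<close> and only the last
  one is estimated by its own square. Once the level is passed, the partial sums stay above it and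
  the product is frozen. The bound is linear in the squares, so second moments suffice to integrate
  it.\<close>

lemma cmod_mcleish_prod_le:
  assumes "0 \<le> C" shows "(cmod (mcleish_prod C x n))\<^sup>2 \<le> exp C * (1 + (\<Sum>i<n. (x i)\<^sup>2))"
proof (induction n)
  case 0
  show ?case using assms by (simp add: mcleish_prod_def)
next
  case (Suc n)
  show ?case
  proof (cases "(\<Sum>i<n. (x i)\<^sup>2) \<le> C")
    case True
    then have "(cmod (mcleish_prod C x (Suc n)))\<^sup>2 = (cmod (mcleish_prod C x n))\<^sup>2 * (1 + (x n)\<^sup>2)"
      unfolding mcleish_prod_def by (simp add: norm_mult power_mult_distrib cmod_one_plus_i)
    also have "(cmod (mcleish_prod C x n))\<^sup>2 \<le> exp C"
      using cmod_mcleish_prod_le_exp[of C x n] True by (meson exp_le_cancel_iff order_trans)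
    also have "1 + (x n)\<^sup>2 \<le> 1 + (\<Sum>i<Suc n. (x i)\<^sup>2)" by (simp add: sum_nonneg)
    finally show ?thesis by (simp add: mult_right_mono mult_left_mono)
  next
    case False
    then have "mcleish_prod C x (Suc n) = mcleish_prod C x n" by (simp add: mcleish_prod_def)
    moreover have "exp C * (1 + (\<Sum>i<n. (x i)\<^sup>2)) \<le> exp C * (1 + (\<Sum>i<Suc n. (x i)\<^sup>2))" by simp
    ultimately show ?thesis using Suc by (simp only:)
  qed
qed

lemma mcleish_prod_cong:
  assumes "(\<Sum>i<n. (x i)\<^sup>2) \<le> C"
  shows "mcleish_prod C x n = (\<Prod>j<n. 1 + \<i> * complex_of_real (x j))"
proof -
  have "(\<Sum>i<j. (x i)\<^sup>2) \<le> C" if "j < n" for j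
  proof -
    have "(\<Sum>i<j. (x i)\<^sup>2) \<le> (\<Sum>i<n. (x i)\<^sup>2)" using that by (intro sum_mono2) auto
    then show ?thesis using assms by simp
  qed
  then show ?thesis unfolding mcleish_prod_def by (intro prod.cong) auto
qed

text \<open>A statement about a single path. As the averages tend to \<open>s < C\<close>, no factor
  is switched off for large \<open>n\<close>, and the exponential of the sum is close to the full
  product times \<open>exp (- q / 2)\<close>, where the average \<open>q\<close> of squares tends to
  \<open>s\<close>.\<close>

lemma mcleish_limit:
  fixes d :: "nat \<Rightarrow> real"
  assumes lim: "(\<lambda>n. (\<Sum>j<n. (d j)\<^sup>2) / n) \<longlonglongrightarrow> s" and C: "s < C" "0 \<le> C"
  shows "(\<lambda>n. iexp ((\<Sum>j<n. d j) / sqrt n)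
      - complex_of_real (exp (- s / 2)) * mcleish_prod C (\<lambda>j. d j / sqrt n) n) \<longlonglongrightarrow> 0"
proof (rule Lim_null_comparison)
  let ?q = "\<lambda>n. (\<Sum>j<n. (d j)\<^sup>2) / real n"
  have q: "(\<Sum>j<n. (d j / sqrt n)\<^sup>2) = ?q n" for n
    by (simp add: power_divide sum_divide_distrib)
  have "eventually (\<lambda>n. ?q n < C) sequentially" using lim C by (intro order_tendstoD) auto
  then show "eventually (\<lambda>n. norm (iexp ((\<Sum>j<n. d j) / sqrt n)
      - complex_of_real (exp (- s / 2)) * mcleish_prod C (\<lambda>j. d j / sqrt n) n)
      \<le> 2 * (\<Sum>j<n. \<bar>d j / sqrt n\<bar> ^ 3) + exp C * \<bar>exp (- ?q n / 2) - exp (- s / 2)\<bar>) sequentially"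
    using sum_cubes_vanish(1)[OF lim]
  proof eventually_elim
    case (elim n)
    let ?T = "mcleish_prod C (\<lambda>j. d j / sqrt n) n"
    have T: "?T = (\<Prod>j<n. 1 + \<i> * complex_of_real (d j / sqrt n))"
      using elim by (intro mcleish_prod_cong) (simp add: q)
    have S: "(\<Sum>j<n. d j) / sqrt n = (\<Sum>j<n. d j / sqrt n)" by (simp add: sum_divide_distrib)
    have "(cmod ?T)\<^sup>2 \<le> exp (?q n)"
      using cmod_mcleish_prod_le_exp[of C "\<lambda>j. d j / sqrt n" n] by (simp add: q)
    also have "\<dots> \<le> exp C" using elim by simp
    \<comment> \<open>Since \<open>exp C \<ge> 1\<close>, this cruder bound avoids a square
      root.\<close>
    also have "\<dots> \<le> (exp C)\<^sup>2" using C by (intro self_le_power) auto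
    finally have Tb: "cmod ?T \<le> exp C" by (rule power2_le_imp_le) simp
    have "iexp ((\<Sum>j<n. d j) / sqrt n) - complex_of_real (exp (- s / 2)) * ?T
       = (iexp (\<Sum>j<n. d j / sqrt n) - ?T * exp (- ?q n / 2))
         + ?T * complex_of_real (exp (- ?q n / 2) - exp (- s / 2))"
      unfolding S by (simp add: ring_distribs exp_of_real[symmetric])
    then have "cmod (iexp ((\<Sum>j<n. d j) / sqrt n) - complex_of_real (exp (- s / 2)) * ?T)
       \<le> cmod (iexp (\<Sum>j<n. d j / sqrt n) - ?T * exp (- ?q n / 2))
         + cmod (?T * complex_of_real (exp (- ?q n / 2) - exp (- s / 2)))"
      by (simp only:) (rule norm_triangle_ineq)
    also have "\<dots> \<le> 2 * (\<Sum>j<n. \<bar>d j / sqrt n\<bar> ^ 3) + exp C * \<bar>exp (- ?q n / 2) - exp (- s / 2)\<bar>"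
    proof (intro add_mono)
      show "cmod (iexp (\<Sum>j<n. d j / sqrt n) - ?T * exp (- ?q n / 2)) \<le> 2 * (\<Sum>j<n. \<bar>d j / sqrt n\<bar> ^ 3)"
        using iexp_sum_approx[of n "\<lambda>j. d j / sqrt n"] elim unfolding T q exp_of_real[symmetric] by simp
      show "cmod (?T * complex_of_real (exp (- ?q n / 2) - exp (- s / 2))) \<le> exp C * \<bar>exp (- ?q n / 2) - exp (- s / 2)\<bar>"
        unfolding norm_mult norm_of_real by (intro mult_right_mono Tb) auto
    qed
    finally show ?case .
  qed
  have "(\<lambda>n. 2 * (\<Sum>j<n. \<bar>d j / sqrt n\<bar> ^ 3) + exp C * \<bar>exp (- ?q n / 2) - exp (- s / 2)\<bar>)
      \<longlonglongrightarrow> 2 * 0 + exp C * \<bar>exp (- s / 2) - exp (- s / 2)\<bar>"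
    by (intro tendsto_add tendsto_mult tendsto_const tendsto_rabs tendsto_diff tendsto_exp tendsto_minus
        tendsto_divide sum_cubes_vanish(2)[OF lim] lim) auto
  then show "(\<lambda>n. 2 * (\<Sum>j<n. \<bar>d j / sqrt n\<bar> ^ 3) + exp C * \<bar>exp (- ?q n / 2) - exp (- s / 2)\<bar>) \<longlonglongrightarrow> 0"
    by simp
qed

text \<open>\<open>F k\<close> holds the information strictly before \<open>\<xi> k\<close>. The
  vanishing conditional mean is expressed by \<open>orthogonal\<close> as integrals against all
  \<open>F k\<close>-measurable \<open>h\<close> with integrable product; \<open>h\<close> will be
  an earlier difference in the second moment and a bounded function in McLeish's product.\<close>

locale martingale_differences = prob_space M for M :: "'a measure" +
  fixes F :: "nat \<Rightarrow> 'a measure" and \<xi> :: "nat \<Rightarrow> 'a \<Rightarrow> real" and s :: real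
  assumes sub: "\<And>k. subalgebra M (F k)"
    and adapted: "\<And>j k. j < k \<Longrightarrow> \<xi> j \<in> borel_measurable (F k)"
    and square_integrable: "\<And>k. integrable M (\<lambda>\<omega>. (\<xi> k \<omega>)\<^sup>2)"
    and variance: "\<And>k. (\<integral>\<omega>. (\<xi> k \<omega>)\<^sup>2 \<partial>M) = s"
    and orthogonal: "\<And>k h. h \<in> borel_measurable (F k) \<Longrightarrow> integrable M (\<lambda>\<omega>. h \<omega> * \<xi> k \<omega>) \<Longrightarrow>
          (\<integral>\<omega>. h \<omega> * \<xi> k \<omega> \<partial>M) = 0"
begin

lemma \<xi>_measurable [measurable]: "\<xi> k \<in> borel_measurable M"
  using measurable_from_subalg[OF sub adapted[of k "Suc k"]] by simp

lemma integrable_\<xi>_mult: "integrable M (\<lambda>\<omega>. \<xi> j \<omega> * \<xi> k \<omega>)"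
proof (rule Bochner_Integration.integrable_bound)
  show "integrable M (\<lambda>\<omega>. (\<xi> j \<omega>)\<^sup>2 + (\<xi> k \<omega>)\<^sup>2)" using square_integrable by simp
  have "\<bar>x * y\<bar> \<le> x\<^sup>2 + y\<^sup>2" for x y :: real
    using sum_squares_bound[of "\<bar>x\<bar>" "\<bar>y\<bar>"] zero_le_power2[of x] zero_le_power2[of y]
    unfolding abs_mult power2_abs by linarith
  then show "AE \<omega> in M. norm (\<xi> j \<omega> * \<xi> k \<omega>) \<le> norm ((\<xi> j \<omega>)\<^sup>2 + (\<xi> k \<omega>)\<^sup>2)"
    by (intro AE_I2) (simp add: abs_mult)
qed simp

lemma second_moment_sum:
  "integrable M (\<lambda>\<omega>. (\<Sum>j<n. \<xi> j \<omega>)\<^sup>2)" "(\<integral>\<omega>. (\<Sum>j<n. \<xi> j \<omega>)\<^sup>2 \<partial>M) = n * s"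
proof (induction n)
  case (Suc n)
  have eq: "(\<Sum>j<Suc n. \<xi> j \<omega>)\<^sup>2 = (\<Sum>j<n. \<xi> j \<omega>)\<^sup>2 + 2 * (\<Sum>j<n. \<xi> j \<omega> * \<xi> n \<omega>) + (\<xi> n \<omega>)\<^sup>2" for \<omega>
    by (simp add: power2_sum sum_distrib_right)
  have 0: "(\<integral>\<omega>. \<xi> j \<omega> * \<xi> n \<omega> \<partial>M) = 0" if "j < n" for j
    by (rule orthogonal[OF adapted[OF that] integrable_\<xi>_mult])
  { case 1 show ?case unfolding eq
      using Suc square_integrable integrable_\<xi>_mult by (intro Bochner_Integration.integrable_add) auto }
  { case 2 show ?case unfolding eq
      using Suc square_integrable integrable_\<xi>_mult
      by (simp add: variance 0 Bochner_Integration.integral_sum algebra_simps) }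
qed auto

text \<open>Passing from \<open>k\<close> to \<open>Suc k\<close> adds a multiple of
  \<open>h * \<xi> k\<close>, in which the switch and the earlier factors are known in
  \<open>F k\<close>; a switch that looked at \<open>\<xi> k\<close> itself would destroy this. As
  \<open>h\<close> vanishes once the earlier squares exceed \<open>C\<close>, it is bounded, and the
  increment has mean zero.\<close>

lemma expectation_mcleish_prod:
  fixes C c :: real
  defines "P \<equiv> \<lambda>k \<omega>. mcleish_prod C (\<lambda>j. \<xi> j \<omega> / c) k"
  shows "integrable M (P k)" "(\<integral>\<omega>. P k \<omega> \<partial>M) = 1"
proof (induction k)
  case (Suc k)
  define h where "h \<omega> = (if (\<Sum>i<k. (\<xi> i \<omega> / c)\<^sup>2) \<le> C then P k \<omega> else 0)" for \<omega>
  have P: "P (Suc k) \<omega> = P k \<omega> + \<i> * (h \<omega> * complex_of_real (\<xi> k \<omega>)) / c" for \<omega>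
    unfolding P_def h_def mcleish_prod_def by (simp add: algebra_simps)
  have h: "h \<in> borel_measurable (F k)"
  proof -
    have S: "(\<lambda>\<omega>. \<Sum>i<j. (\<xi> i \<omega> / c)\<^sup>2) \<in> borel_measurable (F k)" if "j \<le> k" for j
      using that by (intro borel_measurable_sum borel_measurable_power borel_measurable_divide adapted) auto
    have "(\<lambda>\<omega>. 1 + \<i> * complex_of_real (if (\<Sum>i<j. (\<xi> i \<omega> / c)\<^sup>2) \<le> C then \<xi> j \<omega> / c else 0))
        \<in> borel_measurable (F k)" if "j < k" for j
      using S[OF less_imp_le[OF that]] adapted[OF that] by measurable
    then have [measurable]: "P k \<in> borel_measurable (F k)"
      unfolding P_def mcleish_prod_def by (intro borel_measurable_prod) auto
    show ?thesis unfolding h_def using S[OF order_refl] by measurable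
  qed
  note hM = measurable_from_subalg[OF sub h]
  have hb: "cmod (h \<omega>) \<le> sqrt (exp C)" for \<omega>
  proof (cases "(\<Sum>i<k. (\<xi> i \<omega> / c)\<^sup>2) \<le> C")
    case True
    have "(cmod (P k \<omega>))\<^sup>2 \<le> exp (\<Sum>i<k. (\<xi> i \<omega> / c)\<^sup>2)" unfolding P_def by (rule cmod_mcleish_prod_le_exp)
    also have "\<dots> \<le> exp C" using True by simp
    finally show ?thesis using True by (simp add: h_def real_le_rsqrt)
  qed (simp add: h_def)
  have \<xi>i: "integrable M (\<xi> k)" by (rule square_integrable_imp_integrable) (auto intro: square_integrable)
  have int: "integrable M (\<lambda>\<omega>. f \<omega> * \<xi> k \<omega>)"
    if "f \<in> borel_measurable (F k)" "\<And>\<omega>. \<bar>f \<omega>\<bar> \<le> sqrt (exp C)" for f :: "'a \<Rightarrow> real"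
  proof (rule Bochner_Integration.integrable_bound)
    show "integrable M (\<lambda>\<omega>. sqrt (exp C) * \<xi> k \<omega>)" using \<xi>i by simp
    show "(\<lambda>\<omega>. f \<omega> * \<xi> k \<omega>) \<in> borel_measurable M" using measurable_from_subalg[OF sub that(1)] by measurable
    show "AE \<omega> in M. norm (f \<omega> * \<xi> k \<omega>) \<le> norm (sqrt (exp C) * \<xi> k \<omega>)"
      using that(2) by (intro AE_I2) (simp add: abs_mult mult_right_mono)
  qed
  \<comment> \<open>\<open>orthogonal\<close> concerns real functions, so \<open>h\<close> is split
    into real and imaginary part.\<close>
  have Re: "integrable M (\<lambda>\<omega>. Re (h \<omega>) * \<xi> k \<omega>)" and Im: "integrable M (\<lambda>\<omega>. Im (h \<omega>) * \<xi> k \<omega>)"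
    using h hb by (auto intro!: int order_trans[OF abs_Re_le_cmod] order_trans[OF abs_Im_le_cmod])
  have eq: "h \<omega> * complex_of_real (\<xi> k \<omega>)
      = complex_of_real (Re (h \<omega>) * \<xi> k \<omega>) + \<i> * complex_of_real (Im (h \<omega>) * \<xi> k \<omega>)" for \<omega>
    by (simp add: complex_eq_iff)
  have hi: "integrable M (\<lambda>\<omega>. h \<omega> * complex_of_real (\<xi> k \<omega>))"
    unfolding eq using Re Im by (intro Bochner_Integration.integrable_add integrable_mult_right integrable_of_real) auto
  have h0: "(\<integral>\<omega>. h \<omega> * complex_of_real (\<xi> k \<omega>) \<partial>M) = 0"
  proof -
    have "(\<integral>\<omega>. h \<omega> * complex_of_real (\<xi> k \<omega>) \<partial>M)
      = complex_of_real (\<integral>\<omega>. Re (h \<omega>) * \<xi> k \<omega> \<partial>M) + \<i> * complex_of_real (\<integral>\<omega>. Im (h \<omega>) * \<xi> k \<omega> \<partial>M)"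
      unfolding eq using Re Im
      by (subst Bochner_Integration.integral_add)
        (auto simp del: of_real_mult intro: integrable_mult_right integrable_of_real)
    then show ?thesis using orthogonal[OF _ Re] orthogonal[OF _ Im] h by simp
  qed
  { case 1 show ?case unfolding P using Suc hi by simp }
  { case 2 show ?case unfolding P using Suc hi h0 by simp }
qed (auto simp: P_def mcleish_prod_def prob_space)

text \<open>Since the product has mean 1, the characteristic function minus
  \<open>exp (- s / 2)\<close> is the mean of \<open>W n\<close>, which tends to 0 along almost
  every path and is bounded in \<open>L\<^sup>2\<close>.\<close>

theorem central_limit:
  assumes lln: "AE \<omega> in M. (\<lambda>n. (\<Sum>j<n. (\<xi> j \<omega>)\<^sup>2) / n) \<longlonglongrightarrow> s"
  shows "(\<lambda>n. \<integral>\<omega>. iexp ((\<Sum>j<n. \<xi> j \<omega>) / sqrt n) \<partial>M) \<longlonglongrightarrow> exp (- s / 2)"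
proof -
  have s: "0 \<le> s" using variance[of 0] by (metis integral_nonneg_AE AE_I2 zero_le_power2)
  \<comment> \<open>The level \<open>s + 1\<close> lies above the limit of the averaged squares, so
    the switches are inactive in the limit.\<close>
  define T where "T n \<omega> = mcleish_prod (s + 1) (\<lambda>j. \<xi> j \<omega> / sqrt n) n" for n \<omega>
  define W where "W n \<omega> = iexp ((\<Sum>j<n. \<xi> j \<omega>) / sqrt n) - complex_of_real (exp (- s / 2)) * T n \<omega>" for n \<omega>
  \<comment> \<open>An integrable majorant of the squared modulus of \<open>W n\<close>, from
    \<open>(1 + b)\<^sup>2 \<le> 2 + 2 * b\<^sup>2\<close>; its mean is bounded in
    \<open>n\<close>.\<close>
  define R where "R n \<omega> = 2 + 2 * (exp (s + 1) * (1 + (\<Sum>j<n. (\<xi> j \<omega> / sqrt n)\<^sup>2)))" for n \<omega>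
  have Ti: "integrable M (T n)" "(\<integral>\<omega>. T n \<omega> \<partial>M) = 1" for n
    unfolding T_def by (rule expectation_mcleish_prod)+
  have ii: "integrable M (\<lambda>\<omega>. iexp ((\<Sum>j<n. \<xi> j \<omega>) / sqrt n))" for n
    by (intro integrable_const_bound[where B=1]) auto
  have [measurable]: "T n \<in> borel_measurable M" for n using Ti by auto
  have Wm[measurable]: "W n \<in> borel_measurable M" for n unfolding W_def by measurable
  have Ri: "integrable M (R n)" for n
    unfolding R_def using square_integrable by (auto simp: power_divide)
  have "(\<integral>\<omega>. R n \<omega> \<partial>M) = 2 + 2 * (exp (s + 1) * (1 + (\<Sum>j<n. s / n)))" for n
    unfolding R_def using square_integrable
    by (simp add: power_divide prob_space variance Bochner_Integration.integral_sum)
  moreover have "(\<Sum>j<n. s / real n) \<le> s" for n using s by (cases "n = 0") auto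
  ultimately have RE: "(\<integral>\<omega>. R n \<omega> \<partial>M) \<le> 2 + 2 * (exp (s + 1) * (1 + s))" for n
    by simp
  have WR: "(cmod (W n \<omega>))\<^sup>2 \<le> R n \<omega>" for n \<omega>
  proof -
    have "cmod (complex_of_real (exp (- s / 2)) * T n \<omega>) \<le> 1 * cmod (T n \<omega>)"
      unfolding norm_mult norm_of_real using s by (intro mult_right_mono) auto
    then have "cmod (W n \<omega>) \<le> 1 + cmod (T n \<omega>)"
      unfolding W_def by (intro norm_triangle_le_diff) auto
    then have "(cmod (W n \<omega>))\<^sup>2 \<le> (1 + cmod (T n \<omega>))\<^sup>2" by (intro power_mono) auto
    also have "\<dots> \<le> 2 + 2 * (cmod (T n \<omega>))\<^sup>2"
      using zero_le_power2[of "1 - cmod (T n \<omega>)"] by (simp add: power2_eq_square algebra_simps)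
    also have "(cmod (T n \<omega>))\<^sup>2 \<le> exp (s + 1) * (1 + (\<Sum>j<n. (\<xi> j \<omega> / sqrt n)\<^sup>2))"
      unfolding T_def using s by (intro cmod_mcleish_prod_le) auto
    finally show ?thesis by (simp add: R_def)
  qed
  have W2: "integrable M (\<lambda>\<omega>. (cmod (W n \<omega>))\<^sup>2)" for n
    by (rule Bochner_Integration.integrable_bound[OF Ri[of n]]) (auto intro!: AE_I2 order_trans[OF WR])
  have "(\<lambda>n. \<integral>\<omega>. W n \<omega> \<partial>M) \<longlonglongrightarrow> 0"
  proof (rule tendsto_integral_L2_bounded[OF Wm W2])
    show "(\<integral>\<omega>. (cmod (W n \<omega>))\<^sup>2 \<partial>M) \<le> 2 + 2 * (exp (s + 1) * (1 + s))" for n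
      by (rule order_trans[OF integral_mono[OF W2 Ri WR] RE])
    show "AE \<omega> in M. (\<lambda>n. W n \<omega>) \<longlonglongrightarrow> 0"
      using lln
    proof eventually_elim
      case (elim \<omega>)
      show ?case unfolding W_def T_def by (rule mcleish_limit[OF elim]) (use s in auto)
    qed
  qed
  moreover have "(\<integral>\<omega>. W n \<omega> \<partial>M) = (\<integral>\<omega>. iexp ((\<Sum>j<n. \<xi> j \<omega>) / sqrt n) \<partial>M) - exp (- s / 2)" for n
    unfolding W_def using ii Ti by simp
  ultimately show ?thesis by (simp add: LIM_zero_iff)
qed

end

section \<open>Convergence in law from characteristic functions\<close>

text \<open>Finite combinations of characters form an algebra, and their integrals depend linearly
  on the characteristic function. The first property admits polynomials in sines, the second gives
  convergence of the integrals.\<close>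

inductive trig_poly :: "(real ^ 'n \<Rightarrow> complex) \<Rightarrow> bool" where
  monomial: "trig_poly (\<lambda>y. c * iexp (s \<bullet> y))"
| add: "trig_poly f \<Longrightarrow> trig_poly g \<Longrightarrow> trig_poly (\<lambda>y. f y + g y)"

lemma trig_poly_const: "trig_poly (\<lambda>_. c)"
  using trig_poly.monomial[of c 0] by simp

lemma trig_poly_monomial_mult: "trig_poly g \<Longrightarrow> trig_poly (\<lambda>y. c * iexp (s \<bullet> y) * g y)"
proof (induction rule: trig_poly.induct)
  case (monomial d r)
  have "c * iexp (s \<bullet> y) * (d * iexp (r \<bullet> y)) = (c * d) * iexp ((s + r) \<bullet> y)" for y
    by (simp add: inner_add_left exp_add distrib_left)
  then show ?case using trig_poly.monomial[of "c * d" "s + r"] by (simp only:)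
next
  case (add f g)
  then show ?case using trig_poly.add by (fastforce simp: distrib_left)
qed

lemma trig_poly_mult: "trig_poly f \<Longrightarrow> trig_poly g \<Longrightarrow> trig_poly (\<lambda>y. f y * g y)"
proof (induction rule: trig_poly.induct)
  case (monomial c s)
  then show ?case by (rule trig_poly_monomial_mult)
next
  case (add f h)
  have "trig_poly (\<lambda>y. f y * g y + h y * g y)" using add by (intro trig_poly.add) auto
  then show ?case by (simp add: distrib_right)
qed

lemma trig_poly_sum: "finite I \<Longrightarrow> (\<And>i. i \<in> I \<Longrightarrow> trig_poly (f i)) \<Longrightarrow> trig_poly (\<lambda>y. \<Sum>i\<in>I. f i y)"
  by (induction I rule: finite_induct) (auto intro: trig_poly_const trig_poly.add)

lemma trig_poly_sin:
  fixes i :: "'n::finite"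
  shows "trig_poly (\<lambda>y. complex_of_real (sin (c * y $ i)))"
proof -
  have "complex_of_real (sin (c * y $ i))
     = (1 / (2 * \<i>)) * iexp (axis i c \<bullet> y) + (- 1 / (2 * \<i>)) * iexp (axis i (- c) \<bullet> y)" for y :: "real ^ 'n"
    by (simp add: sin_of_real[symmetric] sin_exp_eq inner_axis') (simp add: algebra_simps diff_divide_distrib)
  then show ?thesis
    using trig_poly.add[OF trig_poly.monomial[of "1 / (2 * \<i>)" "axis i c"] trig_poly.monomial[of "- 1 / (2 * \<i>)" "axis i (- c)"]]
    by simp
qed

lemma trig_poly_polynomial_sin:
  fixes p :: "real ^ 'n \<Rightarrow> real"
  assumes "real_polynomial_function p"
  shows "trig_poly (\<lambda>y. complex_of_real (p (\<chi> i. sin (c * y $ i))))"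
  using assms
proof (induction rule: real_polynomial_function.induct)
  case (linear p)
  then interpret bounded_linear p .
  have "p (\<chi> i. sin (c * y $ i)) = (\<Sum>i\<in>UNIV. p (axis i 1) * sin (c * y $ i))" for y
  proof -
    have "(\<chi> i. sin (c * y $ i)) = (\<Sum>i\<in>UNIV. sin (c * y $ i) *\<^sub>R axis i 1)"
      by (simp add: vec_eq_iff axis_def if_distrib cong: if_cong)
    then show ?thesis by (simp add: sum scaleR mult.commute)
  qed
  moreover have "trig_poly (\<lambda>y. \<Sum>i\<in>UNIV. complex_of_real (p (axis i 1)) * complex_of_real (sin (c * y $ i)))"
    by (intro trig_poly_sum trig_poly_mult trig_poly_const trig_poly_sin) simp
  ultimately show ?case by simp
next
  case (const a)
  show ?case by (rule trig_poly_const)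
next
  case (add p q)
  then show ?case using trig_poly.add by fastforce
next
  case (mult p q)
  then show ?case using trig_poly_mult by fastforce
qed

lemma trig_poly_measurable: "trig_poly f \<Longrightarrow> f \<in> borel_measurable borel"
  by (induction rule: trig_poly.induct) auto

lemma trig_poly_bounded: "trig_poly f \<Longrightarrow> \<exists>B. \<forall>y. cmod (f y) \<le> B"
proof (induction rule: trig_poly.induct)
  case (monomial c s)
  then show ?case by (auto simp: norm_mult)
next
  case (add f g)
  then obtain B C where "cmod (f y) \<le> B" "cmod (g y) \<le> C" for y by blast
  then have "cmod (f y + g y) \<le> B + C" for y by (meson add_mono norm_triangle_le)
  then show ?case by blast
qed

lemma trig_poly_integrable:
  assumes "trig_poly f" "prob_space M" "Y \<in> borel_measurable M"
  shows "integrable M (\<lambda>\<omega>. f (Y \<omega>))"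
proof -
  interpret prob_space M by fact
  from trig_poly_bounded[OF assms(1)] obtain B where "\<And>y. cmod (f y) \<le> B" by blast
  then show ?thesis
    using measurable_compose[OF assms(3) trig_poly_measurable[OF assms(1)]]
    by (intro integrable_const_bound[where B=B]) auto
qed

lemma trig_poly_convergence:
  fixes Y :: "nat \<Rightarrow> 'a \<Rightarrow> real ^ 'n"
  assumes f: "trig_poly f"
    and M: "prob_space M" and N: "prob_space N" and "sets N = sets borel"
    and Y: "\<And>n. Y n \<in> borel_measurable M"
    and char: "\<And>s. (\<lambda>n. \<integral>\<omega>. iexp (s \<bullet> Y n \<omega>) \<partial>M) \<longlonglongrightarrow> (\<integral>y. iexp (s \<bullet> y) \<partial>N)"
  shows "(\<lambda>n. \<integral>\<omega>. f (Y n \<omega>) \<partial>M) \<longlonglongrightarrow> (\<integral>y. f y \<partial>N)"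
  using f
proof (induction rule: trig_poly.induct)
  case (monomial c s)
  show ?case
    using tendsto_mult[OF tendsto_const[of c] char[of s]] by (simp only: integral_mult_right_zero)
next
  case (add f g)
  have "(\<lambda>y. y) \<in> borel_measurable N" using assms(4) by (simp add: measurable_ident_sets)
  then show ?case
    using tendsto_add[OF add.IH] trig_poly_integrable[OF add.hyps(1) M Y] trig_poly_integrable[OF add.hyps(2) M Y]
      trig_poly_integrable[OF add.hyps(1) N, of "\<lambda>y. y"] trig_poly_integrable[OF add.hyps(2) N, of "\<lambda>y. y"]
    by simp
qed

text \<open>Composing with the triangular wave \<open>x \<mapsto> arcsin (sin (c x)) / c\<close>, which is the identity
  near 0, makes \<open>f\<close> periodic, so that a polynomial in sines approximates it on all of space.\<close>

lemma periodic_approximation: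
  fixes f :: "real ^ 'n \<Rightarrow> real"
  assumes f: "continuous_on UNIV f" and K: "\<And>y. \<bar>f y\<bar> \<le> K" and R: "0 < R" and e: "0 < e"
  obtains p where "trig_poly (\<lambda>y. complex_of_real (p y))" "\<And>y. \<bar>p y\<bar> \<le> K + e"
    "\<And>y. norm y \<le> R \<Longrightarrow> \<bar>f y - p y\<bar> \<le> e"
proof -
  \<comment> \<open>For \<open>norm y \<le> R\<close> every \<open>c * y $ i\<close> lies between
    \<open>- pi / 2\<close> and \<open>pi / 2\<close>, where arcsin inverts the sine.\<close>
  define c where "c = pi / (2 * R)"
  have c: "c > 0" using R by (simp add: c_def)
  define F where "F z = f (\<chi> i. arcsin (z $ i) / c)" for z :: "real ^ 'n"
  define S :: "(real ^ 'n) set" where "S = {z. \<forall>i. \<bar>z $ i\<bar> \<le> 1}"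
  have S: "S = cbox (\<chi> i. - 1) (\<chi> i. 1)" by (auto simp: S_def mem_box_cart abs_le_iff minus_le_iff)
  have "compact S" unfolding S by (rule compact_cbox)
  moreover have "continuous_on S F"
    unfolding F_def
  proof (rule continuous_on_compose2[OF f _ subset_UNIV])
    show "continuous_on S (\<lambda>z. \<chi> i. arcsin (z $ i) / c)"
      by (intro continuous_on_vec_lambda continuous_on_divide continuous_on_arcsin continuous_on_component
          continuous_on_id continuous_on_const) (use c in \<open>auto simp: S_def abs_le_iff minus_le_iff\<close>)
  qed
  ultimately obtain q where q: "real_polynomial_function q" "\<And>z. z \<in> S \<Longrightarrow> \<bar>F z - q z\<bar> < e"
    using Stone_Weierstrass_real_polynomial_function[of S F e] e by blast
  \<comment> \<open>The sines land in the cube \<open>S\<close> for every \<open>y\<close>, so the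
    bound on \<open>p\<close> holds on all of space, although closeness to \<open>f\<close> is only
    claimed on the ball.\<close>
  define p where "p y = q (\<chi> i. sin (c * y $ i))" for y
  have sS: "(\<chi> i. sin (c * y $ i)) \<in> S" for y by (simp add: S_def)
  show thesis
  proof
    show "trig_poly (\<lambda>y. complex_of_real (p y))" unfolding p_def by (rule trig_poly_polynomial_sin[OF q(1)])
    fix y :: "real ^ 'n"
    show "\<bar>p y\<bar> \<le> K + e"
      using q(2)[OF sS[of y]] K[of "\<chi> i. arcsin (sin (c * y $ i)) / c"] unfolding p_def F_def by simp
    assume y: "norm y \<le> R"
    have "arcsin (sin (c * y $ i)) / c = y $ i" for i
    proof -
      have "\<bar>y $ i\<bar> \<le> R" using component_le_norm_cart[of y i] y by simp
      then have "\<bar>c * y $ i\<bar> \<le> c * R" using c by (simp add: abs_mult)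
      then have "\<bar>c * y $ i\<bar> \<le> pi / 2" using R by (simp add: c_def)
      then show ?thesis using c by (subst arcsin_sin) (auto simp: abs_le_iff)
    qed
    then have "F (\<chi> i. sin (c * y $ i)) = f y" by (simp add: F_def)
    then show "\<bar>f y - p y\<bar> \<le> e" using q(2)[OF sS[of y]] by (simp add: p_def)
  qed
qed

lemma tail_vanishes:
  fixes N :: "'b::real_normed_vector measure"
  assumes N: "prob_space N" "sets N = sets borel" and e: "0 < e"
  obtains R where "0 < R" "\<And>r. R \<le> r \<Longrightarrow> (\<integral>y. indicat_real {y. r < norm y} y \<partial>N) < e"
proof -
  interpret prob_space N by fact
  have [measurable_cong]: "sets N = sets borel" by fact
  have "(\<lambda>k::nat. \<integral>y. indicat_real {y. real k < norm y} y \<partial>N) \<longlonglongrightarrow> (\<integral>y. 0 \<partial>N)"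
  proof (rule integral_dominated_convergence[where w="\<lambda>_. 1"])
    show "AE y in N. (\<lambda>k::nat. indicat_real {y. real k < norm y} y) \<longlonglongrightarrow> 0"
    proof (intro AE_I2)
      fix y :: 'b
      obtain n :: nat where "norm y \<le> n" using real_arch_simple by blast
      then have "eventually (\<lambda>k::nat. indicat_real {y. real k < norm y} y = 0) sequentially"
        by (intro eventually_sequentiallyI[of n]) auto
      then show "(\<lambda>k::nat. indicat_real {y. real k < norm y} y) \<longlonglongrightarrow> 0" by (rule tendsto_eventually)
    qed
  qed (auto simp: indicator_def)
  then have "eventually (\<lambda>k::nat. (\<integral>y. indicat_real {y. real k < norm y} y \<partial>N) < e) sequentially"
    using e by (intro order_tendstoD) auto
  then obtain k :: nat where k: "(\<integral>y. indicat_real {y. real k < norm y} y \<partial>N) < e"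
    by (auto simp: eventually_sequentially)
  show thesis
  proof (rule that[of "real (Suc k)"])
    fix r assume "real (Suc k) \<le> r"
    then have "(\<integral>y. indicat_real {y. r < norm y} y \<partial>N) \<le> (\<integral>y. indicat_real {y. real k < norm y} y \<partial>N)"
      by (intro integral_mono integrable_const_bound[where B=1]) (auto simp: indicator_def)
    with k show "(\<integral>y. indicat_real {y. r < norm y} y \<partial>N) < e" by simp
  qed simp
qed

lemma norm_iexp_diff: "cmod (iexp a - iexp b) \<le> \<bar>a - b\<bar>"
proof -
  have "iexp a - iexp b = iexp b * (iexp (a - b) - 1)"
    by (simp add: right_diff_distrib exp_add[symmetric] of_real_diff)
  then have "cmod (iexp a - iexp b) = cmod (iexp (a - b) - 1)" by (simp add: norm_mult)
  also have "\<dots> \<le> \<bar>a - b\<bar>" using iexp_approx1[of "a - b" 0] by simp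
  finally show ?thesis .
qed

text \<open>\<open>U\<close> plays the part of a linearised \<open>Y\<close>, and moments are only
  asked of \<open>U\<close>. Characteristic functions pass from \<open>U\<close> to \<open>Y\<close>
  because \<open>iexp\<close> is bounded and Lipschitz. For tightness, a large \<open>Y\<close>
  forces a large \<open>U\<close> or a difference of norm at least 1. On a large ball the test
  function is then replaced by a trigonometric polynomial that is bounded everywhere.\<close>

theorem converges_in_lawI:
  fixes U Y :: "nat \<Rightarrow> 'a \<Rightarrow> real ^ 'n"
  assumes M: "prob_space M" and N: "prob_space N" "sets N = sets borel"
    and U [measurable]: "\<And>n. U n \<in> borel_measurable M" and Y [measurable]: "\<And>n. Y n \<in> borel_measurable M"
    and U2: "\<And>n. integrable M (\<lambda>\<omega>. (norm (U n \<omega>))\<^sup>2)" and B: "\<And>n. (\<integral>\<omega>. (norm (U n \<omega>))\<^sup>2 \<partial>M) \<le> B"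
    and diff: "(\<lambda>n. \<integral>\<omega>. min 1 (norm (Y n \<omega> - U n \<omega>)) \<partial>M) \<longlonglongrightarrow> 0"
    and char: "\<And>s. (\<lambda>n. \<integral>\<omega>. iexp (s \<bullet> U n \<omega>) \<partial>M) \<longlonglongrightarrow> (\<integral>y. iexp (s \<bullet> y) \<partial>N)"
  shows "converges_in_law M Y N"
  unfolding converges_in_law_def
proof (intro conjI allI impI)
  interpret prob_space M by fact
  interpret N: prob_space N by fact
  have [measurable_cong]: "sets N = sets borel" by fact
  define D where "D n = (\<integral>\<omega>. min 1 (norm (Y n \<omega> - U n \<omega>)) \<partial>M)" for n
  have Di: "integrable M (\<lambda>\<omega>. min 1 (norm (Y n \<omega> - U n \<omega>)))" for n
    by (intro integrable_const_bound[where B=1]) auto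
  have charY: "(\<lambda>n. \<integral>\<omega>. iexp (s \<bullet> Y n \<omega>) \<partial>M) \<longlonglongrightarrow> (\<integral>y. iexp (s \<bullet> y) \<partial>N)" for s
  proof -
    have "(\<lambda>n. (\<integral>\<omega>. iexp (s \<bullet> Y n \<omega>) \<partial>M) - (\<integral>\<omega>. iexp (s \<bullet> U n \<omega>) \<partial>M)) \<longlonglongrightarrow> 0"
    proof (rule Lim_null_comparison)
      have "cmod ((\<integral>\<omega>. iexp (s \<bullet> Y n \<omega>) \<partial>M) - (\<integral>\<omega>. iexp (s \<bullet> U n \<omega>) \<partial>M)) \<le> (2 + norm s) * D n" for n
      proof -
        \<comment> \<open>2 bounds the distance of two unimodular numbers, and \<open>norm s\<close>
          is the Lipschitz constant.\<close>
        have "cmod (iexp (s \<bullet> y) - iexp (s \<bullet> u)) \<le> (2 + norm s) * min 1 (norm (y - u))" for u y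
        proof -
          have "cmod (iexp (s \<bullet> y) - iexp (s \<bullet> u)) \<le> cmod (iexp (s \<bullet> y)) + cmod (iexp (s \<bullet> u))"
            by (rule norm_triangle_ineq4)
          moreover have "cmod (iexp (s \<bullet> y) - iexp (s \<bullet> u)) \<le> norm s * norm (y - u)"
            using norm_iexp_diff[of "s \<bullet> y" "s \<bullet> u"] Cauchy_Schwarz_ineq2[of s "y - u"]
            by (simp add: inner_diff_right)
          ultimately show ?thesis
            unfolding min_def distrib_right
            by (cases "1 \<le> norm (y - u)"; simp)
              (insert norm_ge_zero[of s] norm_ge_zero[of "y - u"], linarith+)
        qed
        moreover have i: "integrable M (\<lambda>\<omega>. iexp (s \<bullet> V \<omega>))" if [measurable]: "V \<in> borel_measurable M" for V
          by (intro integrable_const_bound[where B=1]) auto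
        ultimately have "(\<integral>\<omega>. cmod (iexp (s \<bullet> Y n \<omega>) - iexp (s \<bullet> U n \<omega>)) \<partial>M)
            \<le> (\<integral>\<omega>. (2 + norm s) * min 1 (norm (Y n \<omega> - U n \<omega>)) \<partial>M)"
          using i[OF Y] i[OF U] Di by (intro integral_mono) auto
        also have "\<dots> = (2 + norm s) * D n" by (simp add: D_def)
        finally show ?thesis
          using i[OF Y, of n] i[OF U, of n] integral_norm_bound[of M "\<lambda>\<omega>. iexp (s \<bullet> Y n \<omega>) - iexp (s \<bullet> U n \<omega>)"]
          by simp
      qed
      then show "eventually (\<lambda>n. cmod ((\<integral>\<omega>. iexp (s \<bullet> Y n \<omega>) \<partial>M) - (\<integral>\<omega>. iexp (s \<bullet> U n \<omega>) \<partial>M)) \<le> (2 + norm s) * D n) sequentially"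
        by (intro always_eventually) blast
      show "(\<lambda>n. (2 + norm s) * D n) \<longlonglongrightarrow> 0"
        using tendsto_mult[OF tendsto_const[of "2 + norm s"] diff] by (simp add: D_def)
    qed
    from tendsto_add[OF this char[of s]] show ?thesis by simp
  qed
  fix f :: "real ^ 'n \<Rightarrow> real" assume f: "continuous_on UNIV f \<and> bounded (range f)"
  then obtain K where K: "\<And>y. \<bar>f y\<bar> \<le> K" by (auto simp: bounded_iff)
  have K0: "0 \<le> K" using K[of 0] by simp
  have [measurable]: "f \<in> borel_measurable borel" using f by (intro borel_measurable_continuous_onI) auto
  have key: "eventually (\<lambda>n. \<bar>(\<integral>\<omega>. f (Y n \<omega>) \<partial>M) - (\<integral>y. f y \<partial>N)\<bar> \<le> e * (3 + (2 * K + 1) * 3)) sequentially"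
    if e: "0 < e" "e \<le> 1" for e
  proof -
    obtain R0 where R0: "0 < R0" "\<And>r. R0 \<le> r \<Longrightarrow> (\<integral>y. indicat_real {y. r < norm y} y \<partial>N) < e"
      using tail_vanishes[OF N e(1)] by blast
    \<comment> \<open>\<open>R \<ge> 2\<close> makes half the radius at least 1,
      \<open>R \<ge> R0\<close> handles the tail of the limit law, and the last entry makes
      \<open>4 * (\<bar>B\<bar> + 1) / R\<^sup>2\<close> at most \<open>e\<close>.\<close>
    define R where "R = max (max 2 R0) (4 * (\<bar>B\<bar> + 1) / e)"
    have R: "2 \<le> R" "R0 \<le> R" "4 * (\<bar>B\<bar> + 1) / e \<le> R" "0 < R" by (auto simp: R_def)
    obtain p where p: "trig_poly (\<lambda>y. complex_of_real (p y))" "\<And>y. \<bar>p y\<bar> \<le> K + e"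
        "\<And>y. norm y \<le> R \<Longrightarrow> \<bar>f y - p y\<bar> \<le> e"
      using periodic_approximation[of f K R e] f K R(4) e(1) by blast
    have pm [measurable]: "p \<in> borel_measurable borel"
      using measurable_compose[OF trig_poly_measurable[OF p(1)] borel_measurable_Re] by simp
    have pt: "\<bar>f y - p y\<bar> \<le> e + (2 * K + 1) * indicat_real {y. R < norm y} y" for y
      using p(2)[of y] p(3)[of y] K[of y] e by (cases "norm y \<le> R") auto
    \<comment> \<open>Stated for an arbitrary space because it is applied to \<open>Y n\<close>
      under \<open>M\<close> and to the identity under \<open>N\<close>.\<close>
    have gen: "\<bar>(\<integral>\<omega>. f (V \<omega>) \<partial>Q) - (\<integral>\<omega>. p (V \<omega>) \<partial>Q)\<bar>
        \<le> e + (2 * K + 1) * (\<integral>\<omega>. indicat_real {y. R < norm y} (V \<omega>) \<partial>Q)"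
      if Q: "prob_space Q" and [measurable]: "V \<in> borel_measurable Q" for Q :: "'c measure" and V
    proof -
      interpret Q: prob_space Q by fact
      have fi: "integrable Q (\<lambda>\<omega>. f (V \<omega>))" by (intro Q.integrable_const_bound[where B=K]) (auto simp: K)
      have pi: "integrable Q (\<lambda>\<omega>. p (V \<omega>))" by (intro Q.integrable_const_bound[where B="K + e"]) (auto simp: p)
      have ii: "integrable Q (\<lambda>\<omega>. indicat_real {y. R < norm y} (V \<omega>))"
        by (intro Q.integrable_const_bound[where B=1]) (auto simp: indicator_def)
      have "\<bar>(\<integral>\<omega>. f (V \<omega>) - p (V \<omega>) \<partial>Q)\<bar> \<le> (\<integral>\<omega>. \<bar>f (V \<omega>) - p (V \<omega>)\<bar> \<partial>Q)"
        by (rule integral_abs_bound)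
      also have "\<dots> \<le> (\<integral>\<omega>. e + (2 * K + 1) * indicat_real {y. R < norm y} (V \<omega>) \<partial>Q)"
        using fi pi ii by (intro integral_mono pt) auto
      also have "\<dots> = e + (2 * K + 1) * (\<integral>\<omega>. indicat_real {y. R < norm y} (V \<omega>) \<partial>Q)"
        using ii by (simp add: Q.prob_space)
      finally show ?thesis using fi pi by simp
    qed
    have tailY: "(\<integral>\<omega>. indicat_real {y. R < norm y} (Y n \<omega>) \<partial>M) \<le> e + D n" for n
    proof -
      \<comment> \<open>If \<open>norm u \<le> R / 2\<close>, the difference has norm at least
        \<open>R / 2 \<ge> 1\<close>; otherwise the first term alone is at least 1, as in
        Chebyshev's inequality.\<close>
      have "indicat_real {y. R < norm y} y \<le> 4 / R\<^sup>2 * (norm u)\<^sup>2 + min 1 (norm (y - u))" for u y :: "real ^ 'n"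
      proof (cases "R < norm y")
        case True
        show ?thesis
        proof (cases "norm u \<le> R / 2")
          case True
          then have "1 \<le> norm (y - u)" using \<open>R < norm y\<close> R norm_triangle_ineq2[of y u] by linarith
          then show ?thesis using R by (simp add: indicator_def)
        next
          case False
          then have "(R / 2)\<^sup>2 \<le> (norm u)\<^sup>2" using R by (intro power_mono) auto
          then have "1 \<le> 4 / R\<^sup>2 * (norm u)\<^sup>2" using R by (simp add: field_simps)
          then show ?thesis by (auto simp: indicator_def intro: order_trans add_increasing2)
        qed
      qed simp
      moreover have "integrable M (\<lambda>\<omega>. indicat_real {y. R < norm y} (Y n \<omega>))"
        by (intro integrable_const_bound[where B=1]) (auto simp: indicator_def)
      ultimately have "(\<integral>\<omega>. indicat_real {y. R < norm y} (Y n \<omega>) \<partial>M)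
          \<le> (\<integral>\<omega>. 4 / R\<^sup>2 * (norm (U n \<omega>))\<^sup>2 + min 1 (norm (Y n \<omega> - U n \<omega>)) \<partial>M)"
        using U2 Di by (intro integral_mono) auto
      also have "\<dots> = 4 / R\<^sup>2 * (\<integral>\<omega>. (norm (U n \<omega>))\<^sup>2 \<partial>M) + D n"
        using U2 Di by (simp add: D_def)
      also have "4 / R\<^sup>2 * (\<integral>\<omega>. (norm (U n \<omega>))\<^sup>2 \<partial>M) \<le> 4 / R\<^sup>2 * (\<bar>B\<bar> + 1)"
        using B[of n] by (intro mult_left_mono) auto
      also have "\<dots> = (4 * (\<bar>B\<bar> + 1) / R) / R" by (simp add: power2_eq_square)
      also have "\<dots> \<le> (4 * (\<bar>B\<bar> + 1) / R) / 1" using R by (intro divide_left_mono) auto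
      also have "\<dots> \<le> e" using R e by (simp add: field_simps)
      finally show ?thesis by simp
    qed
    have "(\<lambda>n. \<integral>\<omega>. complex_of_real (p (Y n \<omega>)) \<partial>M) \<longlonglongrightarrow> (\<integral>y. complex_of_real (p y) \<partial>N)"
      by (rule trig_poly_convergence[OF p(1) M N Y charY])
    then have "(\<lambda>n. \<integral>\<omega>. p (Y n \<omega>) \<partial>M) \<longlonglongrightarrow> (\<integral>y. p y \<partial>N)"
      by (simp add: tendsto_of_real_iff)
    then have "eventually (\<lambda>n. \<bar>(\<integral>\<omega>. p (Y n \<omega>) \<partial>M) - (\<integral>y. p y \<partial>N)\<bar> < e) sequentially"
      using e by (auto simp: tendsto_iff dist_real_def)
    moreover have "eventually (\<lambda>n. D n < e) sequentially"
      using diff e unfolding D_def by (intro order_tendstoD) auto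
    ultimately show ?thesis
    proof eventually_elim
      case (elim n)
      have 1: "\<bar>(\<integral>\<omega>. f (Y n \<omega>) \<partial>M) - (\<integral>\<omega>. p (Y n \<omega>) \<partial>M)\<bar> \<le> e + (2 * K + 1) * (2 * e)"
      proof (rule order_trans[OF gen[OF M Y]])
        show "e + (2 * K + 1) * (\<integral>\<omega>. indicat_real {y. R < norm y} (Y n \<omega>) \<partial>M) \<le> e + (2 * K + 1) * (2 * e)"
          using tailY[of n] elim K0 by (intro add_left_mono mult_left_mono) auto
      qed
      have 2: "\<bar>(\<integral>y. f y \<partial>N) - (\<integral>y. p y \<partial>N)\<bar> \<le> e + (2 * K + 1) * e"
      proof (rule order_trans[OF gen[OF N(1), of "\<lambda>y. y"]])
        show "e + (2 * K + 1) * (\<integral>y. indicat_real {y. R < norm y} y \<partial>N) \<le> e + (2 * K + 1) * e"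
          using R0(2)[OF R(2)] K0 by (intro add_left_mono mult_left_mono) auto
      qed simp
      have "(2 * K + 1) * (2 * e) + (2 * K + 1) * e = e * ((2 * K + 1) * 3)" by (simp add: algebra_simps)
      then show ?case using 1 2 elim unfolding distrib_left by linarith
    qed
  qed
  show "(\<lambda>n. \<integral>\<omega>. f (Y n \<omega>) \<partial>M) \<longlonglongrightarrow> (\<integral>y. f y \<partial>N)"
  proof (rule LIMSEQ_I)
    fix r :: real assume r: "0 < r"
    \<comment> \<open>Three approximation errors of size \<open>e\<close>, and tails weighted by
      \<open>2 * K + 1\<close>: \<open>2 * e\<close> for \<open>Y n\<close> and \<open>e\<close> for
      the limit.\<close>
    define k where "k = 3 + (2 * K + 1) * 3"
    define e where "e = min 1 (r / (2 * k))"
    have k: "0 < k" using K0 by (simp add: k_def add_pos_nonneg)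
    have e: "0 < e" "e \<le> 1" using r k by (auto simp: e_def)
    have "e * k \<le> r / (2 * k) * k" using k by (intro mult_right_mono) (auto simp: e_def)
    also have "\<dots> < r" using k r by simp
    finally have "e * k < r" .
    with key[OF e] show "\<exists>no. \<forall>n\<ge>no. norm ((\<integral>\<omega>. f (Y n \<omega>) \<partial>M) - (\<integral>y. f y \<partial>N)) < r"
      unfolding k_def eventually_sequentially by (auto intro: le_less_trans)
  qed
qed (rule Y)

section \<open>Normal laws with singular covariance\<close>

text \<open>Symmetric Gaussian elimination: a nonzero pivot is split off as a rank-one term, and the
  Schur complement is again positive semidefinite and vanishes in row \<open>a\<close>; a zero pivot
  forces its whole row to vanish. The induction runs over the set \<open>S\<close> of possibly
  nonzero rows, so the matrix type stays fixed.\<close>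

lemma psd_decomposition_supported:
  fixes A :: "real ^ 'n ^ 'n"
  assumes "finite S" and "\<And>i j. A $ i $ j = A $ j $ i" and "\<And>x. 0 \<le> x \<bullet> (A *v x)"
    and "\<And>i j. i \<notin> S \<Longrightarrow> A $ i $ j = 0"
  shows "\<exists>v :: 'n \<Rightarrow> real ^ 'n. \<forall>i j. A $ i $ j = (\<Sum>k\<in>S. v k $ i * v k $ j)"
  using assms
proof (induction S arbitrary: A rule: finite_induct)
  case empty
  then show ?case by simp
next
  case (insert a S)
  note sym = insert.prems(1) and psd = insert.prems(2) and supp = insert.prems(3)
  have quad: "(x + t *\<^sub>R axis a 1) \<bullet> (A *v (x + t *\<^sub>R axis a 1))
      = x \<bullet> (A *v x) + 2 * t * (A *v x) $ a + t\<^sup>2 * A $ a $ a" for x t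
  proof -
    have "x \<bullet> (A *v axis a 1) = (A *v x) $ a"
      by (simp add: inner_vec_def matrix_vector_mult_def axis_def if_distrib sym[of _ a] mult.commute cong: if_cong)
    moreover have "axis a 1 \<bullet> (A *v y) = (A *v y) $ a" for y
      by (simp add: inner_axis' )
    moreover have "(A *v axis a 1) $ a = A $ a $ a"
      by (simp add: matrix_vector_mult_def axis_def if_distrib cong: if_cong)
    ultimately show ?thesis
      by (simp add: matrix_vector_right_distrib inner_add_left inner_add_right
          matrix_vector_mult_scaleR power2_eq_square algebra_simps)
  qed
  show ?case
  proof (cases "A $ a $ a = 0")
    case True
    have row: "A $ a $ j = 0" for j
    proof (rule ccontr)
      assume n: "A $ a $ j \<noteq> 0"
      have Aj: "(A *v axis j 1) $ a = A $ a $ j"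
        by (simp add: matrix_vector_mult_def axis_def if_distrib cong: if_cong)
      define q where "q = axis j 1 \<bullet> (A *v axis j (1::real))"
      have "0 \<le> q + 2 * t * A $ a $ j" for t
        using psd[of "axis j 1 + t *\<^sub>R axis a 1"] unfolding quad Aj q_def True by simp
      \<comment> \<open>With a zero pivot the form is affine in \<open>t\<close>; this
        \<open>t\<close> gives it the value -1.\<close>
      from this[of "- (q + 1) / (2 * A $ a $ j)"] n show False by (simp add: field_simps)
    qed
    have "\<exists>v :: 'n \<Rightarrow> real ^ 'n. \<forall>i j. A $ i $ j = (\<Sum>k\<in>S. v k $ i * v k $ j)"
    proof (rule insert.IH[OF sym psd])
      fix i j assume "i \<notin> S"
      then show "A $ i $ j = 0" using supp[of i j] row by (cases "i = a") auto
    qed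
    then obtain v :: "'n \<Rightarrow> real ^ 'n" where v: "A $ i $ j = (\<Sum>k\<in>S. v k $ i * v k $ j)" for i j by blast
    have "A $ i $ j = (\<Sum>k\<in>insert a S. (v(a := 0)) k $ i * (v(a := 0)) k $ j)" for i j
      using insert.hyps by (simp add: v[of i j]) (intro sum.cong; auto)
    then show ?thesis by blast
  next
    case False
    then have pos: "0 < A $ a $ a" using psd[of "axis a 1"] quad[of 0 1] by simp
    define B where "B = (\<chi> i j. A $ i $ j - A $ a $ i * A $ a $ j / A $ a $ a)"
    have "0 \<le> x \<bullet> (B *v x)" for x
    proof -
      let ?b = "(A *v x) $ a"
      have "x \<bullet> (B *v x) = x \<bullet> (A *v x) - ?b\<^sup>2 / A $ a $ a"
        by (simp add: B_def inner_vec_def matrix_vector_mult_def power2_eq_square left_diff_distrib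
            right_diff_distrib sum_subtractf sum_product sum_divide_distrib sum_distrib_left sum_distrib_right ac_simps)
      \<comment> \<open>Completing the square: the Schur form at \<open>x\<close> is the original
        form after moving \<open>x\<close> along \<open>axis a 1\<close> to the minimum.\<close>
      also have "\<dots> = (x + (- ?b / A $ a $ a) *\<^sub>R axis a 1) \<bullet> (A *v (x + (- ?b / A $ a $ a) *\<^sub>R axis a 1))"
        unfolding quad using pos by (simp add: power2_eq_square field_simps)
      finally show ?thesis using psd by simp
    qed
    moreover have "B $ i $ j = B $ j $ i" for i j using sym[of i j] by (simp add: B_def)
    moreover have "B $ i $ j = 0" if "i \<notin> S" for i j
    proof (cases "i = a")
      case True
      then show ?thesis using pos by (simp add: B_def)
    next
      case False
      with that have "A $ i $ j = 0" "A $ i $ a = 0" using supp[of i] by auto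
      then show ?thesis using sym[of a i] by (simp add: B_def)
    qed
    ultimately obtain v :: "'n \<Rightarrow> real ^ 'n" where v: "B $ i $ j = (\<Sum>k\<in>S. v k $ i * v k $ j)" for i j
      using insert.IH[of B] by blast
    define w where "w = (\<chi> i. A $ a $ i / sqrt (A $ a $ a))"
    have "A $ i $ j = (\<Sum>k\<in>insert a S. (v(a := w)) k $ i * (v(a := w)) k $ j)" for i j
    proof -
      have "(\<Sum>k\<in>S. (v(a := w)) k $ i * (v(a := w)) k $ j) = (\<Sum>k\<in>S. v k $ i * v k $ j)"
        using insert.hyps by (intro sum.cong) auto
      then show ?thesis
        using insert.hyps pos by (simp add: v[symmetric] B_def w_def)
    qed
    then show ?thesis by blast
  qed
qed

lemma psd_decomposition:
  fixes A :: "real ^ 'n ^ 'n"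
  assumes "\<And>i j. A $ i $ j = A $ j $ i" and "\<And>x. 0 \<le> x \<bullet> (A *v x)"
  obtains v :: "'n \<Rightarrow> real ^ 'n" where "\<And>x. x \<bullet> (A *v x) = (\<Sum>k\<in>UNIV. (x \<bullet> v k)\<^sup>2)"
proof -
  obtain v :: "'n \<Rightarrow> real ^ 'n" where v: "A $ i $ j = (\<Sum>k\<in>UNIV. v k $ i * v k $ j)" for i j
    using psd_decomposition_supported[of UNIV A] assms by auto
  have "x \<bullet> (A *v x) = (\<Sum>k\<in>UNIV. (x \<bullet> v k)\<^sup>2)" for x
  proof -
    have "x \<bullet> (A *v x) = (\<Sum>i\<in>UNIV. \<Sum>j\<in>UNIV. \<Sum>k\<in>UNIV. (x $ i * v k $ i) * (x $ j * v k $ j))"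
      by (simp add: inner_vec_def matrix_vector_mult_def v sum_distrib_left sum_distrib_right ac_simps)
    also have "\<dots> = (\<Sum>i\<in>UNIV. \<Sum>k\<in>UNIV. \<Sum>j\<in>UNIV. (x $ i * v k $ i) * (x $ j * v k $ j))"
      by (intro sum.cong refl sum.swap)
    also have "\<dots> = (\<Sum>k\<in>UNIV. \<Sum>i\<in>UNIV. \<Sum>j\<in>UNIV. (x $ i * v k $ i) * (x $ j * v k $ j))"
      by (rule sum.swap)
    also have "\<dots> = (\<Sum>k\<in>UNIV. (x \<bullet> v k)\<^sup>2)"
      by (simp add: power2_eq_square inner_vec_def sum_product)
    finally show ?thesis .
  qed
  then show thesis by (rule that)
qed

text \<open>With the quadratic form written as a sum of squares
  \<open>(x \<bullet> v k)\<^sup>2\<close>, the combination of the vectors \<open>v k\<close> with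
  independent standard normal weights has the required characteristic function, whatever the rank of
  \<open>A\<close>.\<close>

theorem multivariate_normal_exists:
  fixes A :: "real ^ 'n ^ 'n"
  assumes "\<And>i j. A $ i $ j = A $ j $ i" and "\<And>x. 0 \<le> x \<bullet> (A *v x)"
  obtains N where "is_multivariate_normal 0 A N"
proof -
  obtain v :: "'n \<Rightarrow> real ^ 'n" where v: "\<And>x. x \<bullet> (A *v x) = (\<Sum>k\<in>UNIV. (x \<bullet> v k)\<^sup>2)"
    using psd_decomposition[of A] assms by blast
  let ?P = "PiM UNIV (\<lambda>_::'n. std_normal_distribution)"
  define T where "T x = (\<Sum>k\<in>UNIV. x k *\<^sub>R v k)" for x :: "'n \<Rightarrow> real"
  interpret std: prob_space std_normal_distribution by (rule prob_space_normal_density) simp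
  interpret P: product_prob_space "\<lambda>_::'n. std_normal_distribution" UNIV ..
  have T [measurable]: "T \<in> borel_measurable ?P" unfolding T_def by measurable
  have "(\<integral>y. iexp (s \<bullet> y) \<partial>distr ?P borel T) = exp (- complex_of_real (s \<bullet> (A *v s)) / 2)" for s
  proof -
    have "(\<integral>y. iexp (s \<bullet> y) \<partial>distr ?P borel T) = (\<integral>x. iexp (s \<bullet> T x) \<partial>?P)"
      by (rule integral_distr) auto
    also have "\<dots> = (\<integral>x. (\<Prod>k\<in>UNIV. iexp ((s \<bullet> v k) * x k)) \<partial>?P)"
    proof (intro Bochner_Integration.integral_cong refl)
      fix x :: "'n \<Rightarrow> real"
      have "s \<bullet> T x = (\<Sum>k\<in>UNIV. (s \<bullet> v k) * x k)"
        by (simp add: T_def inner_sum_right mult.commute)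
      then show "iexp (s \<bullet> T x) = (\<Prod>k\<in>UNIV. iexp ((s \<bullet> v k) * x k))"
        by (simp only: of_real_sum sum_distrib_left) (rule exp_sum, simp)
    qed
    also have "\<dots> = (\<Prod>k\<in>UNIV. \<integral>x. iexp ((s \<bullet> v k) * x) \<partial>std_normal_distribution)"
      by (rule P.product_integral_prod) (auto intro: std.integrable_iexp)
    also have "\<dots> = (\<Prod>k\<in>UNIV. complex_of_real (exp (- (s \<bullet> v k)\<^sup>2 / 2)))"
      using char_std_normal_distribution unfolding char_def fun_eq_iff by simp
    also have "\<dots> = complex_of_real (exp (\<Sum>k\<in>UNIV. - (s \<bullet> v k)\<^sup>2 / 2))"
      by (simp add: exp_sum)
    also have "(\<Sum>k\<in>UNIV. - (s \<bullet> v k)\<^sup>2 / 2) = - (s \<bullet> (A *v s)) / 2"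
      by (simp add: v sum_negf sum_divide_distrib)
    finally show ?thesis by (simp flip: exp_of_real)
  qed
  then have "is_multivariate_normal 0 A (distr ?P borel T)"
    unfolding is_multivariate_normal_def by (auto intro: P.prob_space_distr)
  then show thesis by (rule that)
qed

section \<open>Conditional mean of the process\<close>

lemma beta_prime_density_nonneg:
  assumes "0 < p" "0 < l" shows "0 \<le> beta_prime_density p l x"
  using assms unfolding beta_prime_density_def Beta_def
  by (auto intro!: divide_nonneg_nonneg mult_nonneg_nonneg less_imp_le[OF Gamma_real_pos])

text \<open>The mean is read off the derivative
  \<open>(x\<^sup>p (1 + x)\<^bsup>-p-l\<^esup>)' = x\<^bsup>p-1\<^esup> (1 + x)\<^bsup>-p-l-1\<^esup> (p - l x)\<close>, whose integral over the half-line vanishes.\<close>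

lemma beta_prime_derivative_integral:
  fixes p l :: real
  assumes p: "0 < p" and l: "0 < l"
  defines "f \<equiv> \<lambda>x. x powr (p - 1) * (1 + x) powr (- p - l - 1) * (p - l * x)"
  shows "integrable lborel (\<lambda>x. indicator {0<..} x * f x)" "(\<integral>x. indicator {0<..} x * f x \<partial>lborel) = 0"
proof -
  define F where "F x = x powr p * (1 + x) powr (- p - l)" for x
  \<comment> \<open>The zero of \<open>f\<close>: the primitive \<open>F\<close> increases up to
    \<open>a\<close> and decreases after it, so the fundamental theorem for integrands of one sign
    applies on either side and yields integrability too.\<close>
  define a where "a = p / l"
  have a: "0 < a" using p l by (simp add: a_def)
  have F': "(F has_real_derivative f x) (at x)" if "0 < x" for x
  proof -
    have "(F has_real_derivative (p * x powr (p - 1) * (1 + x) powr (- p - l) +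
        x powr p * ((- p - l) * (1 + x) powr (- p - l - 1)))) (at x)"
      unfolding F_def using that by (auto intro!: derivative_eq_intros)
    moreover have "x powr p = x powr (p - 1) * x" "(1 + x) powr (- p - l) = (1 + x) powr (- p - l - 1) * (1 + x)"
      using that powr_add[of x "p - 1" 1] powr_add[of "1 + x" "- p - l - 1" 1] by simp_all
    ultimately show ?thesis unfolding f_def by (simp add: algebra_simps)
  qed
  have fc: "isCont f x" if "0 < x" for x
    unfolding f_def using that by (intro continuous_intros) auto
  have F0: "((F \<circ> real_of_ereal) \<longlongrightarrow> 0) (at_right (0::ereal))"
  proof -
    have "(F \<longlongrightarrow> 0 powr p * (1 + 0) powr (- p - l)) (at_right 0)"
      unfolding F_def using p by (intro tendsto_intros) (auto simp: eventually_at_filter)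
    then show ?thesis unfolding zero_ereal_def ereal_tendsto_simps using p by simp
  qed
  have Fa: "((F \<circ> real_of_ereal) \<longlongrightarrow> F a) (at_left (ereal a))" "((F \<circ> real_of_ereal) \<longlongrightarrow> F a) (at_right (ereal a))"
    using DERIV_isCont[OF F'[OF a]] unfolding isCont_def ereal_tendsto_simps filterlim_at_split by auto
  have Finf: "((F \<circ> real_of_ereal) \<longlongrightarrow> 0) (at_left \<infinity>)"
  proof -
    have "(F \<longlongrightarrow> 0) at_top"
    proof (rule real_tendsto_sandwich)
      show "eventually (\<lambda>x. 0 \<le> F x) at_top" by (simp add: F_def)
      show "eventually (\<lambda>x. F x \<le> (1 + x) powr (- l)) at_top"
        using eventually_gt_at_top[of 0]
      proof eventually_elim
        case (elim x)
        have "F x \<le> (1 + x) powr p * (1 + x) powr (- p - l)"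
          unfolding F_def using elim p by (intro mult_right_mono powr_mono2) auto
        then show ?case by (simp flip: powr_add)
      qed
      show "((\<lambda>x. (1 + x) powr (- l)) \<longlongrightarrow> 0) at_top"
        using l by (intro tendsto_neg_powr filterlim_tendsto_add_at_top[OF tendsto_const] filterlim_ident) auto
    qed simp
    then show ?thesis unfolding ereal_tendsto_simps .
  qed
  have f1: "0 \<le> f x" if "0 < x" "x < a" for x
    using that l unfolding f_def a_def by (auto intro!: mult_nonneg_nonneg simp: field_simps)
  have f2: "0 \<le> - f x" if "a < x" for x
  proof -
    have "0 \<le> x powr (p - 1) * (1 + x) powr (- p - l - 1) * (l * x - p)"
      using that l unfolding a_def by (intro mult_nonneg_nonneg powr_ge_zero) (simp add: field_simps)
    then show ?thesis by (simp add: f_def algebra_simps)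
  qed
  have 1: "set_integrable lborel (einterval 0 (ereal a)) f" "(LBINT x=0..ereal a. f x) = F a - 0"
  proof -
    have "(0::ereal) < ereal a" using a by simp
    moreover have "(F has_real_derivative f x) (at x)" "isCont f x" if "0 < ereal x" for x
      using that F' fc by auto
    moreover have "AE x in lborel. 0 < ereal x \<longrightarrow> ereal x < ereal a \<longrightarrow> 0 \<le> f x" using f1 by simp
    ultimately show "set_integrable lborel (einterval 0 (ereal a)) f" "(LBINT x=0..ereal a. f x) = F a - 0"
      using interval_integral_FTC_nonneg[of 0 "ereal a" F f 0 "F a"] F0 Fa by blast+
  qed
  have 2: "set_integrable lborel (einterval (ereal a) \<infinity>) (\<lambda>x. - f x)" "(LBINT x=ereal a..\<infinity>. - f x) = - 0 - (- F a)"
  proof -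
    have "ereal a < \<infinity>" by simp
    moreover have "((\<lambda>x. - F x) has_real_derivative - f x) (at x)" "isCont (\<lambda>x. - f x) x" if "ereal a < ereal x" for x
      using that a F'[of x] fc[of x] by (auto intro: DERIV_minus)
    moreover have "AE x in lborel. ereal a < ereal x \<longrightarrow> ereal x < \<infinity> \<longrightarrow> 0 \<le> - f x" using f2 by simp
    moreover have "(((\<lambda>x. - F x) \<circ> real_of_ereal) \<longlongrightarrow> - F a) (at_right (ereal a))"
      "(((\<lambda>x. - F x) \<circ> real_of_ereal) \<longlongrightarrow> - 0) (at_left \<infinity>)"
      using tendsto_minus[OF Fa(2)] tendsto_minus[OF Finf] by (simp_all only: comp_def)
    ultimately show "set_integrable lborel (einterval (ereal a) \<infinity>) (\<lambda>x. - f x)" "(LBINT x=ereal a..\<infinity>. - f x) = - 0 - (- F a)"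
      using interval_integral_FTC_nonneg[of "ereal a" "\<infinity>" "\<lambda>x. - F x" "\<lambda>x. - f x" "- F a" "- 0"] by blast+
  qed
  have "f a = 0" using l by (simp add: f_def a_def)
  then have eq: "indicator {0<..} x * f x = indicator {0<..<a} x * f x - indicator {a<..} x * (- f x)" for x
    using a by (auto simp: indicator_def)
  have i: "integrable lborel (\<lambda>x. indicator {0<..<a} x * f x)" "integrable lborel (\<lambda>x. indicator {a<..} x * (- f x))"
    using 1(1) 2(1) unfolding set_integrable_def by (simp_all add: zero_ereal_def)
  show "integrable lborel (\<lambda>x. indicator {0<..} x * f x)" unfolding eq by (rule Bochner_Integration.integrable_diff[OF i])
  have "(\<integral>x. indicator {0<..<a} x * f x \<partial>lborel) = F a"
    using 1(2) a by (simp add: interval_lebesgue_integral_def set_lebesgue_integral_def zero_ereal_def)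
  moreover have "(\<integral>x. indicator {a<..} x * (- f x) \<partial>lborel) = F a"
    using 2(2) a by (simp add: interval_lebesgue_integral_def set_lebesgue_integral_def)
  ultimately show "(\<integral>x. indicator {0<..} x * f x \<partial>lborel) = 0"
    unfolding eq using i by (simp only: Bochner_Integration.integral_diff)
qed

text \<open>The total mass 1 follows from the density being that of \<open>V\<close>, so the Beta
  function is never evaluated; the first moment is then \<open>p / l\<close> times the mass plus an
  integral that vanishes.\<close>

lemma (in prob_space) beta_prime_mean:
  fixes V :: "'a \<Rightarrow> real"
  assumes V: "distributed M lborel V (\<lambda>x. ennreal (beta_prime_density p l x))" and p: "0 < p" and l: "0 < l"
  shows "integrable M V" "expectation V = p / l" "AE \<omega> in M. 0 < V \<omega>"
proof -
  let ?d = "beta_prime_density p l"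
  have dm [measurable]: "?d \<in> borel_measurable lborel" unfolding beta_prime_density_def[abs_def] by measurable
  have dn: "\<And>x. x \<in> space lborel \<Longrightarrow> 0 \<le> ?d x" using beta_prime_density_nonneg[OF p l] by simp
  have d: "integrable lborel ?d" "(\<integral>x. ?d x \<partial>lborel) = 1"
    using distributed_integrable[OF V, of "\<lambda>_. 1"] distributed_integral[OF V, of "\<lambda>_. 1"] dn
    by (simp_all add: prob_space)
  define h where "h x = indicator {0<..} x * (x powr (p - 1) * (1 + x) powr (- p - l - 1) * (p - l * x))" for x :: real
  have h: "integrable lborel h" "(\<integral>x. h x \<partial>lborel) = 0"
    unfolding h_def using beta_prime_derivative_integral[OF p l] by auto
  have eq: "?d x * x = (p / l) * ?d x - h x / (l * Beta p (l + 1))" for x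
  proof -
    \<comment> \<open>Admitting \<open>b = 0\<close>, where division yields 0, saves a proof that
      the Beta value is nonzero.\<close>
    have "y / b * x = p / l * (y / b) - y * (p - l * x) / (l * b)" for y b
      using l by (cases "b = 0") (auto simp: field_simps)
    then show ?thesis by (simp add: beta_prime_density_def h_def)
  qed
  have "integrable lborel (\<lambda>x. ?d x * x)" unfolding eq using d h by simp
  then show "integrable M V" using distributed_integrable[OF V, of "\<lambda>x. x"] dn by simp
  have "(\<integral>x. ?d x * x \<partial>lborel) = p / l" unfolding eq using d h by simp
  then show "expectation V = p / l" using distributed_integral[OF V, of "\<lambda>x. x"] dn by simp
  have "AE x in distr M lborel V. 0 < x"
    unfolding distributed_distr_eq_density[OF V]
    by (subst AE_density) (auto simp: beta_prime_density_def)
  then show "AE \<omega> in M. 0 < V \<omega>"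
    by (rule AE_distrD[OF distributed_measurable[OF V]])
qed

lemma geom_mass_pos: "0 < a \<Longrightarrow> 0 < geom_mass a k"
  by (simp add: geom_mass_def)

text \<open>The differentiated geometric series at ratio \<open>a / (1 + a)\<close>; the final index
  shift restores the vanishing term \<open>k = 0\<close>.\<close>

lemma geom_mass_mean:
  assumes "0 < a" shows "(\<lambda>k. real k * geom_mass a k) sums a"
proof -
  let ?q = "a / (1 + a)"
  have "norm ?q < 1" using assms by simp
  from sums_mult[OF geometric_deriv_sums[OF this], of "?q / (1 + a)"]
  have "(\<lambda>k. ?q / (1 + a) * (real (Suc k) * ?q ^ k)) sums (?q / (1 + a) * (1 / (1 - ?q)\<^sup>2))" by simp
  moreover have "?q / (1 + a) * (1 / (1 - ?q)\<^sup>2) = a"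
  proof -
    have "1 - ?q = 1 / (1 + a)" using assms by (simp add: field_simps)
    then show ?thesis using assms by (simp add: power2_eq_square)
  qed
  moreover have "?q / (1 + a) * (real (Suc k) * ?q ^ k) = real (Suc k) * geom_mass a (Suc k)" for k
    using assms by (simp add: geom_mass_def power_divide ac_simps)
  ultimately have "(\<lambda>k. real (Suc k) * geom_mass a (Suc k)) sums a" by simp
  then show ?thesis by (subst (asm) sums_Suc_iff) simp
qed

lemma ennreal_of_nat_suminf: "ennreal (real n) = (\<Sum>k. ennreal (real k) * indicator {k} n)"
proof -
  have "(\<Sum>k. ennreal (real k) * indicator {k} n) = (\<Sum>k\<in>{n}. ennreal (real k) * indicator {k} n)"
    by (rule suminf_finite) auto
  then show ?thesis by simp
qed

text \<open>Turns a sum with a random number of terms into a series whose terms are an indicator of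
  the state times one counting variable, so that Tonelli and independence apply termwise. The series
  starts at 0 and the counting variables at 1, whence the \<open>x + 1\<close> active terms
  \<open>j \<le> x\<close>.\<close>

lemma mnb_op_suminf: "ennreal (real (mnb_op K x)) = (\<Sum>j. indicator {j..} x * ennreal (real (K (Suc j))))"
proof -
  have "(\<Sum>j. indicator {j..} x * ennreal (real (K (Suc j)))) = (\<Sum>j\<in>{..x}. indicator {j..} x * ennreal (real (K (Suc j))))"
    by (rule suminf_finite) auto
  also have "\<dots> = ennreal (\<Sum>j\<in>{..x}. real (K (Suc j)))"
    by (subst sum_ennreal[symmetric]) (auto intro!: sum.cong)
  also have "(\<Sum>j\<in>{..x}. real (K (Suc j))) = real (mnb_op K x)"
    by (simp add: mnb_op_def sum.atLeast_Suc_atMost_Suc_shift atMost_atLeast0 del: sum.cl_ivl_Suc)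
  finally show ?thesis by simp
qed

section \<open>Integer-valued variables independent of an event\<close>

context prob_space begin

lemma sigma_finite_subalgebraI: "subalgebra M F \<Longrightarrow> sigma_finite_subalgebra M F"
  by (intro finite_measure_subalgebra_is_sigma_finite finite_measure_subalgebra.intro
      finite_measure_subalgebra_axioms.intro finite_measure_axioms)

lemma nn_integral_nat_expand:
  assumes E [measurable]: "E \<in> events" and U [measurable]: "U \<in> measurable M (count_space UNIV)"
  shows "(\<integral>\<^sup>+\<omega>. indicator E \<omega> * ennreal (real (U \<omega>)) \<partial>M)
    = (\<Sum>k. ennreal (real k) * emeasure M (E \<inter> {\<omega>\<in>space M. U \<omega> = k}))"
proof -
  have "(\<integral>\<^sup>+\<omega>. indicator E \<omega> * ennreal (real (U \<omega>)) \<partial>M)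
      = (\<integral>\<^sup>+\<omega>. (\<Sum>k. ennreal (real k) * indicator (E \<inter> {\<omega>\<in>space M. U \<omega> = k}) \<omega>) \<partial>M)"
    by (intro nn_integral_cong, subst ennreal_of_nat_suminf, subst ennreal_suminf_cmult[symmetric])
      (auto intro!: suminf_cong simp: indicator_def)
  also have "\<dots> = (\<Sum>k. \<integral>\<^sup>+\<omega>. ennreal (real k) * indicator (E \<inter> {\<omega>\<in>space M. U \<omega> = k}) \<omega> \<partial>M)"
    by (intro nn_integral_suminf) auto
  also have "\<dots> = (\<Sum>k. ennreal (real k) * emeasure M (E \<inter> {\<omega>\<in>space M. U \<omega> = k}))"
    by (intro suminf_cong nn_integral_cmult_indicator) auto
  finally show ?thesis .
qed

text \<open>Expanding over the values of \<open>U\<close> reduces factorisation to point events;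
  with nonnegative integrals no integrability has to be checked.\<close>

lemma nn_integral_indep_nat:
  assumes E [measurable]: "E \<in> events" and U [measurable]: "U \<in> measurable M (count_space UNIV)"
    and ind: "\<And>k. prob (E \<inter> {\<omega>\<in>space M. U \<omega> = k}) = prob E * prob {\<omega>\<in>space M. U \<omega> = k}"
  shows "(\<integral>\<^sup>+\<omega>. indicator E \<omega> * ennreal (real (U \<omega>)) \<partial>M) = emeasure M E * (\<integral>\<^sup>+\<omega>. ennreal (real (U \<omega>)) \<partial>M)"
proof -
  have "emeasure M (E \<inter> {\<omega>\<in>space M. U \<omega> = k}) = emeasure M E * emeasure M (space M \<inter> {\<omega>\<in>space M. U \<omega> = k})" for k
  proof -
    have "space M \<inter> {\<omega>\<in>space M. U \<omega> = k} = {\<omega>\<in>space M. U \<omega> = k}" by auto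
    then show ?thesis by (simp add: emeasure_eq_measure ind ennreal_mult)
  qed
  then have "(\<integral>\<^sup>+\<omega>. indicator E \<omega> * ennreal (real (U \<omega>)) \<partial>M)
     = (\<Sum>k. emeasure M E * (ennreal (real k) * emeasure M (space M \<inter> {\<omega>\<in>space M. U \<omega> = k})))"
    unfolding nn_integral_nat_expand[OF E U] by (intro suminf_cong) (simp only: mult.left_commute)
  also have "\<dots> = emeasure M E * (\<integral>\<^sup>+\<omega>. indicator (space M) \<omega> * ennreal (real (U \<omega>)) \<partial>M)"
    unfolding nn_integral_nat_expand[OF sets.top U] by (rule ennreal_suminf_cmult)
  also have "(\<integral>\<^sup>+\<omega>. indicator (space M) \<omega> * ennreal (real (U \<omega>)) \<partial>M) = (\<integral>\<^sup>+\<omega>. ennreal (real (U \<omega>)) \<partial>M)"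
    by (intro nn_integral_cong) auto
  finally show ?thesis .
qed

end

section \<open>Laws and means of the innovations\<close>

context brcmnbinar1 begin

lemma l_pos: "0 < l" using l_gt_1 by simp

lemma X_component_measurable [measurable]: "(\<lambda>\<omega>. X t \<omega> $ i) \<in> measurable M (count_space UNIV)"
  using X_measurable by (rule measurable_compose) simp

lemma Z_component_measurable: "t \<ge> 1 \<Longrightarrow> (\<lambda>\<omega>. Z t \<omega> $ i) \<in> measurable M (count_space UNIV)"
  using Z_measurable by (rule measurable_compose) auto

lemma G_component_measurable: "t \<ge> 1 \<Longrightarrow> j \<ge> 1 \<Longrightarrow> (\<lambda>\<omega>. G t j \<omega> $ i) \<in> measurable M (count_space UNIV)"
  using G_measurable by (rule measurable_compose) auto

lemma \<alpha>_component_measurable: "t \<ge> 1 \<Longrightarrow> (\<lambda>\<omega>. \<alpha> t \<omega> $ i) \<in> borel_measurable M"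
  using \<alpha>_measurable
  by (rule measurable_compose) (auto intro!: borel_measurable_continuous_onI continuous_intros)

lemma \<alpha>_mean:
  assumes "t \<ge> 1"
  shows "integrable M (\<lambda>\<omega>. \<alpha> t \<omega> $ i)" "expectation (\<lambda>\<omega>. \<alpha> t \<omega> $ i) = m $ i / l" "AE \<omega> in M. 0 < \<alpha> t \<omega> $ i"
  by (rule beta_prime_mean[OF \<alpha>_distributed[OF assms, of i]]; use m_bounds[of i] l_pos in simp)+

text \<open>\<open>G_conditional\<close> for a single variable, integrated over the coefficient.
  Positivity at every \<open>k\<close> is the unbounded support from which nondegeneracy of
  \<open>X\<close> is drawn.\<close>

lemma G_mass:
  assumes t: "t \<ge> 1" and j: "j \<ge> 1"
  shows "emeasure M {\<omega>\<in>space M. G t j \<omega> $ i = k} = (\<integral>\<^sup>+\<omega>. ennreal (geom_mass (\<alpha> t \<omega> $ i) k) \<partial>M)"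
    and "0 < prob {\<omega>\<in>space M. G t j \<omega> $ i = k}"
proof -
  let ?F = "vimage_algebra (space M) (\<lambda>\<omega>. \<lambda>t\<in>{1..}. \<alpha> t \<omega>) (PiM {1..} (\<lambda>_. borel))"
  let ?S = "{\<omega>\<in>space M. G t j \<omega> $ i = k}"
  note [measurable] = G_component_measurable[OF t j] \<alpha>_component_measurable[OF t]
  have "(\<lambda>\<omega>. \<lambda>t\<in>{1..}. \<alpha> t \<omega>) \<in> measurable M (PiM {1..} (\<lambda>_. borel))"
    by (intro measurable_restrict \<alpha>_measurable) auto
  then have "sets ?F \<subseteq> sets M" by (simp add: measurable_iff_sets)
  then have "subalgebra M ?F" by (simp add: subalgebra_def)
  then interpret sigma_finite_subalgebra M ?F
    by (rule sigma_finite_subalgebraI)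
  have ind: "integrable M (indicat_real ?S)" by (intro integrable_const_bound[where B=1]) auto
  have AE: "AE \<omega> in M. real_cond_exp M ?F (indicat_real ?S) \<omega> = geom_mass (\<alpha> t \<omega> $ i) k"
    using G_conditional[of "{(i, t, j)}" "\<lambda>_. k"] t j by simp
  have gm [measurable]: "(\<lambda>\<omega>. geom_mass (\<alpha> t \<omega> $ i) k) \<in> borel_measurable M"
    unfolding geom_mass_def by measurable
  have gi: "integrable M (\<lambda>\<omega>. geom_mass (\<alpha> t \<omega> $ i) k)"
    using integrable_cong_AE[THEN iffD1, OF _ gm AE real_cond_exp_int(1)[OF ind]] by simp
  have "prob ?S = (\<integral>\<omega>. real_cond_exp M ?F (indicat_real ?S) \<omega> \<partial>M)"
    using real_cond_exp_int(2)[OF ind] by simp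
  also have "\<dots> = (\<integral>\<omega>. geom_mass (\<alpha> t \<omega> $ i) k \<partial>M)"
    by (intro integral_cong_AE AE) auto
  finally have p: "prob ?S = (\<integral>\<omega>. geom_mass (\<alpha> t \<omega> $ i) k \<partial>M)" .
  have pos: "AE \<omega> in M. 0 < geom_mass (\<alpha> t \<omega> $ i) k"
    using \<alpha>_mean(3)[OF t, of i] by eventually_elim (rule geom_mass_pos)
  then have nonneg: "AE \<omega> in M. 0 \<le> geom_mass (\<alpha> t \<omega> $ i) k" by eventually_elim simp
  show "emeasure M ?S = (\<integral>\<^sup>+\<omega>. ennreal (geom_mass (\<alpha> t \<omega> $ i) k) \<partial>M)"
    unfolding emeasure_eq_measure p by (rule nn_integral_eq_integral[OF gi nonneg, symmetric])
  have "prob ?S \<noteq> 0"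
  proof
    assume "prob ?S = 0"
    then have "AE \<omega> in M. geom_mass (\<alpha> t \<omega> $ i) k = 0"
      unfolding p using integral_nonneg_eq_0_iff_AE[OF gi nonneg] by simp
    with pos have "AE \<omega> in M. False" by eventually_elim simp
    then show False by simp
  qed
  then show "0 < prob ?S" using measure_nonneg[of M ?S] by linarith
qed

text \<open>Tonelli moves the series over the values inside the integral over the coefficient, where
  the geometric mean is the coefficient itself.\<close>

lemma G_mean:
  assumes t: "t \<ge> 1" and j: "j \<ge> 1"
  shows "(\<integral>\<^sup>+\<omega>. ennreal (real (G t j \<omega> $ i)) \<partial>M) = ennreal (m $ i / l)"
proof -
  note [measurable] = G_component_measurable[OF t j] \<alpha>_component_measurable[OF t]
  have [measurable]: "(\<lambda>\<omega>. geom_mass (\<alpha> t \<omega> $ i) k) \<in> borel_measurable M" for k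
    unfolding geom_mass_def by measurable
  have "(\<integral>\<^sup>+\<omega>. ennreal (real (G t j \<omega> $ i)) \<partial>M) = (\<integral>\<^sup>+\<omega>. indicator (space M) \<omega> * ennreal (real (G t j \<omega> $ i)) \<partial>M)"
    by (intro nn_integral_cong) auto
  also have "\<dots> = (\<Sum>k. ennreal (real k) * emeasure M (space M \<inter> {\<omega>\<in>space M. G t j \<omega> $ i = k}))"
    by (rule nn_integral_nat_expand) auto
  also have "\<dots> = (\<Sum>k. \<integral>\<^sup>+\<omega>. ennreal (real k) * ennreal (geom_mass (\<alpha> t \<omega> $ i) k) \<partial>M)"
  proof (intro suminf_cong)
    fix k
    have "space M \<inter> {\<omega>\<in>space M. G t j \<omega> $ i = k} = {\<omega>\<in>space M. G t j \<omega> $ i = k}" by auto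
    then show "ennreal (real k) * emeasure M (space M \<inter> {\<omega>\<in>space M. G t j \<omega> $ i = k})
        = (\<integral>\<^sup>+\<omega>. ennreal (real k) * ennreal (geom_mass (\<alpha> t \<omega> $ i) k) \<partial>M)"
      by (simp add: G_mass(1)[OF t j] nn_integral_cmult)
  qed
  also have "\<dots> = (\<integral>\<^sup>+\<omega>. (\<Sum>k. ennreal (real k) * ennreal (geom_mass (\<alpha> t \<omega> $ i) k)) \<partial>M)"
    by (rule nn_integral_suminf[symmetric]) auto
  also have "\<dots> = (\<integral>\<^sup>+\<omega>. ennreal (\<alpha> t \<omega> $ i) \<partial>M)"
  proof (rule nn_integral_cong_AE)
    show "AE \<omega> in M. (\<Sum>k. ennreal (real k) * ennreal (geom_mass (\<alpha> t \<omega> $ i) k)) = ennreal (\<alpha> t \<omega> $ i)"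
      using \<alpha>_mean(3)[OF t, of i]
    proof eventually_elim
      case (elim \<omega>)
      have "(\<Sum>k. ennreal (real k * geom_mass (\<alpha> t \<omega> $ i) k)) = ennreal (\<alpha> t \<omega> $ i)"
        using geom_mass_mean[OF elim] geom_mass_pos[OF elim]
        by (subst suminf_ennreal2) (auto simp: sums_iff less_imp_le)
      then show ?case using geom_mass_pos[OF elim] by (simp add: ennreal_mult less_imp_le)
    qed
  qed
  also have "\<dots> = ennreal (m $ i / l)"
    using nn_integral_eq_integral[OF \<alpha>_mean(1)[OF t, of i]] \<alpha>_mean(2)[OF t, of i]
      AE_mp[OF \<alpha>_mean(3)[OF t, of i], of "\<lambda>\<omega>. 0 \<le> \<alpha> t \<omega> $ i"] by simp
  finally show ?thesis .
qed

section \<open>Natural filtration and one-step conditional mean\<close>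

definition past :: "nat \<Rightarrow> 'a measure" where
  "past t = vimage_algebra (space M) (\<lambda>\<omega>. \<lambda>s\<in>{..<t}. X s \<omega>) (PiM {..<t} (\<lambda>_. count_space UNIV))"

lemma past_subalgebra: "subalgebra M (past t)"
proof -
  have "(\<lambda>\<omega>. \<lambda>s\<in>{..<t}. X s \<omega>) \<in> measurable M (PiM {..<t} (\<lambda>_. count_space UNIV))"
    by (intro measurable_restrict X_measurable)
  then show ?thesis unfolding past_def subalgebra_def
    by (simp add: measurable_iff_sets)
qed

lemma X_past_measurable:
  assumes "s < t" shows "X s \<in> measurable (past t) (count_space UNIV)"
proof -
  have "(\<lambda>\<omega>. (\<lambda>s\<in>{..<t}. X s \<omega>) s) \<in> measurable (past t) (count_space UNIV)"
    unfolding past_def using assms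
    by (intro measurable_compose[OF measurable_vimage_algebra1 measurable_component_singleton])
      (auto simp: space_PiM split: if_splits)
  then show ?thesis using assms by simp
qed

lemma past_cases:
  assumes "E \<in> sets (past t)"
  obtains A where "A \<in> sets (PiM {..<t} (\<lambda>_. count_space UNIV))" "E = (\<lambda>\<omega>. \<lambda>s\<in>{..<t}. X s \<omega>) -` A \<inter> space M"
  using assms unfolding past_def by (subst (asm) sets_vimage_algebra2) (auto simp: space_PiM)

lemma Z_indep_event:
  assumes "t \<ge> 1" "E \<in> sets (past t)"
  shows "prob (E \<inter> {\<omega>\<in>space M. Z t \<omega> $ i = k}) = prob E * prob {\<omega>\<in>space M. Z t \<omega> $ i = k}"
proof -
  obtain A where A: "A \<in> sets (PiM {..<t} (\<lambda>_. count_space UNIV))" "E = (\<lambda>\<omega>. \<lambda>s\<in>{..<t}. X s \<omega>) -` A \<inter> space M"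
    using past_cases[OF assms(2)] .
  have "{\<omega>\<in>space M. Z t \<omega> $ i = k} = Z t -` {v. v $ i = k} \<inter> space M" by auto
  then have "prob ({\<omega>\<in>space M. Z t \<omega> $ i = k} \<inter> E) = prob {\<omega>\<in>space M. Z t \<omega> $ i = k} * prob E"
    using Z_indep_past[OF assms(1)] A unfolding indep_rv_def sets_count_space by (intro indep_setD) blast+
  then show ?thesis by (simp add: ac_simps)
qed

lemma G_indep_event:
  assumes "t \<ge> 1" "j \<ge> 1" "E \<in> sets (past t)"
  shows "prob (E \<inter> {\<omega>\<in>space M. G t j \<omega> $ i = k}) = prob E * prob {\<omega>\<in>space M. G t j \<omega> $ i = k}"
proof -
  let ?N = "borel \<Otimes>\<^sub>M PiM {1..} (\<lambda>_. count_space UNIV) \<Otimes>\<^sub>M count_space UNIV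
      :: ((real ^ 2) \<times> (nat \<Rightarrow> nat ^ 2) \<times> (nat ^ 2)) measure"
  let ?f = "\<lambda>\<omega>. (\<alpha> t \<omega>, \<lambda>j\<in>{1..}. G t j \<omega>, Z t \<omega>)"
  obtain A where A: "A \<in> sets (PiM {..<t} (\<lambda>_. count_space UNIV))" "E = (\<lambda>\<omega>. \<lambda>s\<in>{..<t}. X s \<omega>) -` A \<inter> space M"
    using past_cases[OF assms(3)] .
  define B where "B = (\<lambda>x. fst (snd x) j) -` {v. v $ i = k} \<inter> space ?N"
  have "(\<lambda>x. fst (snd x) j) \<in> measurable ?N (count_space UNIV)"
    using assms by (intro measurable_compose[OF measurable_compose[OF measurable_snd measurable_fst] measurable_component_singleton]) auto
  then have "B \<in> sets ?N" unfolding B_def by (rule measurable_sets) simp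
  moreover have "{\<omega>\<in>space M. G t j \<omega> $ i = k} = ?f -` B \<inter> space M"
    using assms by (auto simp: B_def space_pair_measure space_PiM)
  ultimately have "prob ({\<omega>\<in>space M. G t j \<omega> $ i = k} \<inter> E) = prob {\<omega>\<in>space M. G t j \<omega> $ i = k} * prob E"
    using triple_indep_past[OF assms(1)] A unfolding indep_rv_def by (intro indep_setD) blast+
  then show ?thesis by (simp add: ac_simps)
qed

lemma Z_nn_mean:
  assumes "t \<ge> 1" shows "(\<integral>\<^sup>+\<omega>. ennreal (real (Z t \<omega> $ i)) \<partial>M) = ennreal (\<mu> $ i)" "0 \<le> \<mu> $ i"
proof -
  note [measurable] = Z_component_measurable[OF assms]
  have "integrable M (\<lambda>\<omega>. real (Z t \<omega> $ i))"
    using Z_square_integrable[OF assms] by (rule square_integrable_imp_integrable[rotated]) auto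
  then show "(\<integral>\<^sup>+\<omega>. ennreal (real (Z t \<omega> $ i)) \<partial>M) = ennreal (\<mu> $ i)"
    using Z_mean[OF assms] by (subst nn_integral_eq_integral) auto
  have "0 \<le> expectation (\<lambda>\<omega>. real (Z t \<omega> $ i))" by (intro integral_nonneg_AE) auto
  then show "0 \<le> \<mu> $ i" using Z_mean[OF assms] by simp
qed

text \<open>\<open>E\<close> together with the condition
  \<open>j \<le> X (t - 1) \<omega> $ i\<close> is again an event of the past, hence independent of
  counting variable number \<open>Suc j\<close>. Each such variable contributes its mean
  \<open>m $ i / l\<close>, and resumming the indicators counts one more of them than the previous
  state.\<close>

lemma thinning_mean:
  assumes t: "t \<ge> 1" and E: "E \<in> sets (past t)"
  shows "(\<integral>\<^sup>+\<omega>. indicator E \<omega> * ennreal (real (mnb_op (\<lambda>j. G t j \<omega> $ i) (X (t - 1) \<omega> $ i))) \<partial>M)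
    = (\<integral>\<^sup>+\<omega>. indicator E \<omega> * ennreal (m $ i * (real (X (t - 1) \<omega> $ i) + 1) / l) \<partial>M)"
proof -
  have EM [measurable]: "E \<in> events" using E past_subalgebra by (auto simp: subalgebra_def)
  note [measurable] = G_component_measurable[OF t]
  have lpos: "0 < l" by (rule l_pos)
  define E' where "E' j = E \<inter> (X (t - 1) -` {x. j \<le> x $ i} \<inter> space M)" for j
  have E': "E' j \<in> sets (past t)" for j
  proof -
    have "X (t - 1) -` {x. j \<le> x $ i} \<inter> space (past t) \<in> sets (past t)"
      by (rule measurable_sets[OF X_past_measurable]) (use t in auto)
    moreover have "space (past t) = space M" by (simp add: past_def)
    ultimately show ?thesis unfolding E'_def using E by (simp only: sets.Int)
  qed
  have E'M [measurable]: "E' j \<in> events" for j using E' past_subalgebra by (auto simp: subalgebra_def)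
  have "(\<integral>\<^sup>+\<omega>. indicator E \<omega> * ennreal (real (mnb_op (\<lambda>j. G t j \<omega> $ i) (X (t - 1) \<omega> $ i))) \<partial>M)
      = (\<integral>\<^sup>+\<omega>. (\<Sum>j. indicator (E' j) \<omega> * ennreal (real (G t (Suc j) \<omega> $ i))) \<partial>M)"
    unfolding mnb_op_suminf
    by (intro nn_integral_cong, subst ennreal_suminf_cmult[symmetric])
      (auto intro!: suminf_cong simp: indicator_def E'_def)
  also have "\<dots> = (\<Sum>j. \<integral>\<^sup>+\<omega>. indicator (E' j) \<omega> * ennreal (real (G t (Suc j) \<omega> $ i)) \<partial>M)"
    by (intro nn_integral_suminf) auto
  also have "\<dots> = (\<Sum>j. emeasure M (E' j) * ennreal (m $ i / l))"
  proof (intro suminf_cong)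
    fix j
    have "(\<integral>\<^sup>+\<omega>. indicator (E' j) \<omega> * ennreal (real (G t (Suc j) \<omega> $ i)) \<partial>M)
      = emeasure M (E' j) * (\<integral>\<^sup>+\<omega>. ennreal (real (G t (Suc j) \<omega> $ i)) \<partial>M)"
      by (rule nn_integral_indep_nat[OF E'M G_component_measurable[OF t] G_indep_event[OF t _ E']]) auto
    then show "(\<integral>\<^sup>+\<omega>. indicator (E' j) \<omega> * ennreal (real (G t (Suc j) \<omega> $ i)) \<partial>M) = emeasure M (E' j) * ennreal (m $ i / l)"
      by (simp add: G_mean[OF t])
  qed
  also have "\<dots> = (\<Sum>j. \<integral>\<^sup>+\<omega>. indicator (E' j) \<omega> * ennreal (m $ i / l) \<partial>M)"
    by (intro suminf_cong) (simp add: nn_integral_multc)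
  also have "\<dots> = (\<integral>\<^sup>+\<omega>. (\<Sum>j. indicator (E' j) \<omega> * ennreal (m $ i / l)) \<partial>M)"
    by (rule nn_integral_suminf[symmetric]) auto
  also have "\<dots> = (\<integral>\<^sup>+\<omega>. indicator E \<omega> * ennreal (m $ i * (real (X (t - 1) \<omega> $ i) + 1) / l) \<partial>M)"
  proof (intro nn_integral_cong)
    fix \<omega> assume \<omega>: "\<omega> \<in> space M"
    let ?x = "X (t - 1) \<omega> $ i"
    have "(\<Sum>j. indicator (E' j) \<omega> * ennreal (m $ i / l)) = (\<Sum>j\<in>{..?x}. indicator (E' j) \<omega> * ennreal (m $ i / l))"
      by (rule suminf_finite) (auto simp: E'_def indicator_def)
    also have "\<dots> = (\<Sum>j\<in>{..?x}. indicator E \<omega> * ennreal (m $ i / l))"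
      using \<omega> by (intro sum.cong) (auto simp: E'_def indicator_def)
    also have "\<dots> = indicator E \<omega> * (ennreal (real ?x + 1) * ennreal (m $ i / l))"
      by (simp add: ennreal_of_nat_eq_real_of_nat[symmetric] ac_simps)
    also have "ennreal (real ?x + 1) * ennreal (m $ i / l) = ennreal (m $ i * (real ?x + 1) / l)"
      using m_bounds[of i] lpos by (subst ennreal_mult[symmetric]) (auto simp: mult.commute)
    finally show "(\<Sum>j. indicator (E' j) \<omega> * ennreal (m $ i / l)) = indicator E \<omega> * ennreal (m $ i * (real ?x + 1) / l)" .
  qed
  finally show ?thesis .
qed

lemma one_step_mean:
  assumes t: "t \<ge> 1" and E: "E \<in> sets (past t)"
  shows "(\<integral>\<^sup>+\<omega>. indicator E \<omega> * ennreal (real (X t \<omega> $ i)) \<partial>M)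
    = (\<integral>\<^sup>+\<omega>. indicator E \<omega> * ennreal (m $ i * (real (X (t - 1) \<omega> $ i) + 1) / l + \<mu> $ i) \<partial>M)"
proof -
  have EM [measurable]: "E \<in> events" using E past_subalgebra by (auto simp: subalgebra_def)
  note [measurable] = Z_component_measurable[OF t] G_component_measurable[OF t]
  have nn: "0 \<le> m $ i * (real (X (t - 1) \<omega> $ i) + 1) / l" for \<omega>
    using m_bounds[of i] l_pos by (intro divide_nonneg_pos mult_nonneg_nonneg) auto
  have thin: "(\<lambda>\<omega>. indicator E \<omega> * ennreal (real (mnb_op (\<lambda>j. G t j \<omega> $ i) (X (t - 1) \<omega> $ i)))) \<in> borel_measurable M"
  proof -
    have [measurable]: "(\<lambda>\<omega>. G t (Suc j) \<omega> $ i) \<in> measurable M (count_space UNIV)" for j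
      by (rule G_component_measurable[OF t]) simp
    note [measurable] = X_measurable[of "t - 1"]
    show ?thesis unfolding mnb_op_suminf by measurable
  qed
  have "(\<integral>\<^sup>+\<omega>. indicator E \<omega> * ennreal (real (X t \<omega> $ i)) \<partial>M)
     = (\<integral>\<^sup>+\<omega>. indicator E \<omega> * ennreal (real (mnb_op (\<lambda>j. G t j \<omega> $ i) (X (t - 1) \<omega> $ i)))
          + indicator E \<omega> * ennreal (real (Z t \<omega> $ i)) \<partial>M)"
    by (intro nn_integral_cong_AE, use recursion[OF t, of i] in eventually_elim)
      (simp add: ennreal_plus[symmetric] distrib_left[symmetric] del: ennreal_plus)
  also have "\<dots> = (\<integral>\<^sup>+\<omega>. indicator E \<omega> * ennreal (real (mnb_op (\<lambda>j. G t j \<omega> $ i) (X (t - 1) \<omega> $ i))) \<partial>M)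
      + (\<integral>\<^sup>+\<omega>. indicator E \<omega> * ennreal (real (Z t \<omega> $ i)) \<partial>M)"
    by (intro nn_integral_add thin) measurable
  also have "(\<integral>\<^sup>+\<omega>. indicator E \<omega> * ennreal (real (Z t \<omega> $ i)) \<partial>M) = emeasure M E * (\<integral>\<^sup>+\<omega>. ennreal (real (Z t \<omega> $ i)) \<partial>M)"
    by (rule nn_integral_indep_nat[OF EM Z_component_measurable[OF t] Z_indep_event[OF t E]])
  also have "\<dots> = (\<integral>\<^sup>+\<omega>. indicator E \<omega> * ennreal (\<mu> $ i) \<partial>M)"
    by (simp add: Z_nn_mean(1)[OF t] nn_integral_multc)
  also have "(\<integral>\<^sup>+\<omega>. indicator E \<omega> * ennreal (real (mnb_op (\<lambda>j. G t j \<omega> $ i) (X (t - 1) \<omega> $ i))) \<partial>M)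
      + (\<integral>\<^sup>+\<omega>. indicator E \<omega> * ennreal (\<mu> $ i) \<partial>M)
    = (\<integral>\<^sup>+\<omega>. indicator E \<omega> * ennreal (m $ i * (real (X (t - 1) \<omega> $ i) + 1) / l) + indicator E \<omega> * ennreal (\<mu> $ i) \<partial>M)"
    unfolding thinning_mean[OF t E] by (rule nn_integral_add[symmetric]) auto
  also have "\<dots> = (\<integral>\<^sup>+\<omega>. indicator E \<omega> * ennreal (m $ i * (real (X (t - 1) \<omega> $ i) + 1) / l + \<mu> $ i) \<partial>M)"
    using Z_nn_mean(2)[OF t] nn by (intro nn_integral_cong) (simp add: distrib_left[symmetric])
  finally show ?thesis .
qed

lemma reg_param: "reg l (param m \<mu>) x $ i = m $ i * (real (x $ i) + 1) / l + \<mu> $ i"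
  using exhaust_2[of i] by (auto simp: reg_def param_def vector_def)

text \<open>The mean given the whole past depends on \<open>X (t - 1)\<close> alone, so it serves
  every smaller algebra that makes this variable measurable. The full past is needed for the
  martingale property, the algebra generated by \<open>X (t - 1)\<close> for identifying the
  regression function.\<close>

lemma cond_exp_subalgebra:
  assumes t: "t \<ge> 1" and int: "\<And>s i. integrable M (\<lambda>\<omega>. real (X s \<omega> $ i))"
    and F: "subalgebra (past t) F" and XF: "X (t - 1) \<in> measurable F (count_space UNIV)"
  shows "AE \<omega> in M. real_cond_exp M F (\<lambda>\<omega>. real (X t \<omega> $ i)) \<omega> = reg l (param m \<mu>) (X (t - 1) \<omega>) $ i"
proof -
  have sub: "subalgebra M F" using F past_subalgebra[of t] by (auto simp: subalgebra_def)
  then interpret sigma_finite_subalgebra M F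
    by (rule sigma_finite_subalgebraI)
  let ?r = "\<lambda>\<omega>. reg l (param m \<mu>) (X (t - 1) \<omega>) $ i"
  have ri: "integrable M ?r" unfolding reg_param using int by auto
  have nn: "0 \<le> ?r \<omega>" for \<omega>
    unfolding reg_param using m_bounds[of i] l_pos Z_nn_mean(2)[OF t, of i]
    by (intro add_nonneg_nonneg divide_nonneg_pos mult_nonneg_nonneg) auto
  show ?thesis
  proof (rule real_cond_exp_charact)
    fix A assume "A \<in> sets F"
    then have A: "A \<in> sets (past t)" and AM: "A \<in> events" using F sub by (auto simp: subalgebra_def)
    have set_to_nn: "(\<integral>\<omega>\<in>A. f \<omega> \<partial>M) = enn2real (\<integral>\<^sup>+\<omega>. indicator A \<omega> * ennreal (f \<omega>) \<partial>M)"
      if "integrable M f" "\<And>\<omega>. 0 \<le> f \<omega>" for f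
    proof -
      have "(\<integral>\<omega>\<in>A. f \<omega> \<partial>M) = enn2real (\<integral>\<^sup>+\<omega>. ennreal (indicator A \<omega> * f \<omega>) \<partial>M)"
        unfolding set_lebesgue_integral_def using that AM
        by (subst integral_eq_nn_integral) (auto simp: indicator_def)
      also have "(\<integral>\<^sup>+\<omega>. ennreal (indicator A \<omega> * f \<omega>) \<partial>M) = (\<integral>\<^sup>+\<omega>. indicator A \<omega> * ennreal (f \<omega>) \<partial>M)"
        by (intro nn_integral_cong) (auto simp: indicator_def)
      finally show ?thesis .
    qed
    show "(\<integral>\<omega>\<in>A. real (X t \<omega> $ i) \<partial>M) = (\<integral>\<omega>\<in>A. ?r \<omega> \<partial>M)"
      using set_to_nn[OF int] set_to_nn[OF ri nn] one_step_mean[OF t A, of i] unfolding reg_param by simp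
  next
    show "?r \<in> borel_measurable F"
      using XF by (rule measurable_compose) auto
  qed (use int ri in auto)
qed

text \<open>The thinning sum has a first term even when the previous state is 0, and this term takes
  a value above \<open>c\<close> with positive probability.\<close>

lemma X_not_constant: "\<not> (AE \<omega> in M. real (X 1 \<omega> $ i) = c)"
proof
  assume AE: "AE \<omega> in M. real (X 1 \<omega> $ i) = c"
  obtain k :: nat where k: "c < k" using reals_Archimedean2 by blast
  have "AE \<omega> in M. \<not> (G 1 1 \<omega> $ i = k)"
    using AE recursion[of 1 i, OF order_refl]
  proof eventually_elim
    case (elim \<omega>)
    have "G 1 1 \<omega> $ i \<le> mnb_op (\<lambda>j. G 1 j \<omega> $ i) (X (1 - 1) \<omega> $ i)"
      unfolding mnb_op_def by (rule member_le_sum) auto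
    with elim have "real (G 1 1 \<omega> $ i) \<le> c" by simp
    with k show ?case by auto
  qed
  then have "prob {\<omega>\<in>space M. G 1 1 \<omega> $ i = k} = 0"
    using G_component_measurable[of 1 1 i] by (subst prob_eq_0) auto
  then show False using G_mass(2)[of 1 1 i k] by simp
qed

end

section \<open>Least squares\<close>

lemma dot_transpose_matrix: "(transpose A *v r) \<bullet> w = r \<bullet> (A *v (w :: real ^ 'n))"
  by (simp add: dot_lmul_matrix)

text \<open>The vector \<open>w\<close> itself is used as direction of perturbation: a step
  \<open>e\<close> along it gains \<open>2 * e * (norm w)\<^sup>2\<close> and loses only
  \<open>e\<^sup>2 * c\<close>, which contradicts minimality for small \<open>e\<close> unless
  \<open>w\<close> vanishes.\<close>

lemma least_squares_normal_equation:
  fixes A :: "'i \<Rightarrow> real ^ 'n ^ 'k" and y :: "'i \<Rightarrow> real ^ 'k"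
  assumes min: "\<And>h. (\<Sum>t\<in>I. (norm (y t - A t *v g))\<^sup>2) \<le> (\<Sum>t\<in>I. (norm (y t - A t *v h))\<^sup>2)"
  shows "(\<Sum>t\<in>I. transpose (A t) *v (y t - A t *v g)) = 0"
proof -
  define w where "w = (\<Sum>t\<in>I. transpose (A t) *v (y t - A t *v g))"
  define c where "c = (\<Sum>t\<in>I. (norm (A t *v w))\<^sup>2)"
  have c: "0 \<le> c" by (simp add: c_def sum_nonneg)
  have cross: "(\<Sum>t\<in>I. (y t - A t *v g) \<bullet> (A t *v w)) = (norm w)\<^sup>2"
    by (simp only: dot_transpose_matrix[symmetric] inner_sum_left[symmetric] w_def[symmetric] power2_norm_eq_inner)
  have *: "2 * e * (norm w)\<^sup>2 \<le> e\<^sup>2 * c" for e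
  proof -
    have "(norm (y t - A t *v (g + e *\<^sub>R w)))\<^sup>2
        = (norm (y t - A t *v g))\<^sup>2 - 2 * e * ((y t - A t *v g) \<bullet> (A t *v w)) + e\<^sup>2 * (norm (A t *v w))\<^sup>2" for t
    proof -
      have "y t - A t *v (g + e *\<^sub>R w) = (y t - A t *v g) - e *\<^sub>R (A t *v w)"
        by (simp add: matrix_vector_right_distrib matrix_vector_mult_scaleR)
      moreover have "(norm (a - e *\<^sub>R b))\<^sup>2 = (norm a)\<^sup>2 - 2 * e * (a \<bullet> b) + e\<^sup>2 * (norm b)\<^sup>2" for a b :: "real ^ 'k"
        unfolding power2_norm_eq_inner inner_diff_left inner_diff_right inner_scaleR_left inner_scaleR_right
          inner_commute[of b a] by (simp add: power2_eq_square algebra_simps)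
      ultimately show ?thesis by (simp only:)
    qed
    then have "(\<Sum>t\<in>I. (norm (y t - A t *v (g + e *\<^sub>R w)))\<^sup>2)
        = (\<Sum>t\<in>I. (norm (y t - A t *v g))\<^sup>2) - 2 * e * (norm w)\<^sup>2 + e\<^sup>2 * c"
      by (simp add: sum.distrib sum_subtractf sum_distrib_left[symmetric] cross c_def)
    then show ?thesis using min[of "g + e *\<^sub>R w"] by linarith
  qed
  have "norm w = 0"
  proof (rule ccontr)
    assume "norm w \<noteq> 0"
    then have w: "0 < (norm w)\<^sup>2" by simp
    \<comment> \<open>Small enough for \<open>e * c \<le> (norm w)\<^sup>2\<close>; the 1 keeps the
      denominator positive.\<close>
    define e where "e = (norm w)\<^sup>2 / (c + 1)"
    have e: "0 < e" using w c by (simp add: e_def)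
    have "2 * (norm w)\<^sup>2 \<le> e * c"
      using *[of e] e by (simp add: power2_eq_square[of e] mult.assoc)
    also have "\<dots> \<le> e * (c + 1)" using e by simp
    also have "\<dots> = (norm w)\<^sup>2" using c by (simp add: e_def)
    finally show False using w by simp
  qed
  then show ?thesis by (simp add: w_def)
qed

text \<open>The regression function is linear in the parameter, so this is both its matrix and, at
  every parameter, its Jacobian.\<close>

definition design :: "real \<Rightarrow> nat ^ 2 \<Rightarrow> real ^ 4 ^ 2" where
  "design l x = vector [vector [(real (x $ 1) + 1) / l, 0, 1, 0], vector [0, (real (x $ 2) + 1) / l, 0, 1]]"

lemma vector_4 [simp]:
  "(vector [a, b, c, d] :: ('a::zero) ^ 4) $ 1 = a" "(vector [a, b, c, d] :: 'a ^ 4) $ 2 = b"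
  "(vector [a, b, c, d] :: 'a ^ 4) $ 3 = c" "(vector [a, b, c, d] :: 'a ^ 4) $ 4 = d"
  unfolding vector_def by simp_all

lemma reg_eq_design: "reg l \<gamma> x = design l x *v \<gamma>"
  by (simp add: vec_eq_iff forall_2 reg_def design_def matrix_vector_mult_def sum_4 mult.commute)

lemma reg_jacobian_eq_design: "reg_jacobian l \<gamma> x = design l x"
proof -
  have "((*v) (design l x) has_derivative (*v) (design l x)) (at \<gamma>)"
    by (intro bounded_linear_imp_has_derivative matrix_vector_mul_bounded_linear)
  then show ?thesis
    unfolding reg_jacobian_def jacobian_def reg_eq_design
    using frechet_derivative_at[symmetric] by (metis matrix_of_matrix_vector_mul)
qed

text \<open>Minus half the gradient, in the parameter, of the squared prediction error for a
  transition from \<open>x\<close> to \<open>y\<close>.\<close>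

definition score :: "real \<Rightarrow> real ^ 4 \<Rightarrow> nat ^ 2 \<Rightarrow> nat ^ 2 \<Rightarrow> real ^ 4" where
  "score l \<gamma> x y = transpose (design l x) *v ((\<chi> i. real (y $ i)) - reg l \<gamma> x)"

definition gram :: "real \<Rightarrow> nat ^ 2 \<Rightarrow> real ^ 4 ^ 4" where
  "gram l x = transpose (design l x) ** design l x"

text \<open>Centring the normal equations at an arbitrary \<open>\<gamma>\<close> leaves the scores
  at \<open>\<gamma>\<close> on the right. A sample of size \<open>n\<close> has
  \<open>n - 1\<close> transitions, reindexed by \<open>t = k + 2\<close>.\<close>

lemma CLS_normal_equation:
  assumes "is_arg_min (S\<^sub>1 l n x) (\<lambda>_. True) g"
  shows "(\<Sum>k<n - 1. gram l (x (k + 1))) *v (g - \<gamma>) = (\<Sum>k<n - 1. score l \<gamma> (x (k + 1)) (x (k + 2)))"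
proof -
  let ?y = "\<lambda>t. (\<chi> i. real (x t $ i)) :: real ^ 2" and ?A = "\<lambda>t. design l (x (t - 1))"
  have S: "S\<^sub>1 l n x h = (\<Sum>t\<in>{2..n}. (norm (?y t - ?A t *v h))\<^sup>2)" for h
    unfolding S\<^sub>1_def reg_eq_design power2_norm_eq_inner inner_vec_def
    by (simp add: power2_eq_square)
  have "(\<Sum>t\<in>{2..n}. (norm (?y t - ?A t *v g))\<^sup>2) \<le> (\<Sum>t\<in>{2..n}. (norm (?y t - ?A t *v h))\<^sup>2)" for h
    using assms unfolding is_arg_min_linorder S by simp
  then have "(\<Sum>t\<in>{2..n}. transpose (?A t) *v (?y t - ?A t *v g)) = 0"
    by (rule least_squares_normal_equation)
  moreover have "transpose (?A t) *v (?y t - ?A t *v g) = score l \<gamma> (x (t - 1)) (x t) - gram l (x (t - 1)) *v (g - \<gamma>)" for t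
    unfolding score_def gram_def reg_eq_design
    by (simp add: matrix_vector_mul_assoc[symmetric] matrix_vector_mult_diff_distrib)
  ultimately have "(\<Sum>t\<in>{2..n}. gram l (x (t - 1)) *v (g - \<gamma>)) = (\<Sum>t\<in>{2..n}. score l \<gamma> (x (t - 1)) (x t))"
    by (simp add: sum_subtractf)
  moreover have "(\<Sum>t\<in>{2..n}. f t) = (\<Sum>k<n - 1. f (k + 2))" for f :: "nat \<Rightarrow> real ^ 4"
  proof (induction n)
    case (Suc n)
    then show ?case by (cases n) simp_all
  qed simp
  moreover have "(\<Sum>k\<in>I. B k) *v h = (\<Sum>k\<in>I. B k *v h)" for B :: "nat \<Rightarrow> real ^ 4 ^ 4" and I h
    by (induction I rule: infinite_finite_induct) (auto simp: matrix_vector_mult_add_rdistrib)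
  ultimately show ?thesis by simp
qed

section \<open>Expectations of vectors and matrices\<close>

lemma bounded_linear_axis: "bounded_linear (axis i :: 'b::euclidean_space \<Rightarrow> 'b ^ 'n)"
  by (intro linear_conv_bounded_linear[THEN iffD1] linearI) (auto simp: vec_eq_iff axis_def)

lemma integrable_vecI:
  fixes f :: "'a \<Rightarrow> 'b::euclidean_space ^ 'n"
  assumes "\<And>i. integrable M (\<lambda>\<omega>. f \<omega> $ i)"
  shows "integrable M f"
proof -
  have "integrable M (\<lambda>\<omega>. \<Sum>i\<in>UNIV. axis i (f \<omega> $ i))"
    by (intro Bochner_Integration.integrable_sum integrable_bounded_linear[OF bounded_linear_axis] assms)
  moreover have "(\<Sum>i\<in>UNIV. axis i (f \<omega> $ i)) = f \<omega>" for \<omega>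
    by (simp add: vec_eq_iff axis_def if_distrib cong: if_cong)
  ultimately show ?thesis by simp
qed

text \<open>Matrix expectations are handled through their bilinear forms, which commute with the
  integral.\<close>

lemma bounded_linear_quadratic: "bounded_linear (\<lambda>A :: real ^ 'n ^ 'n. s \<bullet> (A *v r))"
  by (intro linear_conv_bounded_linear[THEN iffD1] linearI)
    (auto simp: matrix_vector_mult_add_rdistrib inner_add_right scaleR_matrix_vector_assoc[symmetric])

lemma outer_quadratic: "s \<bullet> (outer d d *v r) = (s \<bullet> d) * (r \<bullet> d)"
  by (simp add: outer_def inner_vec_def matrix_vector_mult_def sum_product sum_distrib_left ac_simps)

lemma score_outer:
  "transpose (reg_jacobian l \<gamma> x) ** outer u u ** reg_jacobian l \<gamma> x
    = outer (transpose (design l x) *v u) (transpose (design l x) *v u)"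
  unfolding reg_jacobian_eq_design
  by (simp add: vec_eq_iff outer_def matrix_matrix_mult_def matrix_vector_mult_def transpose_def
      sum_product sum_distrib_left sum_distrib_right ac_simps)

lemma matrix_vector_norm_le:
  fixes A :: "real ^ 'n ^ 'm"
  shows "norm (A *v x) \<le> (\<Sum>i\<in>UNIV. \<Sum>j\<in>UNIV. \<bar>A $ i $ j\<bar>) * norm x"
proof -
  have "norm (A *v x) \<le> onorm ((*v) A) * norm x"
    by (intro onorm matrix_vector_mul_bounded_linear)
  also have "\<dots> \<le> (\<Sum>i\<in>UNIV. \<Sum>j\<in>UNIV. \<bar>A $ i $ j\<bar>) * norm x"
    by (intro mult_right_mono onorm_le_matrix_component_sum) auto
  finally show ?thesis .
qed

text \<open>For \<open>\<delta> \<le> 1 / 2\<close> the term \<open>\<delta> * norm y\<close> can be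
  absorbed, which turns an error relative to the unknown \<open>y\<close> into one relative to
  \<open>u\<close>.\<close>

lemma perturbation_bound:
  fixes u y :: "'b::real_normed_vector"
  assumes "norm (y - u) \<le> \<delta> * norm y" "\<delta> \<le> 1 / 2"
  shows "norm y \<le> 2 * norm u" "norm (y - u) \<le> 2 * \<delta> * norm u"
proof -
  have "norm (y - u) \<le> 1 / 2 * norm y" using assms by (meson mult_right_mono norm_ge_zero order_trans)
  then show 1: "norm y \<le> 2 * norm u" using norm_triangle_ineq2[of y u] by linarith
  show "norm (y - u) \<le> 2 * \<delta> * norm u"
  proof (cases "0 \<le> \<delta>")
    case True
    with 1 have "\<delta> * norm y \<le> \<delta> * (2 * norm u)" by (intro mult_left_mono)
    with assms show ?thesis by simp
  next
    case False
    then have "norm y = 0" using assms(1) norm_ge_zero[of "y - u"] by (smt (verit) mult_neg_pos norm_ge_zero)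
    then show ?thesis using assms(1) by simp
  qed
qed

lemma perturbation_tendsto_0:
  fixes u y :: "nat \<Rightarrow> 'b::real_normed_vector"
  assumes le: "\<And>n. norm (y n - u n) \<le> \<delta> n * norm (y n)" and \<delta>: "\<delta> \<longlonglongrightarrow> 0" and u: "u \<longlonglongrightarrow> 0"
  shows "y \<longlonglongrightarrow> 0"
proof (rule Lim_null_comparison)
  have "eventually (\<lambda>n. \<delta> n < 1 / 2) sequentially" using \<delta> by (intro order_tendstoD) auto
  then show "eventually (\<lambda>n. norm (y n) \<le> 2 * norm (u n)) sequentially"
    by eventually_elim (rule perturbation_bound(1)[OF le], simp)
  show "(\<lambda>n. 2 * norm (u n)) \<longlonglongrightarrow> 0"
    using tendsto_mult[OF tendsto_const[of 2] tendsto_norm[OF u]] by simp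
qed

text \<open>\<open>\<delta>\<close> tends to 0 only almost surely, and no moment of \<open>Y\<close>
  is at hand. Where \<open>\<delta> > 1 / 2\<close>, the truncation at 1 is all that is used;
  elsewhere the difference is at most \<open>2 * \<delta> * norm U\<close>, which is small while
  \<open>norm U \<le> R\<close>, and the second moment takes care of larger
  \<open>U\<close>.\<close>

lemma (in prob_space) perturbation_in_probability:
  fixes U Y :: "nat \<Rightarrow> 'a \<Rightarrow> 'b::euclidean_space"
  assumes [measurable]: "\<And>n. U n \<in> borel_measurable M" "\<And>n. Y n \<in> borel_measurable M" "\<And>n. \<delta> n \<in> borel_measurable M"
    and le: "\<And>n \<omega>. \<omega> \<in> space M \<Longrightarrow> norm (Y n \<omega> - U n \<omega>) \<le> \<delta> n \<omega> * norm (Y n \<omega>)"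
    and \<delta>0: "\<And>n \<omega>. 0 \<le> \<delta> n \<omega>"
    and \<delta>: "AE \<omega> in M. (\<lambda>n. \<delta> n \<omega>) \<longlonglongrightarrow> 0"
    and U2: "\<And>n. integrable M (\<lambda>\<omega>. (norm (U n \<omega>))\<^sup>2)" and B: "\<And>n. (\<integral>\<omega>. (norm (U n \<omega>))\<^sup>2 \<partial>M) \<le> B"
  shows "(\<lambda>n. \<integral>\<omega>. min 1 (norm (Y n \<omega> - U n \<omega>)) \<partial>M) \<longlonglongrightarrow> 0"
proof (rule LIMSEQ_I)
  fix e :: real assume e: "0 < e"
  \<comment> \<open>\<open>R \<ge> 1\<close> gives \<open>R \<le> (norm U)\<^sup>2\<close> as soon
    as \<open>norm U > R\<close>; the other entry makes \<open>(\<bar>B\<bar> + 1) / R\<close> at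
    most \<open>e / 2\<close>.\<close>
  define R where "R = max 1 (2 * (\<bar>B\<bar> + 1) / e)"
  have R: "1 \<le> R" "2 * (\<bar>B\<bar> + 1) / e \<le> R" by (auto simp: R_def)
  \<comment> \<open>The first summand serves \<open>\<delta> \<le> 1 / 2\<close> with
    \<open>norm U \<le> R\<close>; the second equals 1 once \<open>\<delta> > 1 / 2\<close>. Both
    are bounded, as dominated convergence requires.\<close>
  define w where "w n \<omega> = min 1 (2 * \<delta> n \<omega> * R) + min 1 (2 * \<delta> n \<omega>)" for n \<omega>
  have [measurable]: "w n \<in> borel_measurable M" for n unfolding w_def by measurable
  have wb: "0 \<le> w n \<omega>" "w n \<omega> \<le> 2" for n \<omega> using \<delta>0[of n \<omega>] R by (auto simp: w_def)
  have wi: "integrable M (w n)" for n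
    by (intro integrable_const_bound[where B=2]) (use wb in auto)
  have "(\<lambda>n. \<integral>\<omega>. w n \<omega> \<partial>M) \<longlonglongrightarrow> (\<integral>\<omega>. 0 \<partial>M)"
  proof (rule integral_dominated_convergence[where w="\<lambda>_. 2"])
    show "AE \<omega> in M. (\<lambda>n. w n \<omega>) \<longlonglongrightarrow> 0"
      using \<delta>
    proof eventually_elim
      case (elim \<omega>)
      have "(\<lambda>n. w n \<omega>) \<longlonglongrightarrow> min 1 (2 * 0 * R) + min 1 (2 * 0)"
        unfolding w_def by (intro tendsto_intros elim)
      then show ?case by simp
    qed
  qed (use wb in auto)
  then have "eventually (\<lambda>n. (\<integral>\<omega>. w n \<omega> \<partial>M) < e / 2) sequentially"
    using e by (intro order_tendstoD) auto
  then obtain n0 where n0: "\<And>n. n \<ge> n0 \<Longrightarrow> (\<integral>\<omega>. w n \<omega> \<partial>M) < e / 2"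
    by (auto simp: eventually_sequentially)
  show "\<exists>no. \<forall>n\<ge>no. norm ((\<integral>\<omega>. min 1 (norm (Y n \<omega> - U n \<omega>)) \<partial>M) - 0) < e"
  proof (intro exI allI impI)
    fix n assume n: "n \<ge> n0"
    have pt: "min 1 (norm (Y n \<omega> - U n \<omega>)) \<le> w n \<omega> + (norm (U n \<omega>))\<^sup>2 / R" if \<omega>: "\<omega> \<in> space M" for \<omega>
    proof (cases "\<delta> n \<omega> \<le> 1 / 2")
      case False
      then have "1 \<le> w n \<omega>" using \<delta>0[of n \<omega>] R by (auto simp: w_def)
      moreover have "0 \<le> (norm (U n \<omega>))\<^sup>2 / R" using R by simp
      ultimately show ?thesis by linarith
    next
      case True
      note p = perturbation_bound(2)[OF le[OF \<omega>] True]
      show ?thesis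
      proof (cases "norm (U n \<omega>) \<le> R")
        case True
        then have "2 * \<delta> n \<omega> * norm (U n \<omega>) \<le> 2 * \<delta> n \<omega> * R" using \<delta>0[of n \<omega>] by (intro mult_left_mono) auto
        with p have "min 1 (norm (Y n \<omega> - U n \<omega>)) \<le> min 1 (2 * \<delta> n \<omega> * R)" by linarith
        also have "\<dots> \<le> w n \<omega>" using \<delta>0[of n \<omega>] by (simp add: w_def)
        finally show ?thesis using R by (simp add: add_increasing2)
      next
        case False
        then have "R * 1 \<le> norm (U n \<omega>) * norm (U n \<omega>)" using R by (intro mult_mono) auto
        then have "1 \<le> (norm (U n \<omega>))\<^sup>2 / R" using R by (simp add: power2_eq_square)
        then show ?thesis using wb(1)[of n \<omega>] by linarith
      qed
    qed
    have "(\<integral>\<omega>. min 1 (norm (Y n \<omega> - U n \<omega>)) \<partial>M) \<le> (\<integral>\<omega>. w n \<omega> + (norm (U n \<omega>))\<^sup>2 / R \<partial>M)"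
    proof (rule integral_mono)
      show "integrable M (\<lambda>\<omega>. min 1 (norm (Y n \<omega> - U n \<omega>)))"
        by (intro integrable_const_bound[where B=1]) auto
    qed (use wi U2 pt in auto)
    also have "\<dots> = (\<integral>\<omega>. w n \<omega> \<partial>M) + (\<integral>\<omega>. (norm (U n \<omega>))\<^sup>2 \<partial>M) / R"
      using wi U2 by simp
    also have "(\<integral>\<omega>. (norm (U n \<omega>))\<^sup>2 \<partial>M) / R \<le> (\<bar>B\<bar> + 1) / R"
      using B[of n] R by (intro divide_right_mono) auto
    also have "(\<bar>B\<bar> + 1) / R \<le> e / 2" using R e by (simp add: field_simps)
    finally have "(\<integral>\<omega>. min 1 (norm (Y n \<omega> - U n \<omega>)) \<partial>M) < e" using n0[OF n] by linarith
    moreover have "0 \<le> (\<integral>\<omega>. min 1 (norm (Y n \<omega> - U n \<omega>)) \<partial>M)" by (intro integral_nonneg_AE) auto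
    ultimately show "norm ((\<integral>\<omega>. min 1 (norm (Y n \<omega> - U n \<omega>)) \<partial>M) - 0) < e" by simp
  qed
qed

text \<open>The state space is countable and discrete, so the product of two copies is discrete as
  well and every function of two states is measurable.\<close>

lemma transition_measurable:
  fixes U V :: "'a \<Rightarrow> nat ^ 2"
  assumes "U \<in> measurable F (count_space UNIV)" "V \<in> measurable F (count_space UNIV)"
    and "\<And>x y. \<phi> x y \<in> space S"
  shows "(\<lambda>\<omega>. \<phi> (U \<omega>) (V \<omega>)) \<in> measurable F S"
proof -
  have "(\<lambda>\<omega>. (U \<omega>, V \<omega>)) \<in> measurable F (count_space UNIV \<Otimes>\<^sub>M count_space UNIV)"
    using assms by (intro measurable_Pair)
  then have pm: "(\<lambda>\<omega>. (U \<omega>, V \<omega>)) \<in> measurable F (count_space UNIV)"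
    by (simp add: pair_measure_countable)
  have "(\<lambda>(x, y). \<phi> x y) \<in> measurable (count_space UNIV) S" using assms(3) by auto
  from measurable_compose[OF pm this] show ?thesis by simp
qed

lemma gram_quadratic: "s \<bullet> (gram l x *v r) = (design l x *v s) \<bullet> (design l x *v r)"
  by (simp only: gram_def matrix_vector_mul_assoc[symmetric] inner_commute[of s] dot_transpose_matrix)
    (rule inner_commute)

section \<open>Integrability from fourth moments\<close>

context prob_space begin

text \<open>A class closed under affine combinations in which products of four members are
  integrable. The exponent is dictated by the outer square of a score, whose entries are sums of
  products of two design entries and two residuals.\<close>

definition fourth_integrable :: "('a \<Rightarrow> real) \<Rightarrow> bool" where
  "fourth_integrable f \<longleftrightarrow> f \<in> borel_measurable M \<and> integrable M (\<lambda>\<omega>. f \<omega> ^ 4)"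

lemma fourth_integrable_const: "fourth_integrable (\<lambda>_. c)"
  by (simp add: fourth_integrable_def)

lemma fourth_integrable_cmult: "fourth_integrable f \<Longrightarrow> fourth_integrable (\<lambda>\<omega>. c * f \<omega>)"
  unfolding fourth_integrable_def by (auto simp: power_mult_distrib)

lemma fourth_integrable_add:
  assumes "fourth_integrable f" "fourth_integrable g"
  shows "fourth_integrable (\<lambda>\<omega>. f \<omega> + g \<omega>)"
proof -
  have [measurable]: "f \<in> borel_measurable M" "g \<in> borel_measurable M"
    using assms by (auto simp: fourth_integrable_def)
  have sq: "(a + b)\<^sup>2 \<le> 2 * a\<^sup>2 + 2 * b\<^sup>2" for a b :: real
    using zero_le_power2[of "a - b"] by (simp add: power2_eq_square algebra_simps)
  have "(a + b) ^ 4 \<le> 8 * a ^ 4 + 8 * b ^ 4" for a b :: real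
  proof -
    have "(a + b) ^ 4 = ((a + b)\<^sup>2)\<^sup>2" by simp
    also have "\<dots> \<le> (2 * a\<^sup>2 + 2 * b\<^sup>2)\<^sup>2" by (intro power_mono sq) simp
    also have "\<dots> \<le> 2 * (2 * a\<^sup>2)\<^sup>2 + 2 * (2 * b\<^sup>2)\<^sup>2" by (rule sq)
    also have "\<dots> = 8 * a ^ 4 + 8 * b ^ 4" by (simp add: power_mult_distrib)
    finally show ?thesis .
  qed
  moreover have "integrable M (\<lambda>\<omega>. 8 * f \<omega> ^ 4 + 8 * g \<omega> ^ 4)"
    using assms by (simp add: fourth_integrable_def)
  ultimately have "integrable M (\<lambda>\<omega>. (f \<omega> + g \<omega>) ^ 4)"
    by (elim Bochner_Integration.integrable_bound) (auto intro!: AE_I2 order_trans[OF _ abs_ge_self])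
  then show ?thesis by (simp add: fourth_integrable_def)
qed

lemma integrable_four_products:
  assumes "fourth_integrable f" "fourth_integrable g" "fourth_integrable h" "fourth_integrable k"
  shows "integrable M (\<lambda>\<omega>. f \<omega> * g \<omega> * (h \<omega> * k \<omega>))"
proof -
  have [measurable]: "f \<in> borel_measurable M" "g \<in> borel_measurable M" "h \<in> borel_measurable M" "k \<in> borel_measurable M"
    using assms by (auto simp: fourth_integrable_def)
  have prod: "\<bar>a * b\<bar> \<le> a\<^sup>2 + b\<^sup>2" for a b :: real
    using sum_squares_bound[of "\<bar>a\<bar>" "\<bar>b\<bar>"] zero_le_power2[of a] zero_le_power2[of b]
    unfolding abs_mult power2_abs by linarith
  have prod2: "(a * b)\<^sup>2 \<le> a ^ 4 + b ^ 4" for a b :: real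
    using prod[of "a\<^sup>2" "b\<^sup>2"] by (simp add: power_mult_distrib)
  have "\<bar>a * b * (c * d)\<bar> \<le> a ^ 4 + b ^ 4 + (c ^ 4 + d ^ 4)" for a b c d :: real
    using prod[of "a * b" "c * d"] prod2[of a b] prod2[of c d] by linarith
  moreover have "integrable M (\<lambda>\<omega>. f \<omega> ^ 4 + g \<omega> ^ 4 + (h \<omega> ^ 4 + k \<omega> ^ 4))"
    using assms by (simp add: fourth_integrable_def)
  ultimately show ?thesis
    by (elim Bochner_Integration.integrable_bound) (auto intro!: AE_I2 order_trans[OF _ abs_ge_self])
qed

lemma fourth_integrable_mult: "fourth_integrable f \<Longrightarrow> fourth_integrable g \<Longrightarrow> integrable M (\<lambda>\<omega>. f \<omega> * g \<omega>)"
  using integrable_four_products[of f g "\<lambda>_. 1" "\<lambda>_. 1"] by (simp add: fourth_integrable_const)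

lemma fourth_integrable_integrable: "fourth_integrable f \<Longrightarrow> integrable M f"
  using fourth_integrable_mult[of f "\<lambda>_. 1"] by (simp add: fourth_integrable_const)

end

section \<open>Functionals of the stationary process\<close>

locale stationary_brcmnbinar1 = brcmnbinar1 +
  assumes stationary: "strictly_stationary M (count_space UNIV) X"
    and ergodic: "ergodic_process M (count_space UNIV) X"
    and fourth_moment: "\<And>s i. integrable M (\<lambda>\<omega>. real (X s \<omega> $ i) ^ 4)"
begin

abbreviation \<gamma> :: "real ^ 4" where "\<gamma> \<equiv> param m \<mu>"

lemma transition_measurable_X [measurable]:
  "(\<lambda>\<omega>. \<psi> (X a \<omega>) (X b \<omega>) :: 'z::topological_space) \<in> borel_measurable M"
  by (rule transition_measurable[OF X_measurable X_measurable]) simp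

lemma transition_measurable_X1: "(\<lambda>\<omega>. \<psi> (X a \<omega>) :: 'z::topological_space) \<in> borel_measurable M"
  by (rule transition_measurable_X[of "\<lambda>x y. \<psi> x" a a])

lemma transition_path_measurable:
  "(\<lambda>x. \<psi> (x a) (x b) :: 'z::topological_space) \<in> borel_measurable (PiM UNIV (\<lambda>_::nat. count_space (UNIV :: (nat ^ 2) set)))"
  by (rule transition_measurable) (auto intro!: measurable_component_singleton)

lemma path_measurable: "(\<lambda>\<omega> t. X (t + h) \<omega>) \<in> measurable M (PiM UNIV (\<lambda>_. count_space UNIV))"
  by (rule measurable_PiM_single') (auto simp: X_measurable)

lemma stationary_expectation:
  fixes \<psi> :: "nat ^ 2 \<Rightarrow> nat ^ 2 \<Rightarrow> 'z::{banach, second_countable_topology}"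
  shows "(\<integral>\<omega>. \<psi> (X (a + h) \<omega>) (X (b + h) \<omega>) \<partial>M) = (\<integral>\<omega>. \<psi> (X a \<omega>) (X b \<omega>) \<partial>M)"
proof -
  let ?P = "PiM UNIV (\<lambda>_::nat. count_space (UNIV :: (nat ^ 2) set))"
  have "(\<integral>\<omega>. \<psi> (X (a + h) \<omega>) (X (b + h) \<omega>) \<partial>M) = (\<integral>x. \<psi> (x a) (x b) \<partial>distr M ?P (\<lambda>\<omega> t. X (t + h) \<omega>))"
    by (subst integral_distr[OF path_measurable transition_path_measurable]) simp
  also have "\<dots> = (\<integral>x. \<psi> (x a) (x b) \<partial>distr M ?P (\<lambda>\<omega> t. X (t + 0) \<omega>))"
    using stationary unfolding strictly_stationary_def by simp
  also have "\<dots> = (\<integral>\<omega>. \<psi> (X a \<omega>) (X b \<omega>) \<partial>M)"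
    by (subst integral_distr[OF path_measurable transition_path_measurable]) simp
  finally show ?thesis .
qed

lemma ergodic_average:
  fixes \<psi> :: "nat ^ 2 \<Rightarrow> nat ^ 2 \<Rightarrow> real"
  assumes "integrable M (\<lambda>\<omega>. \<psi> (X 1 \<omega>) (X 2 \<omega>))"
  shows "AE \<omega> in M. (\<lambda>n. (\<Sum>k<n. \<psi> (X (k + 1) \<omega>) (X (k + 2) \<omega>)) / n) \<longlonglongrightarrow> (\<integral>\<omega>. \<psi> (X 1 \<omega>) (X 2 \<omega>) \<partial>M)"
  using stationary_ergodic_average[OF prob_space_axioms stationary ergodic transition_path_measurable, of \<psi> 1 2] assms
  by (simp add: add.commute)

lemma fourth_integrable_X: "fourth_integrable (\<lambda>\<omega>. real (X s \<omega> $ i))"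
  using fourth_moment by (simp add: fourth_integrable_def)

lemma integrable_X: "integrable M (\<lambda>\<omega>. real (X s \<omega> $ i))"
  by (rule fourth_integrable_integrable[OF fourth_integrable_X])

lemma fourth_integrable_affine_X: "fourth_integrable (\<lambda>\<omega>. a * real (X s \<omega> $ i) + b)"
  by (intro fourth_integrable_add fourth_integrable_cmult fourth_integrable_X fourth_integrable_const)

lemma fourth_integrable_design: "fourth_integrable (\<lambda>\<omega>. design l (X s \<omega>) $ i $ j)"
  using exhaust_2[of i] exhaust_4[of j] fourth_integrable_affine_X[of "1 / l" s 1 "1 / l"]
    fourth_integrable_affine_X[of "1 / l" s 2 "1 / l"]
  by (auto simp: design_def fourth_integrable_const add_divide_distrib)

lemma fourth_integrable_residual: "fourth_integrable (\<lambda>\<omega>. real (X t \<omega> $ i) - reg l \<gamma> (X s \<omega>) $ i)"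
proof -
  have "fourth_integrable (\<lambda>\<omega>. real (X t \<omega> $ i) + (- (m $ i / l) * real (X s \<omega> $ i) + (- (m $ i / l) - \<mu> $ i)))"
    by (intro fourth_integrable_add[OF fourth_integrable_X] fourth_integrable_affine_X)
  moreover have "real (X t \<omega> $ i) - reg l \<gamma> (X s \<omega>) $ i
      = real (X t \<omega> $ i) + (- (m $ i / l) * real (X s \<omega> $ i) + (- (m $ i / l) - \<mu> $ i))" for \<omega>
    unfolding reg_param by (simp add: add_divide_distrib distrib_left)
  ultimately show ?thesis by (simp only:)
qed

lemma integrable_gram: "integrable M (\<lambda>\<omega>. gram l (X s \<omega>))"
proof (intro integrable_vecI)
  fix i j
  have "gram l x $ i $ j = (\<Sum>k\<in>UNIV. design l x $ k $ i * design l x $ k $ j)" for x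
    by (simp add: gram_def matrix_matrix_mult_def transpose_def)
  then show "integrable M (\<lambda>\<omega>. gram l (X s \<omega>) $ i $ j)"
    by (simp only:) (intro Bochner_Integration.integrable_sum fourth_integrable_mult fourth_integrable_design)
qed

lemma score_component: "score l \<gamma> x y $ i = (\<Sum>k\<in>UNIV. design l x $ k $ i * (real (y $ k) - reg l \<gamma> x $ k))"
  by (simp add: score_def matrix_vector_mult_def transpose_def)

lemma integrable_score_outer: "integrable M (\<lambda>\<omega>. outer (score l \<gamma> (X s \<omega>) (X t \<omega>)) (score l \<gamma> (X s \<omega>) (X t \<omega>)))"
proof (intro integrable_vecI)
  fix i j
  have "outer d d $ i $ j = d $ i * d $ j" for d :: "real ^ 4" by (simp add: outer_def)
  then show "integrable M (\<lambda>\<omega>. outer (score l \<gamma> (X s \<omega>) (X t \<omega>)) (score l \<gamma> (X s \<omega>) (X t \<omega>)) $ i $ j)"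
    by (simp only: score_component sum_product)
      (intro Bochner_Integration.integrable_sum integrable_four_products fourth_integrable_design fourth_integrable_residual)
qed

section \<open>The matrices V and W and the limit covariance\<close>

definition V :: "real ^ 4 ^ 4" where "V = (\<integral>\<omega>. gram l (X 1 \<omega>) \<partial>M)"

definition W :: "real ^ 4 ^ 4" where
  "W = (\<integral>\<omega>. outer (score l \<gamma> (X 1 \<omega>) (X 2 \<omega>)) (score l \<gamma> (X 1 \<omega>) (X 2 \<omega>)) \<partial>M)"

lemma V\<^sub>1_eq: "V\<^sub>1 M l X \<gamma> t = V"
  using stationary_expectation[of "\<lambda>x y. gram l x" 0 1 0] stationary_expectation[of "\<lambda>x y. gram l x" 0 "t - 1" 0]
  by (simp add: V\<^sub>1_def V_def reg_jacobian_eq_design gram_def)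

text \<open>Stationarity gives the pair at times \<open>t - 1\<close> and \<open>t\<close> the law
  of the pair at times 1 and 2. For \<open>t = 0\<close> natural subtraction would collapse the pair
  to a single time, hence the assumption.\<close>

lemma W\<^sub>1_eq:
  assumes "t \<ge> 1" shows "W\<^sub>1 M l X \<gamma> t = W"
  using stationary_expectation[of "\<lambda>x y. outer (score l \<gamma> x y) (score l \<gamma> x y)" 0 1 1]
    stationary_expectation[of "\<lambda>x y. outer (score l \<gamma> x y) (score l \<gamma> x y)" 0 "t - 1" 1] assms
  by (simp add: W\<^sub>1_def W_def score_outer residual_def score_def numeral_2_eq_2)

lemma V_quadratic: "s \<bullet> (V *v r) = (\<integral>\<omega>. (design l (X 1 \<omega>) *v s) \<bullet> (design l (X 1 \<omega>) *v r) \<partial>M)"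
proof -
  have "s \<bullet> (V *v r) = (\<integral>\<omega>. s \<bullet> (gram l (X 1 \<omega>) *v r) \<partial>M)"
    unfolding V_def by (rule integral_bounded_linear[OF bounded_linear_quadratic integrable_gram, symmetric])
  then show ?thesis by (simp only: gram_quadratic)
qed

lemma integrable_score_mult: "integrable M (\<lambda>\<omega>. (s \<bullet> score l \<gamma> (X a \<omega>) (X b \<omega>)) * (r \<bullet> score l \<gamma> (X a \<omega>) (X b \<omega>)))"
  using integrable_bounded_linear[OF bounded_linear_quadratic integrable_score_outer]
  by (simp add: outer_quadratic)

lemma W_quadratic: "s \<bullet> (W *v r) = (\<integral>\<omega>. (s \<bullet> score l \<gamma> (X 1 \<omega>) (X 2 \<omega>)) * (r \<bullet> score l \<gamma> (X 1 \<omega>) (X 2 \<omega>)) \<partial>M)"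
  unfolding W_def outer_quadratic[symmetric]
  by (rule integral_bounded_linear[OF bounded_linear_quadratic integrable_score_outer, symmetric])

lemma matrix_entry: "A $ i $ j = axis i 1 \<bullet> (A *v axis j (1::real))"
  by (simp add: inner_axis' matrix_vector_mult_basis column_def)

lemma V_symmetric: "transpose V = V"
  by (simp add: vec_eq_iff transpose_def matrix_entry[of V] V_quadratic inner_commute)

text \<open>For \<open>s\<close> in the kernel, \<open>s \<bullet> (V *v s)\<close> is the mean
  square of the vector \<open>design l (X 1 \<omega>) *v s\<close>, which therefore vanishes almost
  surely. Each component is an affine relation for \<open>X 1\<close>; a nonzero slope would make
  \<open>X 1\<close> constant, and without slope the intercept vanishes too.\<close>

lemma V_invertible: "invertible V"
proof -
  have "s = 0" if "V *v s = 0" for s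
  proof -
    have di: "integrable M (\<lambda>\<omega>. (design l (X 1 \<omega>) *v s) \<bullet> (design l (X 1 \<omega>) *v s))"
      using integrable_bounded_linear[OF bounded_linear_quadratic integrable_gram[of 1], of s s]
      by (simp only: gram_quadratic)
    have "(\<integral>\<omega>. (design l (X 1 \<omega>) *v s) \<bullet> (design l (X 1 \<omega>) *v s) \<partial>M) = 0"
      using that V_quadratic[of s s] by simp
    then have "AE \<omega> in M. (design l (X 1 \<omega>) *v s) \<bullet> (design l (X 1 \<omega>) *v s) = 0"
      by (subst (asm) integral_nonneg_eq_0_iff_AE[OF di]) auto
    then have AE: "AE \<omega> in M. design l (X 1 \<omega>) *v s = 0" by eventually_elim simp
    have design: "(design l x *v s) $ 1 = s $ 1 * (real (x $ 1) + 1) / l + s $ 3"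
      "(design l x *v s) $ 2 = s $ 2 * (real (x $ 2) + 1) / l + s $ 4" for x
      unfolding reg_eq_design[symmetric] by (simp_all add: reg_def)
    have zero: "a = 0 \<and> b = 0" if "AE \<omega> in M. a * (real (X 1 \<omega> $ i) + 1) / l + b = 0" for a b i
    proof -
      have "a = 0"
      proof (rule ccontr)
        assume a: "a \<noteq> 0"
        have "AE \<omega> in M. real (X 1 \<omega> $ i) = - b * l / a - 1"
          using that
        proof eventually_elim
          case (elim \<omega>)
          then have "a * (real (X 1 \<omega> $ i) + 1) = - b * l" using l_pos by (simp add: field_simps)
          then show ?case using a by (simp add: field_simps)
        qed
        then show False using X_not_constant by blast
      qed
      with that show ?thesis by simp
    qed
    have "s $ 1 = 0 \<and> s $ 3 = 0" by (rule zero[of _ 1], use AE in eventually_elim) (simp flip: design)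
    moreover have "s $ 2 = 0 \<and> s $ 4 = 0" by (rule zero[of _ 2], use AE in eventually_elim) (simp flip: design)
    ultimately show "s = 0" by (simp add: vec_eq_iff forall_4)
  qed
  then show ?thesis
    unfolding invertible_left_inverse matrix_left_invertible_ker by blast
qed

definition V' :: "real ^ 4 ^ 4" where "V' = matrix_inv V"

lemma V'_inverse: "V' ** V = mat 1" "V ** V' = mat 1"
proof -
  have "V ** V' = mat 1 \<and> V' ** V = mat 1"
    using someI_ex[OF V_invertible[unfolded invertible_def]] unfolding V'_def matrix_inv_def .
  then show "V' ** V = mat 1" "V ** V' = mat 1" by auto
qed

lemma V'_symmetric: "transpose V' = V'"
proof -
  have "transpose V' ** V = transpose (V ** V')" by (simp add: matrix_transpose_mul V_symmetric)
  also have "\<dots> = mat 1" by (simp add: V'_inverse transpose_mat)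
  finally have "transpose V' ** (V ** V') = V'" by (simp add: matrix_mul_assoc)
  then show ?thesis by (simp add: V'_inverse)
qed

lemma V'_inner: "s \<bullet> (V' *v x) = (V' *v s) \<bullet> x"
  using dot_transpose_matrix[of V' s x] V'_symmetric by simp

text \<open>Reduces the limit covariance in direction \<open>s\<close> to the score covariance in
  direction \<open>V' *v s\<close>, where the scalar limit theorem is applied.\<close>

lemma sandwich_quadratic: "s \<bullet> ((V' ** W ** V') *v r) = (V' *v s) \<bullet> (W *v (V' *v r))"
  by (simp add: matrix_vector_mul_assoc[symmetric] V'_inner)

lemma sandwich_normal:
  obtains N where "is_multivariate_normal 0 (V' ** W ** V') N"
proof (rule multivariate_normal_exists)
  show "(V' ** W ** V') $ i $ j = (V' ** W ** V') $ j $ i" for i j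
    unfolding matrix_entry[of "V' ** W ** V'"] sandwich_quadratic W_quadratic by (simp add: mult.commute)
  show "0 \<le> x \<bullet> ((V' ** W ** V') *v x)" for x
    unfolding sandwich_quadratic W_quadratic by (intro integral_nonneg_AE) auto
qed (rule that)

section \<open>Scores as martingale differences\<close>

lemma cond_exp_residual:
  assumes t: "t \<ge> 1"
  shows "AE \<omega> in M. real_cond_exp M (past t) (\<lambda>\<omega>. real (X t \<omega> $ i) - reg l \<gamma> (X (t - 1) \<omega>) $ i) \<omega> = 0"
proof -
  interpret sigma_finite_subalgebra M "past t" by (rule sigma_finite_subalgebraI[OF past_subalgebra])
  have Xm: "X (t - 1) \<in> measurable (past t) (count_space UNIV)" using t by (intro X_past_measurable) auto
  have ri: "integrable M (\<lambda>\<omega>. reg l \<gamma> (X (t - 1) \<omega>) $ i)" unfolding reg_param using integrable_X by auto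
  have rm: "(\<lambda>\<omega>. reg l \<gamma> (X (t - 1) \<omega>) $ i) \<in> borel_measurable (past t)"
    using Xm by (rule measurable_compose) simp
  have "AE \<omega> in M. real_cond_exp M (past t) (\<lambda>\<omega>. real (X t \<omega> $ i)) \<omega> = reg l \<gamma> (X (t - 1) \<omega>) $ i"
    by (rule cond_exp_subalgebra[OF t integrable_X _ Xm]) (simp add: subalgebra_def)
  moreover note real_cond_exp_F_meas[OF ri rm] real_cond_exp_diff[OF integrable_X[of t i] ri]
  ultimately show ?thesis by eventually_elim simp
qed

text \<open>The score is linear in the residual with coefficients \<open>c k\<close> that depend on
  \<open>X (t - 1)\<close> only. They come out of the conditional expectation, and what remains is
  the residual, whose conditional mean is zero.\<close>

lemma score_orthogonal:
  assumes t: "t \<ge> 1" and h: "h \<in> borel_measurable (past t)"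
    and int: "integrable M (\<lambda>\<omega>. h \<omega> * (s \<bullet> score l \<gamma> (X (t - 1) \<omega>) (X t \<omega>)))"
  shows "(\<integral>\<omega>. h \<omega> * (s \<bullet> score l \<gamma> (X (t - 1) \<omega>) (X t \<omega>)) \<partial>M) = 0"
proof -
  interpret sigma_finite_subalgebra M "past t" by (rule sigma_finite_subalgebraI[OF past_subalgebra])
  define c where "c k \<omega> = (design l (X (t - 1) \<omega>) *v s) $ k" for k \<omega>
  define u where "u k \<omega> = real (X t \<omega> $ k) - reg l \<gamma> (X (t - 1) \<omega>) $ k" for k \<omega>
  have score: "s \<bullet> score l \<gamma> (X (t - 1) \<omega>) (X t \<omega>) = (\<Sum>k\<in>UNIV. c k \<omega> * u k \<omega>)" for \<omega>
    unfolding score_def inner_commute[of s] dot_transpose_matrix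
    by (simp add: inner_vec_def c_def u_def mult.commute)
  have Xm: "X (t - 1) \<in> measurable (past t) (count_space UNIV)" using t by (intro X_past_measurable) auto
  have cm: "c k \<in> borel_measurable (past t)" for k
    unfolding c_def using Xm by (rule measurable_compose) simp
  have u4: "fourth_integrable (u k)" for k unfolding u_def by (rule fourth_integrable_residual)
  have c4: "fourth_integrable (c k)" for k
    unfolding c_def matrix_vector_mult_def
    by (simp add: sum_4) (intro fourth_integrable_add fourth_integrable_design
        fourth_integrable_cmult[where c="s $ _", unfolded mult.commute[of "s $ _"]])
  have um: "u k \<in> borel_measurable M" for k using u4[of k] by (simp add: fourth_integrable_def)
  have cu: "integrable M (\<lambda>\<omega>. c k \<omega> * u k \<omega>)" for k by (rule fourth_integrable_mult[OF c4 u4])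
  have "AE \<omega> in M. real_cond_exp M (past t) (\<lambda>\<omega>. c k \<omega> * u k \<omega>) \<omega> = 0" for k
    using real_cond_exp_mult[OF cm[of k] um[of k] cu[of k]] cond_exp_residual[OF t, of k]
    by eventually_elim (simp add: u_def)
  then have "AE \<omega> in M. \<forall>k\<in>UNIV. real_cond_exp M (past t) (\<lambda>\<omega>. c k \<omega> * u k \<omega>) \<omega> = 0"
    by (intro AE_finite_allI) auto
  moreover have "AE \<omega> in M. real_cond_exp M (past t) (\<lambda>\<omega>. \<Sum>k\<in>UNIV. c k \<omega> * u k \<omega>) \<omega>
      = (\<Sum>k\<in>UNIV. real_cond_exp M (past t) (\<lambda>\<omega>. c k \<omega> * u k \<omega>) \<omega>)"
    by (rule real_cond_exp_sum) (rule cu)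
  ultimately have z: "AE \<omega> in M. real_cond_exp M (past t) (\<lambda>\<omega>. s \<bullet> score l \<gamma> (X (t - 1) \<omega>) (X t \<omega>)) \<omega> = 0"
    unfolding score by eventually_elim simp
  have "(\<integral>\<omega>. h \<omega> * (s \<bullet> score l \<gamma> (X (t - 1) \<omega>) (X t \<omega>)) \<partial>M)
      = (\<integral>\<omega>. h \<omega> * real_cond_exp M (past t) (\<lambda>\<omega>. s \<bullet> score l \<gamma> (X (t - 1) \<omega>) (X t \<omega>)) \<omega> \<partial>M)"
    by (rule real_cond_exp_intg(2)[OF int h, symmetric]) measurable
  also have "\<dots> = (\<integral>\<omega>. 0 \<partial>M)"
    using z measurable_from_subalg[OF past_subalgebra h]
    by (intro integral_cong_AE) (auto elim: eventually_mono)
  finally show ?thesis by simp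
qed

text \<open>The sample starts at time 1, so the difference with index \<open>k\<close> belongs to
  the transition from \<open>X (k + 1)\<close> to \<open>X (k + 2)\<close>;
  \<open>past (k + 2)\<close> contains the states up to time \<open>k + 1\<close>.\<close>

lemma score_martingale_differences:
  "martingale_differences M (\<lambda>k. past (k + 2)) (\<lambda>k \<omega>. s \<bullet> score l \<gamma> (X (k + 1) \<omega>) (X (k + 2) \<omega>)) (s \<bullet> (W *v s))"
proof
  fix k
  show "subalgebra M (past (k + 2))" by (rule past_subalgebra)
  show "integrable M (\<lambda>\<omega>. (s \<bullet> score l \<gamma> (X (k + 1) \<omega>) (X (k + 2) \<omega>))\<^sup>2)"
    unfolding power2_eq_square by (rule integrable_score_mult)
  show "(\<integral>\<omega>. (s \<bullet> score l \<gamma> (X (k + 1) \<omega>) (X (k + 2) \<omega>))\<^sup>2 \<partial>M) = s \<bullet> (W *v s)"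
    unfolding W_quadratic power2_eq_square
    using stationary_expectation[of "\<lambda>x y. (s \<bullet> score l \<gamma> x y) * (s \<bullet> score l \<gamma> x y)" 1 k 2]
    by (simp add: add.commute)
  show "(\<lambda>\<omega>. s \<bullet> score l \<gamma> (X (j + 1) \<omega>) (X (j + 2) \<omega>)) \<in> borel_measurable (past (k + 2))" if "j < k" for j
    by (rule transition_measurable[where \<phi>="\<lambda>x y. s \<bullet> score l \<gamma> x y"])
      (use that in \<open>auto intro!: X_past_measurable\<close>)
  show "(\<integral>\<omega>. h \<omega> * (s \<bullet> score l \<gamma> (X (k + 1) \<omega>) (X (k + 2) \<omega>)) \<partial>M) = 0"
    if "h \<in> borel_measurable (past (k + 2))"
      "integrable M (\<lambda>\<omega>. h \<omega> * (s \<bullet> score l \<gamma> (X (k + 1) \<omega>) (X (k + 2) \<omega>)))" for h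
    using score_orthogonal[of "k + 2" h s] that by simp
qed

text \<open>A fixed direction \<open>s\<close> makes the differences scalar, and the ergodic theorem
  applied to their squares supplies the law of large numbers that McLeish's argument asks
  for.\<close>

lemma score_central_limit:
  "(\<lambda>n. \<integral>\<omega>. iexp ((\<Sum>k<n. s \<bullet> score l \<gamma> (X (k + 1) \<omega>) (X (k + 2) \<omega>)) / sqrt n) \<partial>M)
    \<longlonglongrightarrow> exp (- (s \<bullet> (W *v s)) / 2)"
proof -
  interpret md: martingale_differences M "\<lambda>k. past (k + 2)" "\<lambda>k \<omega>. s \<bullet> score l \<gamma> (X (k + 1) \<omega>) (X (k + 2) \<omega>)" "s \<bullet> (W *v s)"
    by (rule score_martingale_differences)
  have "AE \<omega> in M. (\<lambda>n. (\<Sum>k<n. (s \<bullet> score l \<gamma> (X (k + 1) \<omega>) (X (k + 2) \<omega>))\<^sup>2) / n) \<longlonglongrightarrow> s \<bullet> (W *v s)"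
    using ergodic_average[of "\<lambda>x y. (s \<bullet> score l \<gamma> x y)\<^sup>2"]
    unfolding W_quadratic power2_eq_square using integrable_score_mult by blast
  then show ?thesis by (rule md.central_limit)
qed

lemma gram_average: "AE \<omega> in M. (\<lambda>n. (\<Sum>k<n. gram l (X (k + 1) \<omega>) $ i $ j) / n) \<longlonglongrightarrow> V $ i $ j"
proof -
  have "integrable M (\<lambda>\<omega>. gram l (X 1 \<omega>) $ i $ j)" "V $ i $ j = (\<integral>\<omega>. gram l (X 1 \<omega>) $ i $ j \<partial>M)"
    unfolding matrix_entry[of _ i j] V_def
    by (rule integrable_bounded_linear[OF bounded_linear_quadratic integrable_gram],
        rule integral_bounded_linear[OF bounded_linear_quadratic integrable_gram, symmetric])
  then show ?thesis using ergodic_average[of "\<lambda>x y. gram l x $ i $ j"] by simp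
qed

lemma score_average:
  "AE \<omega> in M. (\<lambda>n. (\<Sum>k<n. score l \<gamma> (X (k + 1) \<omega>) (X (k + 2) \<omega>) $ i) / n) \<longlonglongrightarrow> 0"
proof -
  have int: "integrable M (\<lambda>\<omega>. score l \<gamma> (X 1 \<omega>) (X 2 \<omega>) $ i)"
    unfolding score_component
    by (intro Bochner_Integration.integrable_sum fourth_integrable_mult fourth_integrable_design fourth_integrable_residual)
  \<comment> \<open>A martingale difference is orthogonal to the constant 1.\<close>
  moreover have "(\<integral>\<omega>. score l \<gamma> (X 1 \<omega>) (X 2 \<omega>) $ i \<partial>M) = 0"
    using score_orthogonal[of 2 "\<lambda>_. 1" "axis i 1"] int by (simp add: inner_axis')
  ultimately show ?thesis using ergodic_average[of "\<lambda>x y. score l \<gamma> x y $ i"] by simp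
qed

section \<open>The estimation error and its linearisation\<close>

definition score_sum :: "nat \<Rightarrow> 'a \<Rightarrow> real ^ 4" where
  "score_sum n \<omega> = (\<Sum>k<n. score l \<gamma> (X (k + 1) \<omega>) (X (k + 2) \<omega>))"

definition gram_error :: "nat \<Rightarrow> 'a \<Rightarrow> real ^ 4 ^ 4" where
  "gram_error n \<omega> = V' ** (V - (1 / real n) *\<^sub>R (\<Sum>k<n. gram l (X (k + 1) \<omega>)))"

text \<open>The sum of the moduli of all entries dominates the operator norm, and as a finite
  expression in the entries it inherits their measurability and limits.\<close>

definition gram_error_size :: "nat \<Rightarrow> 'a \<Rightarrow> real" where
  "gram_error_size n \<omega> = (\<Sum>i\<in>UNIV. \<Sum>j\<in>UNIV. \<bar>gram_error n \<omega> $ i $ j\<bar>)"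

lemma gram_error_entry:
  "gram_error n \<omega> $ i $ j = (\<Sum>k\<in>UNIV. V' $ i $ k * (V $ k $ j - (\<Sum>q<n. gram l (X (q + 1) \<omega>) $ k $ j) / n))"
  by (simp add: gram_error_def matrix_matrix_mult_def)

lemma gram_error_size_measurable [measurable]: "gram_error_size n \<in> borel_measurable M"
proof -
  have [measurable]: "(\<lambda>\<omega>. gram l (X q \<omega>) $ i $ j) \<in> borel_measurable M" for q i j
    by (rule transition_measurable_X1)
  show ?thesis unfolding gram_error_size_def gram_error_entry by measurable
qed

lemma gram_error_size_nonneg: "0 \<le> gram_error_size n \<omega>"
  unfolding gram_error_size_def by (intro sum_nonneg) auto

lemma gram_error_size_tendsto: "AE \<omega> in M. (\<lambda>n. gram_error_size n \<omega>) \<longlonglongrightarrow> 0"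
proof -
  have "AE \<omega> in M. \<forall>i j. (\<lambda>n. (\<Sum>k<n. gram l (X (k + 1) \<omega>) $ i $ j) / n) \<longlonglongrightarrow> V $ i $ j"
    unfolding AE_all_countable by (intro allI gram_average)
  then show ?thesis
  proof eventually_elim
    case (elim \<omega>)
    have "(\<lambda>n. gram_error n \<omega> $ i $ j) \<longlonglongrightarrow> (\<Sum>k\<in>UNIV. V' $ i $ k * (V $ k $ j - V $ k $ j))" for i j
      unfolding gram_error_entry using elim by (intro tendsto_sum tendsto_mult tendsto_diff tendsto_const) auto
    then have "(\<lambda>n. gram_error n \<omega> $ i $ j) \<longlonglongrightarrow> 0" for i j by simp
    then have "(\<lambda>n. gram_error_size n \<omega>) \<longlonglongrightarrow> (\<Sum>i\<in>(UNIV::4 set). \<Sum>j\<in>(UNIV::4 set). \<bar>0\<bar>)"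
      unfolding gram_error_size_def by (intro tendsto_sum tendsto_rabs) auto
    then show ?case by simp
  qed
qed

text \<open>\<open>Suc n\<close> observations contain \<open>n\<close> transitions, so averages are
  divided by \<open>n\<close>. The case \<open>n = 0\<close> is included: there
  \<open>1 / real n\<close> is 0, \<open>gram_error\<close> is the identity and the bound still
  holds.\<close>

lemma estimation_error_bound:
  assumes "is_arg_min (S\<^sub>1 l (Suc n) (\<lambda>t. X t \<omega>)) (\<lambda>_. True) g"
  shows "norm ((g - \<gamma>) - V' *v ((1 / real n) *\<^sub>R score_sum n \<omega>)) \<le> gram_error_size n \<omega> * norm (g - \<gamma>)"
proof -
  have eq: "(\<Sum>k<n. gram l (X (k + 1) \<omega>)) *v (g - \<gamma>) = score_sum n \<omega>"
    using CLS_normal_equation[OF assms, of \<gamma>] by (simp add: score_sum_def)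
  have "gram_error n \<omega> *v h = (V' ** V) *v h
      - V' *v ((1 / real n) *\<^sub>R ((\<Sum>k<n. gram l (X (k + 1) \<omega>)) *v h))" for h
    by (simp only: gram_error_def matrix_vector_mul_assoc[symmetric] matrix_vector_mult_diff_rdistrib
        matrix_vector_mult_diff_distrib scaleR_matrix_vector_assoc[symmetric])
  from this[of "g - \<gamma>"] have "(g - \<gamma>) - V' *v ((1 / real n) *\<^sub>R score_sum n \<omega>) = gram_error n \<omega> *v (g - \<gamma>)"
    by (simp only: V'_inverse matrix_vector_mul_lid eq)
  then show ?thesis unfolding gram_error_size_def by (simp only: matrix_vector_norm_le)
qed

definition rescaled_score :: "nat \<Rightarrow> 'a \<Rightarrow> real ^ 4" where
  "rescaled_score n \<omega> = V' *v ((1 / sqrt (real n)) *\<^sub>R score_sum n \<omega>)"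

lemma rescaled_score_measurable [measurable]: "rescaled_score n \<in> borel_measurable M"
proof -
  have [measurable]: "score_sum n \<in> borel_measurable M"
    unfolding score_sum_def[abs_def] by (intro borel_measurable_sum transition_measurable_X)
  have "(*v) V' \<in> borel_measurable borel"
    by (intro borel_measurable_continuous_onI linear_continuous_on matrix_vector_mul_bounded_linear)
  then show ?thesis unfolding rescaled_score_def[abs_def] by measurable
qed

lemma inner_rescaled_score:
  "s \<bullet> rescaled_score n \<omega> = (\<Sum>k<n. (V' *v s) \<bullet> score l \<gamma> (X (k + 1) \<omega>) (X (k + 2) \<omega>)) / sqrt n"
  unfolding rescaled_score_def V'_inner score_sum_def by (simp add: inner_sum_right)

text \<open>Each coordinate is a sum of \<open>n\<close> orthogonal differences divided by
  \<open>sqrt n\<close>, so its second moment does not grow. This is the tightness input for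
  convergence in law.\<close>

lemma rescaled_score_second_moment:
  "integrable M (\<lambda>\<omega>. (norm (rescaled_score n \<omega>))\<^sup>2)"
  "(\<integral>\<omega>. (norm (rescaled_score n \<omega>))\<^sup>2 \<partial>M) \<le> (\<Sum>i\<in>UNIV. (V' *v axis i 1) \<bullet> (W *v (V' *v axis i 1)))"
proof -
  define r where "r i = V' *v axis i 1" for i
  define Q where "Q i n \<omega> = (\<Sum>k<n. r i \<bullet> score l \<gamma> (X (k + 1) \<omega>) (X (k + 2) \<omega>))" for i n \<omega>
  have Q: "integrable M (\<lambda>\<omega>. (Q i n \<omega>)\<^sup>2)" "(\<integral>\<omega>. (Q i n \<omega>)\<^sup>2 \<partial>M) = n * (r i \<bullet> (W *v r i))" for i n
  proof -
    interpret md: martingale_differences M "\<lambda>k. past (k + 2)"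
      "\<lambda>k \<omega>. r i \<bullet> score l \<gamma> (X (k + 1) \<omega>) (X (k + 2) \<omega>)" "r i \<bullet> (W *v r i)"
      by (rule score_martingale_differences)
    show "integrable M (\<lambda>\<omega>. (Q i n \<omega>)\<^sup>2)" "(\<integral>\<omega>. (Q i n \<omega>)\<^sup>2 \<partial>M) = n * (r i \<bullet> (W *v r i))"
      unfolding Q_def by (rule md.second_moment_sum)+
  qed
  have norm: "(norm (rescaled_score n \<omega>))\<^sup>2 = (\<Sum>i\<in>UNIV. (Q i n \<omega>)\<^sup>2 / n)" for \<omega>
  proof -
    have "rescaled_score n \<omega> $ i = Q i n \<omega> / sqrt n" for i
      using inner_rescaled_score[of "axis i 1" n \<omega>] by (simp add: inner_axis' Q_def r_def)
    then show ?thesis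
      by (simp add: power2_norm_eq_inner inner_vec_def power2_eq_square[symmetric] power_divide)
  qed
  show "integrable M (\<lambda>\<omega>. (norm (rescaled_score n \<omega>))\<^sup>2)" unfolding norm using Q by auto
  have nonneg: "0 \<le> r i \<bullet> (W *v r i)" for i unfolding W_quadratic by (intro integral_nonneg_AE) auto
  have "(\<integral>\<omega>. (norm (rescaled_score n \<omega>))\<^sup>2 \<partial>M) = (\<Sum>i\<in>UNIV. n * (r i \<bullet> (W *v r i)) / n)"
    unfolding norm using Q by (simp add: Bochner_Integration.integral_sum)
  \<comment> \<open>For \<open>n = 0\<close> division by zero makes the left side 0; for all other
    \<open>n\<close> the two sides agree.\<close>
  also have "\<dots> \<le> (\<Sum>i\<in>UNIV. r i \<bullet> (W *v r i))"
    using nonneg by (intro sum_mono) (cases "n = 0"; simp)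
  finally show "(\<integral>\<omega>. (norm (rescaled_score n \<omega>))\<^sup>2 \<partial>M) \<le> (\<Sum>i\<in>UNIV. (V' *v axis i 1) \<bullet> (W *v (V' *v axis i 1)))"
    by (simp add: r_def)
qed

lemma CLS_strongly_consistent:
  assumes "is_CLS_estimator M l X \<gamma>hat"
  shows "AE \<omega> in M. (\<lambda>n. \<gamma>hat n \<omega>) \<longlonglongrightarrow> \<gamma>"
proof -
  have "AE \<omega> in M. \<forall>i. (\<lambda>n. (\<Sum>k<n. score l \<gamma> (X (k + 1) \<omega>) (X (k + 2) \<omega>) $ i) / n) \<longlonglongrightarrow> 0"
    unfolding AE_all_countable by (intro allI score_average)
  then show ?thesis
    using gram_error_size_tendsto AE_space
  proof eventually_elim
    case (elim \<omega>)
    have "(\<lambda>n. (1 / real n) *\<^sub>R score_sum n \<omega>) \<longlonglongrightarrow> 0"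
      using elim(1) by (intro vec_tendstoI) (simp add: score_sum_def)
    from bounded_linear.tendsto[OF matrix_vector_mul_bounded_linear[of V'] this]
    have u: "(\<lambda>n. V' *v ((1 / real n) *\<^sub>R score_sum n \<omega>)) \<longlonglongrightarrow> 0" by simp
    have "(\<lambda>n. \<gamma>hat (Suc n) \<omega> - \<gamma>) \<longlonglongrightarrow> 0"
    proof (rule perturbation_tendsto_0[OF _ elim(2) u])
      show "norm (\<gamma>hat (Suc n) \<omega> - \<gamma> - V' *v ((1 / real n) *\<^sub>R score_sum n \<omega>)) \<le> gram_error_size n \<omega> * norm (\<gamma>hat (Suc n) \<omega> - \<gamma>)" for n
        using assms elim(3) unfolding is_CLS_estimator_def by (intro estimation_error_bound) blast
    qed
    then have "(\<lambda>n. \<gamma>hat (Suc n) \<omega>) \<longlonglongrightarrow> \<gamma>" by (simp add: LIM_zero_iff)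
    then show ?case by (rule LIMSEQ_imp_Suc)
  qed
qed

text \<open>The error bound is homogeneous in the error, so it survives multiplication by
  \<open>sqrt n\<close> and compares the normalised error with \<open>rescaled_score n\<close>.
  Taking \<open>Suc n\<close> observations turns the factor \<open>sqrt (real (n - 1))\<close> into
  \<open>sqrt n\<close>.\<close>

lemma CLS_asymptotically_normal:
  assumes est: "is_CLS_estimator M l X \<gamma>hat" and N: "is_multivariate_normal 0 (V' ** W ** V') N"
  shows "converges_in_law M (\<lambda>n \<omega>. sqrt (real (n - 1)) *\<^sub>R (\<gamma>hat n \<omega> - \<gamma>)) N"
proof -
  let ?Y = "\<lambda>n \<omega>. sqrt (real (n - 1)) *\<^sub>R (\<gamma>hat n \<omega> - \<gamma>)"
  have [measurable]: "\<gamma>hat n \<in> borel_measurable M" for n using est by (simp add: is_CLS_estimator_def)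
  have YS [measurable]: "?Y n \<in> borel_measurable M" for n by measurable
  have scale: "sqrt (real n) * (1 / real n) = 1 / sqrt (real n)" for n
    by (cases "n = 0") (auto simp: real_div_sqrt field_simps)
  have bound: "norm (?Y (Suc n) \<omega> - rescaled_score n \<omega>) \<le> gram_error_size n \<omega> * norm (?Y (Suc n) \<omega>)"
    if "\<omega> \<in> space M" for n \<omega>
  proof -
    have "norm (\<gamma>hat (Suc n) \<omega> - \<gamma> - V' *v ((1 / real n) *\<^sub>R score_sum n \<omega>)) \<le> gram_error_size n \<omega> * norm (\<gamma>hat (Suc n) \<omega> - \<gamma>)"
      using est that unfolding is_CLS_estimator_def by (intro estimation_error_bound) blast
    then have "sqrt (real n) * norm (\<gamma>hat (Suc n) \<omega> - \<gamma> - V' *v ((1 / real n) *\<^sub>R score_sum n \<omega>))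
        \<le> sqrt (real n) * (gram_error_size n \<omega> * norm (\<gamma>hat (Suc n) \<omega> - \<gamma>))"
      by (intro mult_left_mono) auto
    moreover have "?Y (Suc n) \<omega> - rescaled_score n \<omega>
        = sqrt (real n) *\<^sub>R (\<gamma>hat (Suc n) \<omega> - \<gamma> - V' *v ((1 / real n) *\<^sub>R score_sum n \<omega>))"
      unfolding rescaled_score_def scale[symmetric] scaleR_scaleR[symmetric]
      by (simp add: matrix_vector_mult_scaleR scaleR_diff_right)
    ultimately show ?thesis by (simp add: mult.left_commute)
  qed
  have "converges_in_law M (\<lambda>n. ?Y (Suc n)) N"
  proof (rule converges_in_lawI[where U=rescaled_score])
    show "prob_space M" by (rule prob_space_axioms)
    show "prob_space N" "sets N = sets borel" using N by (auto simp: is_multivariate_normal_def)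
    show "(\<lambda>n. \<integral>\<omega>. min 1 (norm (?Y (Suc n) \<omega> - rescaled_score n \<omega>)) \<partial>M) \<longlonglongrightarrow> 0"
      by (rule perturbation_in_probability[OF rescaled_score_measurable YS gram_error_size_measurable bound
            gram_error_size_nonneg gram_error_size_tendsto rescaled_score_second_moment])
    fix s
    have "(\<integral>y. iexp (s \<bullet> y) \<partial>N) = exp (- ((V' *v s) \<bullet> (W *v (V' *v s))) / 2)"
      using N unfolding is_multivariate_normal_def sandwich_quadratic by (simp flip: exp_of_real)
    then show "(\<lambda>n. \<integral>\<omega>. iexp (s \<bullet> rescaled_score n \<omega>) \<partial>M) \<longlonglongrightarrow> (\<integral>y. iexp (s \<bullet> y) \<partial>N)"
      unfolding inner_rescaled_score using score_central_limit[of "V' *v s"] by simp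
  qed (use rescaled_score_second_moment in auto)
  then show ?thesis
    unfolding converges_in_law_def using YS by (auto intro: LIMSEQ_imp_Suc)
qed

end

text \<open>Invertibility belongs to the conclusion because \<open>matrix_inv\<close> is defined by
  choice and is an inverse only for an invertible matrix. The first clause is what entitles
  \<open>reg\<close> to be called the conditional mean. The time \<open>t\<close> is arbitrary,
  since stationarity makes both matrices independent of it.\<close>

theorem theorem3p1:
  fixes M :: "'a measure"
    and l :: real
    and m \<mu> \<sigma>2 :: "real ^ 2"
    and \<phi> :: real
    and f\<^sub>Z :: "(nat ^ 2) pmf"
    and \<alpha> :: "nat \<Rightarrow> 'a \<Rightarrow> real ^ 2"
    and G :: "nat \<Rightarrow> nat \<Rightarrow> 'a \<Rightarrow> nat ^ 2"
    and Z X :: "nat \<Rightarrow> 'a \<Rightarrow> nat ^ 2"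
    and \<gamma>hat :: "nat \<Rightarrow> 'a \<Rightarrow> real ^ 4"
    and \<gamma> :: "real ^ 4"
    and t :: nat
  assumes "brcmnbinar1 M l m \<mu> \<sigma>2 \<phi> f\<^sub>Z \<alpha> G Z X"
    and "strictly_stationary M (count_space UNIV) X"
    and "ergodic_process M (count_space UNIV) X"
    and "\<And>s i. integrable M (\<lambda>\<omega>. real (X s \<omega> $ i) ^ 4)"
    and "\<gamma> = param m \<mu>"
    and "is_CLS_estimator M l X \<gamma>hat"
    and "t \<ge> 1"
  shows "(\<forall>i. AE \<omega> in M.
            real_cond_exp M (vimage_algebra (space M) (X (t - 1)) (count_space UNIV))
              (\<lambda>\<omega>. real (X t \<omega> $ i)) \<omega> = reg l \<gamma> (X (t - 1) \<omega>) $ i)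
       \<and> (AE \<omega> in M. (\<lambda>n. \<gamma>hat n \<omega>) \<longlonglongrightarrow> \<gamma>)
       \<and> invertible (V\<^sub>1 M l X \<gamma> t)
       \<and> (\<exists>N. is_multivariate_normal 0
                (matrix_inv (V\<^sub>1 M l X \<gamma> t) ** W\<^sub>1 M l X \<gamma> t ** matrix_inv (V\<^sub>1 M l X \<gamma> t)) N
            \<and> converges_in_law M (\<lambda>n \<omega>. sqrt (real (n - 1)) *\<^sub>R (\<gamma>hat n \<omega> - \<gamma>)) N)"
proof -
  interpret stationary_brcmnbinar1 M l m \<mu> \<sigma>2 \<phi> f\<^sub>Z \<alpha> G Z X
    using assms(1-4) by (simp add: stationary_brcmnbinar1_def stationary_brcmnbinar1_axioms_def)
  have \<gamma>: "\<gamma> = param m \<mu>" by fact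
  let ?F = "vimage_algebra (space M) (X (t - 1)) (count_space UNIV)"
  have XF: "X (t - 1) \<in> measurable ?F (count_space UNIV)"
    by (rule measurable_vimage_algebra1) simp
  have Xp: "X (t - 1) \<in> measurable (past t) (count_space UNIV)"
    using assms(7) by (intro X_past_measurable) simp
  have sp: "space (past t) = space M" by (simp add: past_def)
  \<comment> \<open>The claim conditions on \<open>X (t - 1)\<close> alone, whereas the one-step
    mean was computed for events of the whole past; the inclusion transfers it.\<close>
  have "subalgebra (past t) ?F"
    using Xp unfolding subalgebra_def measurable_iff_sets sp by simp
  then have "AE \<omega> in M. real_cond_exp M ?F (\<lambda>\<omega>. real (X t \<omega> $ i)) \<omega> = reg l \<gamma> (X (t - 1) \<omega>) $ i" for i
    unfolding \<gamma> by (intro cond_exp_subalgebra assms(7) integrable_X XF)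
  moreover have "AE \<omega> in M. (\<lambda>n. \<gamma>hat n \<omega>) \<longlonglongrightarrow> \<gamma>"
    unfolding \<gamma> by (rule CLS_strongly_consistent[OF assms(6)])
  moreover obtain N where "is_multivariate_normal 0 (V' ** W ** V') N" by (rule sandwich_normal)
  ultimately show ?thesis
    using CLS_asymptotically_normal[OF assms(6)] V_invertible
    unfolding \<gamma> V\<^sub>1_eq W\<^sub>1_eq[OF assms(7)] V'_def by blast
qed

end
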